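(* The category $\mathbf{CPMet}$ of complete intrinsic metric spaces is locally $\aleph_1$-presentable.
   Context: Metric spaces are allowed infinite distances: a metric takes values in $[0,\infty]$. $\mathbf{CMet}$ is the category of complete metric spaces with non-expansive (1-Lipschitz) maps as morphisms. The length of a continuous curve $f:[a,b]\to (X,d)$ is $\ell(f)=\sup\sum_i d(f(t_i),f(t_{i+1}))$ over all finite subdivisions $a=t_0\le t_1\le\cdots\le t_n=b$. The intrinsic (path) metric attached to $d$ is $d_\ell(x,y)=\inf \ell(f)$ over all continuous curves $f:[a,b]\to X$ with $f(a)=x$, $f(b)=y$ (with $\inf\emptyset=\infty$). $(X,d)$ is an intrinsic (path) metric space if $d=d_\ell$. $\mathbf{CPMet}$ is the full subcategory of $\mathbf{CMet}$ consisting of complete intrinsic metric spaces. For a regular cardinal $\kappa$, a poset is $\kappa$-directed if every subset of cardinality $<\kappa$ has an upper bound; a $\kappa$-directed colimit is a colimit of a functor on a $\kappa$-directed poset; an object $x$ of $\mathcal C$ is $\kappa$-presentable if $\mathrm{hom}_{\mathcal C}(x,-)$ preserves $\kappa$-directed colimits. In the standard sense, $\mathcal C$ is locally $\kappa$-presentable if it is cocomplete and has a set of $\kappa$-presentable objects such that every object is a $\kappa$-directed colimit of objects from that set. *)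

theory Defs
  imports Complex_Main
    "HOL-Library.FuncSet"
    "HOL-Library.Extended_Nonnegative_Real"
begin

unbundle cardinal_syntax

section \<open>Size\<close>

text \<open>
  HOL has no type of all sets, so ``small'' and ``the category of all spaces'' are read
  relative to a type \<open>'u\<close>: a set (of elements of any type) is small if it has fewer elements
  than \<open>'u\<close>, and spaces are carried by small subsets of \<open>'u\<close>. The type \<open>'u\<close> has to be closed
  under set-theoretic constructions, so its cardinality is required to be infinite, regular, and
  to exceed \<open>\<mu>\<^sup>\<omega>\<close> whenever it exceeds \<open>\<mu>\<close>.

  Grothendieck universes (strongly inaccessible cardinals) satisfy this, but strong
  inaccessibility is deliberately not required, since HOL does not prove that there is an
  inaccessible type. By contrast \<open>(2\<^sup>\<mu>)\<^sup>+\<close> qualifies for every infinite \<open>\<mu>\<close>, so that every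
  type embeds as a small set into a universe type; see \<open>universe_type_suc\<close>.
\<close>

definition small :: "'u itself \<Rightarrow> 'b set \<Rightarrow> bool" where
  "small U A \<longleftrightarrow> |A| <o |UNIV :: 'u set|"

definition universe_type :: "'u itself \<Rightarrow> bool" where
  "universe_type U \<longleftrightarrow>
     infinite (UNIV :: 'u set) \<and> regularCard |UNIV :: 'u set| \<and>
     (\<forall>A :: 'u set. small U A \<longrightarrow> small U {s :: nat \<Rightarrow> 'u. range s \<subseteq> A})"

lemma universe_type_suc:
  "universe_type TYPE((nat + 'a) set suc)"
  "small TYPE((nat + 'a) set suc) (UNIV :: 'a set)"
proof -
  let ?P = "|UNIV :: (nat + 'a) set set|"
  let ?U = "|UNIV :: (nat + 'a) set suc set|"
  have U: "?U =o card_suc ?P"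
    using card_of_unique[OF card_order_card_suc[OF card_of_card_order_on]]
    by (rule ordIso_symmetric)
  have infP: "infinite (UNIV :: (nat + 'a) set set)"
    by (simp add: Finite_Set.finite_set finite_Plus_UNIV_iff)
  have PU: "?P <o ?U"
    using card_suc_greater[OF card_of_card_order_on] ordIso_symmetric[OF U]
    by (rule ordLess_ordIso_trans)
  have le: "|A| \<le>o ?P" if "|A| <o ?U" for A :: "'c set"
  proof -
    have "cardSuc ?P =o card_suc ?P" by (rule cardSuc_ordIso_card_suc[OF card_of_card_order_on])
    from ordIso_symmetric[OF this] have "|A| <o cardSuc ?P"
      by (rule ordLess_ordIso_trans[OF ordLess_ordIso_trans[OF that U]])
    then show ?thesis
      using cardSuc_ordLeq_ordLess[OF card_of_Card_order card_of_Card_order] by blast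
  qed
  have CinfP: "Cinfinite ?P" using infP by (simp add: cinfinite_def Field_card_of card_of_card_order_on)
  then have reg: "regularCard (card_suc ?P)"
    by (rule regularCard_card_suc[OF card_of_card_order_on])
  have infU: "infinite (UNIV :: (nat + 'a) set suc set)"
    by (rule card_of_ordLeq_infinite[OF ordLess_imp_ordLeq[OF PU] infP])
  have regU: "regularCard ?U"
    by (rule regularCard_ordIso[OF ordIso_symmetric[OF U]
          Cinfinite_card_suc[OF CinfP card_of_card_order_on] reg])
  have pow: "|{s :: nat \<Rightarrow> (nat + 'a) set suc. range s \<subseteq> A}| <o ?U"
    if A: "|A| <o ?U" for A :: "(nat + 'a) set suc set"
  proof -
    obtain f where f: "inj_on f A" "f ` A \<subseteq> (UNIV :: (nat + 'a) set set)"
      using le[OF A] unfolding card_of_ordLeq[symmetric] by blast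
    obtain p :: "nat \<times> (nat + 'a) \<Rightarrow> nat + 'a" where p: "inj p"
    proof -
      have i: "infinite (UNIV :: (nat + 'a) set)" by (simp add: finite_Plus_UNIV_iff)
      have n: "|UNIV :: nat set| \<le>o |UNIV :: (nat + 'a) set|"
        unfolding card_of_ordLeq[symmetric] by (rule exI[of _ Inl]) simp
      have "|(UNIV :: nat set) \<times> (UNIV :: (nat + 'a) set)| \<le>o |UNIV :: (nat + 'a) set|"
        by (rule card_of_Times_ordLeq_infinite_Field[OF _ n ordLeq_refl[OF card_of_Card_order]
              card_of_Card_order]) (use i in \<open>simp add: Field_card_of\<close>)
      then have "|UNIV :: (nat \<times> (nat + 'a)) set| \<le>o |UNIV :: (nat + 'a) set|"
        by simp
      then show thesis using that unfolding card_of_ordLeq[symmetric] by blast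
    qed
    define g where "g s = p ` {(n, x). x \<in> f (s n)}" for s :: "nat \<Rightarrow> (nat + 'a) set suc"
    have "inj_on g {s. range s \<subseteq> A}"
    proof (rule inj_onI)
      fix s t assume s: "s \<in> {s. range s \<subseteq> A}" and t: "t \<in> {s. range s \<subseteq> A}" and "g s = g t"
      then have "{(n, x). x \<in> f (s n)} = {(n, x). x \<in> f (t n)}"
        using p by (simp add: g_def inj_image_eq_iff)
      then have "f (s n) = f (t n)" for n by auto
      moreover have "s n \<in> A" "t n \<in> A" for n using s t by auto
      ultimately have "s n = t n" for n using f(1) by (meson inj_onD)
      then show "s = t" by (rule ext)
    qed
    then have "|{s :: nat \<Rightarrow> (nat + 'a) set suc. range s \<subseteq> A}| \<le>o ?P"
      unfolding card_of_ordLeq[symmetric] by blast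
    then show ?thesis using PU by (rule ordLeq_ordLess_trans)
  qed
  show "universe_type TYPE((nat + 'a) set suc)"
    using infU regU pow by (simp add: universe_type_def small_def)
  have "|UNIV :: 'a set| \<le>o ?P"
    unfolding card_of_ordLeq[symmetric] by (rule exI[of _ "\<lambda>x. {Inr x}"]) (auto simp: inj_on_def)
  then show "small TYPE((nat + 'a) set suc) (UNIV :: 'a set)"
    unfolding small_def using PU by (rule ordLeq_ordLess_trans)
qed

definition regular_cardinal :: "'k rel \<Rightarrow> bool" where
  "regular_cardinal \<kappa> \<longleftrightarrow> Cinfinite \<kappa> \<and> regularCard \<kappa>"

definition aleph_one :: "nat set rel" where
  "aleph_one = cardSuc natLeq"

section \<open>Categories, functors, colimits\<close>

record ('o, 'm) cat =
  Obj :: "'o set"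
  Arr :: "'m set"
  Dom :: "'m \<Rightarrow> 'o"
  Cod :: "'m \<Rightarrow> 'o"
  Id :: "'o \<Rightarrow> 'm"
  Comp :: "'m \<Rightarrow> 'm \<Rightarrow> 'm"  \<comment> \<open>\<open>Comp C g f\<close> is \<open>g\<close> after \<open>f\<close>\<close>

definition hom :: "('o, 'm) cat \<Rightarrow> 'o \<Rightarrow> 'o \<Rightarrow> 'm set" where
  "hom C x y = {f \<in> Arr C. Dom C f = x \<and> Cod C f = y}"

locale category =
  fixes C :: "('o, 'm) cat"
  assumes Dom_Obj: "f \<in> Arr C \<Longrightarrow> Dom C f \<in> Obj C"
    and Cod_Obj: "f \<in> Arr C \<Longrightarrow> Cod C f \<in> Obj C"
    and Id_hom: "x \<in> Obj C \<Longrightarrow> Id C x \<in> hom C x x"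
    and Comp_hom: "f \<in> hom C x y \<Longrightarrow> g \<in> hom C y z \<Longrightarrow> Comp C g f \<in> hom C x z"
    and Comp_Id_right: "f \<in> hom C x y \<Longrightarrow> Comp C f (Id C x) = f"
    and Comp_Id_left: "f \<in> hom C x y \<Longrightarrow> Comp C (Id C y) f = f"
    and Comp_assoc: "f \<in> hom C w x \<Longrightarrow> g \<in> hom C x y \<Longrightarrow> h \<in> hom C y z \<Longrightarrow>
          Comp C h (Comp C g f) = Comp C (Comp C h g) f"

definition full_subcategory :: "('o, 'm) cat \<Rightarrow> 'o set \<Rightarrow> ('o, 'm) cat" where
  "full_subcategory C S =
     C\<lparr>Obj := Obj C \<inter> S, Arr := {f \<in> Arr C. Dom C f \<in> S \<and> Cod C f \<in> S}\<rparr>"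

definition is_functor ::
  "('j, 'k) cat \<Rightarrow> ('o, 'm) cat \<Rightarrow> ('j \<Rightarrow> 'o) \<Rightarrow> ('k \<Rightarrow> 'm) \<Rightarrow> bool" where
  "is_functor J C Fo Fa \<longleftrightarrow>
     (\<forall>i \<in> Obj J. Fo i \<in> Obj C) \<and>
     (\<forall>i \<in> Obj J. \<forall>j \<in> Obj J. \<forall>u \<in> hom J i j. Fa u \<in> hom C (Fo i) (Fo j)) \<and>
     (\<forall>i \<in> Obj J. Fa (Id J i) = Id C (Fo i)) \<and>
     (\<forall>i \<in> Obj J. \<forall>j \<in> Obj J. \<forall>k \<in> Obj J. \<forall>u \<in> hom J i j. \<forall>v \<in> hom J j k.
        Fa (Comp J v u) = Comp C (Fa v) (Fa u))"

definition is_cocone ::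
  "('j, 'k) cat \<Rightarrow> ('o, 'm) cat \<Rightarrow> ('j \<Rightarrow> 'o) \<Rightarrow> ('k \<Rightarrow> 'm) \<Rightarrow> 'o \<Rightarrow> ('j \<Rightarrow> 'm) \<Rightarrow> bool" where
  "is_cocone J C Fo Fa X \<iota> \<longleftrightarrow>
     X \<in> Obj C \<and> (\<forall>i \<in> Obj J. \<iota> i \<in> hom C (Fo i) X) \<and>
     (\<forall>i \<in> Obj J. \<forall>j \<in> Obj J. \<forall>u \<in> hom J i j. Comp C (\<iota> j) (Fa u) = \<iota> i)"

definition is_colimit ::
  "('j, 'k) cat \<Rightarrow> ('o, 'm) cat \<Rightarrow> ('j \<Rightarrow> 'o) \<Rightarrow> ('k \<Rightarrow> 'm) \<Rightarrow> 'o \<Rightarrow> ('j \<Rightarrow> 'm) \<Rightarrow> bool" where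
  "is_colimit J C Fo Fa X \<iota> \<longleftrightarrow>
     is_cocone J C Fo Fa X \<iota> \<and>
     (\<forall>Y \<gamma>. is_cocone J C Fo Fa Y \<gamma> \<longrightarrow>
        (\<exists>!h. h \<in> hom C X Y \<and> (\<forall>i \<in> Obj J. Comp C h (\<iota> i) = \<gamma> i)))"

text \<open>Every small category is isomorphic to one whose objects and arrows are elements of \<open>'u\<close>,
  so it is enough to let index categories range over those.\<close>

definition cocomplete :: "'u itself \<Rightarrow> ('o, 'm) cat \<Rightarrow> bool" where
  "cocomplete U C \<longleftrightarrow>
     (\<forall>(J :: ('u, 'u) cat) Fo Fa.
        category J \<and> small U (Obj J) \<and> small U (Arr J) \<and> is_functor J C Fo Fa \<longrightarrow>
        (\<exists>X \<iota>. is_colimit J C Fo Fa X \<iota>))"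

section \<open>Sets and hom-functors\<close>

datatype ('o, 'a) morphism = Morphism (source: 'o) (target: 'o) (func: "'a \<Rightarrow> 'a")

definition comp_on ::
  "('o \<Rightarrow> 'a set) \<Rightarrow> ('o, 'a) morphism \<Rightarrow> ('o, 'a) morphism \<Rightarrow> ('o, 'a) morphism" where
  "comp_on carr g f =
     Morphism (source f) (target g) (compose (carr (source f)) (func g) (func f))"

text \<open>All subsets of a type \<open>'a\<close>, and all maps between them. As codomain of the hom-functors of
  a category with arrows in \<open>'a\<close> this is as good as the category of all sets: a
  two-element set of test values detects whether a cocone of sets is colimiting.\<close>

definition SET :: "('a set, ('a set, 'a) morphism) cat" where
  "SET = \<lparr>Obj = UNIV,
     Arr = {f. func f \<in> source f \<rightarrow>\<^sub>E target f},
     Dom = source, Cod = target,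
     Id = (\<lambda>A. Morphism A A (restrict (\<lambda>x. x) A)),
     Comp = comp_on (\<lambda>A. A)\<rparr>"

definition hom_functor_arr :: "('o, 'm) cat \<Rightarrow> 'o \<Rightarrow> 'm \<Rightarrow> ('m set, 'm) morphism" where
  "hom_functor_arr C x u =
     Morphism (hom C x (Dom C u)) (hom C x (Cod C u))
       (restrict (\<lambda>g. Comp C u g) (hom C x (Dom C u)))"

section \<open>Directed colimits and local presentability\<close>

definition poset_cat :: "'i set \<Rightarrow> 'i rel \<Rightarrow> ('i, 'i \<times> 'i) cat" where
  "poset_cat I r = \<lparr>Obj = I, Arr = r, Dom = fst, Cod = snd,
     Id = (\<lambda>i. (i, i)), Comp = (\<lambda>v u. (fst u, snd v))\<rparr>"

definition directed_poset :: "'k rel \<Rightarrow> 'i set \<Rightarrow> 'i rel \<Rightarrow> bool" where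
  "directed_poset \<kappa> I r \<longleftrightarrow>
     partial_order_on I r \<and>
     (\<forall>S. S \<subseteq> I \<and> |S| <o \<kappa> \<longrightarrow> (\<exists>b \<in> I. \<forall>s \<in> S. (s, b) \<in> r))"

definition presentable :: "'u itself \<Rightarrow> 'k rel \<Rightarrow> ('o, 'm) cat \<Rightarrow> 'o \<Rightarrow> bool" where
  "presentable U \<kappa> C x \<longleftrightarrow>
     x \<in> Obj C \<and>
     (\<forall>(I :: 'u set) r Fo Fa X \<iota>.
        directed_poset \<kappa> I r \<and> small U I \<and> is_functor (poset_cat I r) C Fo Fa \<and>
        is_colimit (poset_cat I r) C Fo Fa X \<iota> \<longrightarrow>
        is_colimit (poset_cat I r) SET
          (\<lambda>i. hom C x (Fo i)) (\<lambda>u. hom_functor_arr C x (Fa u))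
          (hom C x X) (\<lambda>i. hom_functor_arr C x (\<iota> i)))"

definition locally_presentable :: "'u itself \<Rightarrow> 'k rel \<Rightarrow> ('o, 'm) cat \<Rightarrow> bool" where
  "locally_presentable U \<kappa> C \<longleftrightarrow>
     regular_cardinal \<kappa> \<and> category C \<and> cocomplete U C \<and>
     (\<exists>G. small U G \<and> (\<forall>x \<in> G. presentable U \<kappa> C x) \<and>
        (\<forall>X \<in> Obj C. \<exists>(I :: 'u set) r Fo Fa \<iota>.
           directed_poset \<kappa> I r \<and> small U I \<and> is_functor (poset_cat I r) C Fo Fa \<and>
           Fo ` I \<subseteq> G \<and> is_colimit (poset_cat I r) C Fo Fa X \<iota>))"

section \<open>Metric spaces with infinite distances\<close>

text \<open>Only the values of \<open>edist\<close> on \<open>points\<close> matter.\<close>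

record 'a emetric =
  points :: "'a set"
  edist :: "'a \<Rightarrow> 'a \<Rightarrow> ennreal"

definition is_emetric :: "'a emetric \<Rightarrow> bool" where
  "is_emetric X \<longleftrightarrow>
     (\<forall>x \<in> points X. \<forall>y \<in> points X. edist X x y = 0 \<longleftrightarrow> x = y) \<and>
     (\<forall>x \<in> points X. \<forall>y \<in> points X. edist X x y = edist X y x) \<and>
     (\<forall>x \<in> points X. \<forall>y \<in> points X. \<forall>z \<in> points X.
        edist X x z \<le> edist X x y + edist X y z)"

definition ecomplete :: "'a emetric \<Rightarrow> bool" where
  "ecomplete X \<longleftrightarrow>
     (\<forall>s :: nat \<Rightarrow> 'a. range s \<subseteq> points X \<and>
        (\<forall>\<epsilon>>0. \<exists>N. \<forall>m\<ge>N. \<forall>n\<ge>N. edist X (s m) (s n) < \<epsilon>) \<longrightarrow>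
        (\<exists>x \<in> points X. \<forall>\<epsilon>>0. \<exists>N. \<forall>n\<ge>N. edist X (s n) x < \<epsilon>))"

definition ecurve :: "'a emetric \<Rightarrow> real \<Rightarrow> real \<Rightarrow> (real \<Rightarrow> 'a) \<Rightarrow> bool" where
  "ecurve X a b f \<longleftrightarrow>
     a \<le> b \<and> f ` {a..b} \<subseteq> points X \<and>
     (\<forall>t \<in> {a..b}. \<forall>\<epsilon>>0. \<exists>\<delta>>0. \<forall>s \<in> {a..b}. \<bar>s - t\<bar> < \<delta> \<longrightarrow> edist X (f s) (f t) < \<epsilon>)"

definition subdivision :: "real \<Rightarrow> real \<Rightarrow> nat \<Rightarrow> (nat \<Rightarrow> real) \<Rightarrow> bool" where
  "subdivision a b n t \<longleftrightarrow> t 0 = a \<and> t n = b \<and> (\<forall>i<n. t i \<le> t (Suc i))"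

definition curve_length :: "'a emetric \<Rightarrow> real \<Rightarrow> real \<Rightarrow> (real \<Rightarrow> 'a) \<Rightarrow> ennreal" where
  "curve_length X a b f =
     Sup {\<Sum>i<n. edist X (f (t i)) (f (t (Suc i))) | n t. subdivision a b n t}"

definition path_dist :: "'a emetric \<Rightarrow> 'a \<Rightarrow> 'a \<Rightarrow> ennreal" where
  "path_dist X x y = Inf {curve_length X a b f | a b f. ecurve X a b f \<and> f a = x \<and> f b = y}"

definition intrinsic :: "'a emetric \<Rightarrow> bool" where
  "intrinsic X \<longleftrightarrow> (\<forall>x \<in> points X. \<forall>y \<in> points X. edist X x y = path_dist X x y)"

definition nonexpansive :: "'a emetric \<Rightarrow> 'a emetric \<Rightarrow> ('a \<Rightarrow> 'a) \<Rightarrow> bool" where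
  "nonexpansive X Y f \<longleftrightarrow>
     (\<forall>x \<in> points X. \<forall>y \<in> points X. edist Y (f x) (f y) \<le> edist X x y)"

definition CMet :: "('u emetric, ('u emetric, 'u) morphism) cat" where
  "CMet = (let Ob = {X. is_emetric X \<and> ecomplete X \<and> small TYPE('u) (points X)} in
     \<lparr>Obj = Ob,
      Arr = {f. source f \<in> Ob \<and> target f \<in> Ob \<and>
                func f \<in> points (source f) \<rightarrow>\<^sub>E points (target f) \<and>
                nonexpansive (source f) (target f) (func f)},
      Dom = source, Cod = target,
      Id = (\<lambda>X. Morphism X X (restrict (\<lambda>x. x) (points X))),
      Comp = comp_on points\<rparr>)"

definition CPMet :: "('u emetric, ('u emetric, 'u) morphism) cat" where
  "CPMet = full_subcategory CMet {X. intrinsic X}"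

end

theory Submission
  imports Defs "HOL-Library.Countable_Set_Type"
begin

text \<open>
  Call a distance splitting if \<open>d x y < a + b\<close> (with \<open>a, b > 0\<close>) always yields a point \<open>z\<close> with
  \<open>d x z < a\<close> and \<open>d z y < b\<close>. A complete space is intrinsic if and only if its distance is
  splitting: a short curve can be cut where its length passes \<open>a\<close>, and conversely repeated
  halving gives a Lipschitz map on the dyadic numbers, which extends to a curve by completeness
  (\<open>intrinsic_imp_splits\<close>, \<open>splits_imp_intrinsic\<close>). Splitting mentions no curves and can be
  tested on a dense subset (\<open>splits_of_dense\<close>); all constructions below are carried out with it.

  Cocompleteness. On the disjoint union of the spaces of a diagram, take the infimum of the
  costs of finite chains of moves, where a move inside one space costs its distance and a move
  along a map of the diagram is free. This is the largest pseudo-metric for which the maps from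
  the spaces are non-expansive and compatible with the diagram. It is splitting, because the
  step of a chain at which the cost passes \<open>a\<close> lies in one splitting space. Its completion is
  the colimit (\<open>colimit_exists\<close>). Completion adds only limits of sequences, and the universe is
  closed under forming sets of sequences, so the result is small.

  Presentability. Over an \<open>\<aleph>\<^sub>1\<close>-directed poset the infimum is attained at some stage of the
  diagram, and for countably many pairs of points even at one common stage (\<open>glue_realized\<close>,
  \<open>glue_realized_countably\<close>). Therefore every Cauchy sequence of the colimit that consists of
  points of the stages converges at a stage, and the stages already cover the colimit
  (\<open>jointly_surjective\<close>). A map from a separable space to the colimit is determined by its
  values on a countable dense subset; lifting these to one stage where their mutual distances
  are right lifts the map. So separable spaces are \<open>\<aleph>\<^sub>1\<close>-presentable (\<open>presentable_separable\<close>).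

  Generation. Closing a countable subset of an intrinsic space under chosen splitting points,
  for rational \<open>a\<close> and \<open>b\<close>, keeps it countable and makes its closure a separable intrinsic
  subspace (\<open>splitting_hull\<close>). So each space is the \<open>\<aleph>\<^sub>1\<close>-directed union of such subspaces, and
  this union is a colimit (\<open>union_colimit\<close>). A separable complete space is determined up to
  isometry by the distances between the members of a dense sequence, that is, by a set of
  triples of two natural numbers and a rational; choosing one space for each such set gives the
  generators.
\<close>

section \<open>Small sets\<close>

lemma small_ordLeq: "|A| \<le>o |B| \<Longrightarrow> small U B \<Longrightarrow> small U A"
  unfolding small_def by (rule ordLeq_ordLess_trans)

lemma small_subset: "A \<subseteq> B \<Longrightarrow> small U B \<Longrightarrow> small U A"
  by (rule small_ordLeq[OF card_of_mono1])

lemma small_image: "small U A \<Longrightarrow> small U (f ` A)"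
  by (rule small_ordLeq[OF card_of_image])

lemma small_inj_on: "inj_on f A \<Longrightarrow> f ` A \<subseteq> B \<Longrightarrow> small U B \<Longrightarrow> small U A"
  by (rule small_ordLeq) (auto simp: card_of_ordLeq[symmetric])

lemma small_imp_inj_on:
  assumes "small TYPE('u) A"
  obtains e :: "'b \<Rightarrow> 'u" where "inj_on e A"
  using ordLess_imp_ordLeq[OF assms[unfolded small_def]] unfolding card_of_ordLeq[symmetric]
  by blast

lemma small_finite: "universe_type U \<Longrightarrow> finite A \<Longrightarrow> small U A"
  unfolding small_def universe_type_def
  by (intro finite_ordLess_infinite) (auto simp: Field_card_of card_of_well_order_on)

lemma small_Sigma:
  assumes U: "universe_type TYPE('u)" and A: "small TYPE('u) A"
    and B: "\<And>a. a \<in> A \<Longrightarrow> small TYPE('u) (B a)"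
  shows "small TYPE('u) (Sigma A B)"
proof -
  have "stable |UNIV :: 'u set|"
    using U by (intro regularCard_stable) (auto simp: universe_type_def Field_card_of card_of_card_order_on)
  then show ?thesis
    using stable_elim A B unfolding small_def by blast
qed

text \<open>
  The closure of \<open>'u\<close> under countable powers concerns subsets of \<open>'u\<close>; an injection into \<open>'u\<close>
  carries it over to small sets of any type.
\<close>
lemma small_sequences:
  assumes U: "universe_type TYPE('u)" and P: "small TYPE('u) P"
  shows "small TYPE('u) {s :: nat \<Rightarrow> 'b. range s \<subseteq> P}"
proof -
  obtain e :: "'b \<Rightarrow> 'u" where e: "inj_on e P" using small_imp_inj_on[OF P] .
  have "small TYPE('u) {s :: nat \<Rightarrow> 'u. range s \<subseteq> e ` P}"
    using U small_image[OF P] unfolding universe_type_def by blast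
  moreover have "inj_on (\<lambda>s. e \<circ> s) {s :: nat \<Rightarrow> 'b. range s \<subseteq> P}"
  proof (rule inj_onI)
    fix s t :: "nat \<Rightarrow> 'b"
    assume st: "s \<in> {s. range s \<subseteq> P}" "t \<in> {s. range s \<subseteq> P}" "e \<circ> s = e \<circ> t"
    then have "e (s n) = e (t n)" "s n \<in> P" "t n \<in> P" for n by (auto simp: fun_eq_iff)
    then have "s n = t n" for n using inj_onD[OF e] by blast
    then show "s = t" by (rule ext)
  qed
  ultimately show ?thesis by (rule small_inj_on[rotated 2]) auto
qed

text \<open>
  Characteristic functions are sequences over a two-element set, so there are fewer than \<open>|'u|\<close>
  sets of natural numbers. This is what bounds the number of separable spaces.
\<close>
lemma small_sets_of_countable:
  assumes U: "universe_type TYPE('u)"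
  shows "small TYPE('u) (UNIV :: 'c::countable set set)"
proof -
  have S: "small TYPE('u) {s :: nat \<Rightarrow> bool. range s \<subseteq> UNIV}"
    by (rule small_sequences[OF U small_finite[OF U]]) simp
  have "inj (\<lambda>K n. n \<in> to_nat ` (K :: 'c set))"
  proof (rule injI)
    fix K L :: "'c set" assume "(\<lambda>n. n \<in> to_nat ` K) = (\<lambda>n. n \<in> to_nat ` L)"
    then have "to_nat ` K = to_nat ` L" by (auto dest: fun_cong)
    then show "K = L" by (simp add: inj_image_eq_iff)
  qed
  from small_inj_on[OF this _ S] show ?thesis by simp
qed

lemma small_insert:
  assumes U: "universe_type TYPE('u)" and A: "small TYPE('u) A"
  shows "small TYPE('u) (insert a A)"
proof -
  have "|{a} \<union> A| <o |UNIV :: 'u set|"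
    using U A small_finite[OF U, of "{a}"]
    by (intro card_of_Un_ordLess_infinite) (auto simp: universe_type_def small_def)
  then show ?thesis by (simp add: small_def)
qed

lemma less_aleph_one_iff: "|S| <o aleph_one \<longleftrightarrow> countable S"
  unfolding aleph_one_def countable_card_le_natLeq
  by (rule cardSuc_ordLeq_ordLess[OF natLeq_Card_order card_of_Card_order])

lemma regular_cardinal_aleph_one: "regular_cardinal aleph_one"
  unfolding regular_cardinal_def aleph_one_def
  by (simp add: Cinfinite_cardSuc regularCard_cardSuc natLeq_Cinfinite)

section \<open>Extended distances\<close>

lemma ennreal_diff_less_iff:
  fixes d a b :: ennreal
  assumes "0 < b" "d < top"
  shows "d - a < b \<longleftrightarrow> d < a + b"
proof
  assume l: "d - a < b"
  show "d < a + b"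
  proof (rule ccontr)
    assume "\<not> d < a + b"
    then have le: "a + b \<le> d" by simp
    then have "a \<noteq> top" using assms by (auto simp: top_unique)
    then have "b \<le> d - a" using ennreal_minus_mono[OF le order.refl[of a]] by simp
    with l show False by simp
  qed
next
  assume l: "d < a + b"
  show "d - a < b"
  proof (cases "a \<le> d")
    case True
    show ?thesis
    proof (rule ccontr)
      assume "\<not> d - a < b"
      then have "b + a \<le> d - a + a" by (intro add_right_mono) simp
      also have "\<dots> = d" by (rule diff_add_cancel_ennreal[OF True])
      finally show False using l by (simp add: add.commute)
    qed
  next
    case False
    then have "d - a = 0" by (intro diff_eq_0_ennreal) (use assms in auto)
    then show ?thesis using assms by simp
  qed
qed

text \<open>
  The slack in \<open>d < a + b\<close> can be passed on to both summands. The new bounds are rational, so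
  that splitting needs to be tested for countably many bounds only.
\<close>
lemma ennreal_less_add_cases:
  fixes d a b :: ennreal
  assumes "d < a + b" "0 < a" "0 < b"
  obtains q r :: rat where "0 < q" "0 < r" "ennreal (real_of_rat q) < a" "ennreal (real_of_rat r) < b"
    "d < ennreal (real_of_rat q) + ennreal (real_of_rat r)"
proof -
  have d: "d < top" using assms(1) order.strict_trans2 top_greatest by blast
  have "d - a < b" using assms d by (simp add: ennreal_diff_less_iff)
  then have "max 0 (d - a) < b" using assms by simp
  then obtain r :: rat where r: "max 0 (d - a) < ennreal (real_of_rat r)" "ennreal (real_of_rat r) < b"
    using ennreal_rat_dense by blast
  then have r': "0 < ennreal (real_of_rat r)" "d - a < ennreal (real_of_rat r)" by (simp_all only: max_less_iff_conj)
  then have "d < a + ennreal (real_of_rat r)" using d ennreal_diff_less_iff by blast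
  then have "d - ennreal (real_of_rat r) < a"
    using assms d by (simp add: ennreal_diff_less_iff add.commute)
  then have "max 0 (d - ennreal (real_of_rat r)) < a" using assms by simp
  then obtain q :: rat where q: "max 0 (d - ennreal (real_of_rat r)) < ennreal (real_of_rat q)" "ennreal (real_of_rat q) < a"
    using ennreal_rat_dense by blast
  then have q': "0 < ennreal (real_of_rat q)" "d - ennreal (real_of_rat r) < ennreal (real_of_rat q)" by (simp_all only: max_less_iff_conj)
  then have "d < ennreal (real_of_rat q) + ennreal (real_of_rat r)"
    using d ennreal_diff_less_iff by (metis add.commute)
  moreover have "0 < q" "0 < r" using q' r' by (auto simp: ennreal_less_zero_iff)
  ultimately show thesis using that q r by blast
qed

lemma ennreal_le_add_twice_epsilon:
  fixes a b :: ennreal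
  assumes "\<And>\<epsilon>. 0 < \<epsilon> \<Longrightarrow> a \<le> b + (\<epsilon> + \<epsilon>)"
  shows "a \<le> b"
proof (rule ennreal_le_epsilon)
  fix e :: real assume "0 < e"
  then show "a \<le> b + ennreal e"
    using assms[of "ennreal (e / 2)"] by (simp flip: ennreal_plus)
qed

text \<open>
  Strictly larger bounds on both summands are enough; this form of the triangle inequality suits
  distances that are defined as infima.
\<close>
lemma ennreal_le_add_dense:
  fixes a b c :: ennreal
  assumes "\<And>b' c'. b < b' \<Longrightarrow> c < c' \<Longrightarrow> a \<le> b' + c'"
  shows "a \<le> b + c"
proof (cases "b = top \<or> c = top")
  case False
  show ?thesis
  proof (rule ennreal_le_add_twice_epsilon)
    fix \<epsilon> :: ennreal assume "0 < \<epsilon>"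
    then have "b < b + \<epsilon>" "c < c + \<epsilon>"
      using False by (auto simp: ennreal_add_left_cancel_less[of _ 0, simplified] top.not_eq_extremum)
    from assms[OF this] show "a \<le> b + c + (\<epsilon> + \<epsilon>)" by (simp add: ac_simps)
  qed
qed auto

lemma ennreal_add_strict_right_mono:
  "(b :: ennreal) < c \<Longrightarrow> a \<noteq> top \<Longrightarrow> b + a < c + a"
  by (simp add: add.commute[of _ a] ennreal_add_left_cancel_less)

lemma ennreal_eqI_rat:
  assumes "\<And>q :: rat. a < ennreal (real_of_rat q) \<longleftrightarrow> b < ennreal (real_of_rat q)"
  shows "a = b"
  using assms ennreal_rat_dense by (metis less_asym linorder_less_linear order.strict_trans)

lemma ennreal_half_pos:
  fixes \<epsilon> :: ennreal
  assumes "0 < \<epsilon>"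
  obtains \<delta> where "0 < \<delta>" "\<delta> + \<delta> < \<epsilon>"
proof -
  obtain q where q: "0 < ennreal q" "ennreal q < \<epsilon>" using ennreal_rat_dense[OF assms] by blast
  then have "0 < q" by simp
  then have "0 < ennreal (q/2)" "ennreal (q/2) + ennreal (q/2) = ennreal q"
    by (auto simp flip: ennreal_plus)
  with q that show thesis by metis
qed

lemma ennreal_inverse_Suc_less:
  fixes \<epsilon> :: ennreal
  assumes "0 < \<epsilon>"
  obtains N where "\<And>n. n \<ge> N \<Longrightarrow> ennreal (1 / Suc n) < \<epsilon>"
proof -
  obtain q where q: "0 < ennreal q" "ennreal q < \<epsilon>" using ennreal_rat_dense[OF assms] by blast
  then have "0 < q" by simp
  then obtain N where N: "1 / real (Suc N) < q" using nat_approx_posE by blast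
  show thesis
  proof (rule that)
    fix n assume "n \<ge> N"
    then have "1 / real (Suc n) \<le> 1 / real (Suc N)" by (simp add: frac_le)
    then have "1 / real (Suc n) < q" using N by linarith
    then have "ennreal (1 / Suc n) < ennreal q" using \<open>0 < q\<close> by (simp add: ennreal_lessI)
    then show "ennreal (1 / Suc n) < \<epsilon>" using q(2) by (rule less_trans)
  qed
qed

text \<open>
  Distances on formal points (Cauchy sequences, elements of a disjoint union) before points at
  distance \<open>0\<close> are identified.
\<close>
definition pseudo_emetric :: "'a set \<Rightarrow> ('a \<Rightarrow> 'a \<Rightarrow> ennreal) \<Rightarrow> bool" where
  "pseudo_emetric P d \<longleftrightarrow> (\<forall>x\<in>P. d x x = 0) \<and> (\<forall>x\<in>P. \<forall>y\<in>P. d x y = d y x) \<and>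
     (\<forall>x\<in>P. \<forall>y\<in>P. \<forall>z\<in>P. d x z \<le> d x y + d y z)"

lemma pseudo_emetric_subset: "pseudo_emetric P d \<Longrightarrow> Q \<subseteq> P \<Longrightarrow> pseudo_emetric Q d"
  unfolding pseudo_emetric_def by blast

lemma is_emetric_iff_pseudo:
  "is_emetric X \<longleftrightarrow> pseudo_emetric (points X) (edist X) \<and>
     (\<forall>x \<in> points X. \<forall>y \<in> points X. edist X x y = 0 \<longrightarrow> x = y)"
  unfolding is_emetric_def pseudo_emetric_def by blast

lemma pseudo_emetric_refl: "pseudo_emetric P d \<Longrightarrow> x \<in> P \<Longrightarrow> d x x = 0"
  and pseudo_emetric_sym: "pseudo_emetric P d \<Longrightarrow> x \<in> P \<Longrightarrow> y \<in> P \<Longrightarrow> d x y = d y x"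
  and pseudo_emetric_triangle:
    "pseudo_emetric P d \<Longrightarrow> x \<in> P \<Longrightarrow> y \<in> P \<Longrightarrow> z \<in> P \<Longrightarrow> d x z \<le> d x y + d y z"
  unfolding pseudo_emetric_def by blast+

lemma emetric_refl: "is_emetric X \<Longrightarrow> x \<in> points X \<Longrightarrow> edist X x x = 0"
  and emetric_sym: "is_emetric X \<Longrightarrow> x \<in> points X \<Longrightarrow> y \<in> points X \<Longrightarrow> edist X x y = edist X y x"
  and emetric_triangle:
    "is_emetric X \<Longrightarrow> x \<in> points X \<Longrightarrow> y \<in> points X \<Longrightarrow> z \<in> points X \<Longrightarrow>
       edist X x z \<le> edist X x y + edist X y z"
  and emetric_eqI: "is_emetric X \<Longrightarrow> x \<in> points X \<Longrightarrow> y \<in> points X \<Longrightarrow> edist X x y \<le> 0 \<Longrightarrow> x = y"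
  unfolding is_emetric_def by auto

lemma is_emetric_subspace: "is_emetric X \<Longrightarrow> V \<subseteq> points X \<Longrightarrow> is_emetric (X\<lparr>points := V\<rparr>)"
  unfolding is_emetric_def by (simp add: subset_iff)

lemma pseudo_emetric_quadrangle:
  assumes "pseudo_emetric P d" "x \<in> P" "x' \<in> P" "y \<in> P" "y' \<in> P"
  shows "d x y \<le> d x x' + d x' y' + d y y'"
proof -
  have "d x y \<le> d x x' + d x' y" "d x' y \<le> d x' y' + d y' y"
    using assms pseudo_emetric_triangle by metis+
  then have "d x y \<le> d x x' + (d x' y' + d y' y)"
    by (meson add_left_mono order_trans)
  then show ?thesis using assms by (simp add: pseudo_emetric_sym[of P d y y'] add.assoc)
qed

section \<open>Cauchy sequences and extension from dense subsets\<close>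

definition cauchy_in :: "'a set \<Rightarrow> ('a \<Rightarrow> 'a \<Rightarrow> ennreal) \<Rightarrow> (nat \<Rightarrow> 'a) \<Rightarrow> bool" where
  "cauchy_in P d s \<longleftrightarrow> range s \<subseteq> P \<and> (\<forall>\<epsilon>>0. \<exists>N. \<forall>m\<ge>N. \<forall>n\<ge>N. d (s m) (s n) < \<epsilon>)"

definition limit_of :: "('a \<Rightarrow> 'a \<Rightarrow> ennreal) \<Rightarrow> (nat \<Rightarrow> 'a) \<Rightarrow> 'a \<Rightarrow> bool" where
  "limit_of d s x \<longleftrightarrow> (\<forall>\<epsilon>>0. \<exists>N. \<forall>n\<ge>N. d (s n) x < \<epsilon>)"

lemma cauchy_inD: "cauchy_in P d s \<Longrightarrow> 0 < \<epsilon> \<Longrightarrow> \<exists>N. \<forall>m\<ge>N. \<forall>n\<ge>N. d (s m) (s n) < \<epsilon>"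
  unfolding cauchy_in_def by blast

lemma ecomplete_iff:
  "ecomplete X \<longleftrightarrow> (\<forall>s. cauchy_in (points X) (edist X) s \<longrightarrow> (\<exists>x\<in>points X. limit_of (edist X) s x))"
  unfolding ecomplete_def cauchy_in_def limit_of_def by blast

definition dense_in :: "'a emetric \<Rightarrow> 'a set \<Rightarrow> bool" where
  "dense_in X A \<longleftrightarrow> A \<subseteq> points X \<and> (\<forall>x\<in>points X. \<forall>\<epsilon>>0. \<exists>a\<in>A. edist X x a < \<epsilon>)"

lemma dense_in_sequence:
  assumes X: "is_emetric X" and D: "dense_in X (\<phi> ` P)" and x: "x \<in> points X"
  obtains p where "range p \<subseteq> P" "limit_of (edist X) (\<phi> \<circ> p) x"
proof -
  have "\<exists>p\<in>P. edist X x (\<phi> p) < ennreal (1 / Suc n)" for n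
  proof -
    have "0 < ennreal (1 / Suc n)" by (simp add: ennreal_less_zero_iff)
    then show ?thesis using D x unfolding dense_in_def by blast
  qed
  then obtain p where p: "\<And>n. p n \<in> P" "\<And>n. edist X x (\<phi> (p n)) < ennreal (1 / Suc n)" by metis
  have "limit_of (edist X) (\<phi> \<circ> p) x"
    unfolding limit_of_def
  proof (intro allI impI)
    fix \<epsilon> :: ennreal assume "0 < \<epsilon>"
    then obtain N where N: "\<And>n. n \<ge> N \<Longrightarrow> ennreal (1 / Suc n) < \<epsilon>" using ennreal_inverse_Suc_less by blast
    have "edist X ((\<phi> \<circ> p) n) x < \<epsilon>" if "n \<ge> N" for n
      using p[of n] N[OF that] D x emetric_sym[OF X x, of "\<phi> (p n)"]
      unfolding dense_in_def by (auto simp: image_subset_iff)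
    then show "\<exists>N. \<forall>n\<ge>N. edist X ((\<phi> \<circ> p) n) x < \<epsilon>" by blast
  qed
  with p(1) that show thesis by blast
qed

lemma limit_imp_cauchy_in:
  assumes X: "pseudo_emetric P d" and s: "range s \<subseteq> P" "x \<in> P" "limit_of d s x"
  shows "cauchy_in P d s"
  unfolding cauchy_in_def
proof (intro conjI s allI impI)
  fix \<epsilon> :: ennreal assume "0 < \<epsilon>"
  then obtain \<delta> where \<delta>: "0 < \<delta>" "\<delta> + \<delta> < \<epsilon>" by (rule ennreal_half_pos)
  then obtain N where N: "\<And>n. n \<ge> N \<Longrightarrow> d (s n) x < \<delta>" using s(3) unfolding limit_of_def by blast
  have "d (s m) (s n) < \<epsilon>" if "m \<ge> N" "n \<ge> N" for m n
  proof -
    have S: "s m \<in> P" "s n \<in> P" using s(1) by auto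
    have "d (s m) (s n) \<le> d (s m) x + d (s n) x"
      using pseudo_emetric_triangle[OF X S(1) s(2) S(2)] pseudo_emetric_sym[OF X S(2) s(2)] by simp
    also have "\<dots> \<le> \<delta> + \<delta>" using N that by (intro add_mono less_imp_le) auto
    finally show ?thesis using \<delta>(2) by (rule le_less_trans)
  qed
  then show "\<exists>N. \<forall>m\<ge>N. \<forall>n\<ge>N. d (s m) (s n) < \<epsilon>" by blast
qed

text \<open>
  The dense subset is given by a family \<open>\<phi>\<close> over an index set, so that a map out of it may be
  given on indices; that it is well defined is part of the inequality. The value at \<open>x\<close> is
  chosen as a point \<open>y\<close> with \<open>d y (g p) \<le> d x (\<phi> p)\<close> for all \<open>p\<close>, a limit of values of \<open>g\<close>.
  Agreement with \<open>g\<close> and non-expansiveness both follow from this condition alone.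
\<close>
lemma nonexpansive_extension:
  fixes X :: "'a emetric" and Y :: "'b emetric"
  assumes X: "is_emetric X" and Y: "is_emetric Y" "ecomplete Y"
    and D: "dense_in X (\<phi> ` P)" and g: "g ` P \<subseteq> points Y"
    and le: "\<And>p q. p \<in> P \<Longrightarrow> q \<in> P \<Longrightarrow> edist Y (g p) (g q) \<le> edist X (\<phi> p) (\<phi> q)"
  obtains h where "h \<in> points X \<rightarrow>\<^sub>E points Y"
    "\<And>x y. x \<in> points X \<Longrightarrow> y \<in> points X \<Longrightarrow> edist Y (h x) (h y) \<le> edist X x y"
    "\<And>p. p \<in> P \<Longrightarrow> h (\<phi> p) = g p"
proof -
  have \<phi>: "\<phi> p \<in> points X" if "p \<in> P" for p using D that unfolding dense_in_def by blast
  have gY: "g p \<in> points Y" if "p \<in> P" for p using g that by blast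
  have "\<exists>y\<in>points Y. \<forall>p\<in>P. edist Y y (g p) \<le> edist X x (\<phi> p)" if x: "x \<in> points X" for x
  proof -
    obtain s where s: "range s \<subseteq> P" "limit_of (edist X) (\<phi> \<circ> s) x"
      using dense_in_sequence[OF X D x] .
    then have sP: "s n \<in> P" for n by blast
    have "cauchy_in (points X) (edist X) (\<phi> \<circ> s)"
      using s \<phi> x X by (intro limit_imp_cauchy_in[of _ _ _ x]) (auto simp: is_emetric_iff_pseudo)
    then have "cauchy_in (points Y) (edist Y) (g \<circ> s)"
      unfolding cauchy_in_def comp_def using gY sP le_less_trans[OF le[OF sP sP]]
      by auto meson
    then obtain y where y: "y \<in> points Y" "limit_of (edist Y) (g \<circ> s) y"
      using Y(2) unfolding ecomplete_iff by blast
    have "edist Y y (g p) \<le> edist X x (\<phi> p)" if p: "p \<in> P" for p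
    proof (rule ennreal_le_add_twice_epsilon)
      fix \<epsilon> :: ennreal assume "0 < \<epsilon>"
      then obtain N M where "\<And>n. n \<ge> N \<Longrightarrow> edist Y (g (s n)) y < \<epsilon>"
        "\<And>n. n \<ge> M \<Longrightarrow> edist X (\<phi> (s n)) x < \<epsilon>"
        using y(2) s(2) unfolding limit_of_def comp_def by blast
      then have n: "edist Y (g (s (max N M))) y < \<epsilon>" "edist X (\<phi> (s (max N M))) x < \<epsilon>"
        by auto
      define n where "n = max N M"
      note n = n[folded n_def]
      have "edist Y y (g p) \<le> edist Y (g (s n)) y + edist Y (g (s n)) (g p)"
        using emetric_triangle[OF Y(1) y(1) gY[OF sP] gY[OF p]] emetric_sym[OF Y(1) y(1) gY[OF sP]]
        by metis
      also have "edist Y (g (s n)) (g p) \<le> edist X (\<phi> (s n)) (\<phi> p)" by (rule le[OF sP p])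
      also have "\<dots> \<le> edist X (\<phi> (s n)) x + edist X x (\<phi> p)"
        by (rule emetric_triangle[OF X \<phi>[OF sP] x \<phi>[OF p]])
      also have "edist Y (g (s n)) y + (edist X (\<phi> (s n)) x + edist X x (\<phi> p)) \<le>
          \<epsilon> + (\<epsilon> + edist X x (\<phi> p))"
        using n by (intro add_mono order.refl less_imp_le)
      finally show "edist Y y (g p) \<le> edist X x (\<phi> p) + (\<epsilon> + \<epsilon>)"
        by (simp add: ac_simps)
    qed
    with y(1) show ?thesis by blast
  qed
  then obtain k where k: "\<And>x. x \<in> points X \<Longrightarrow> k x \<in> points Y"
    "\<And>x p. x \<in> points X \<Longrightarrow> p \<in> P \<Longrightarrow> edist Y (k x) (g p) \<le> edist X x (\<phi> p)" by metis
  show thesis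
  proof (rule that[of "restrict k (points X)"])
    show "restrict k (points X) \<in> points X \<rightarrow>\<^sub>E points Y" using k(1) by auto
  next
    fix p assume p: "p \<in> P"
    have "edist Y (k (\<phi> p)) (g p) \<le> 0"
      using k(2)[OF \<phi>[OF p] p] emetric_refl[OF X \<phi>[OF p]] by simp
    then have "k (\<phi> p) = g p" using emetric_eqI[OF Y(1)] k(1) \<phi> gY p by blast
    then show "restrict k (points X) (\<phi> p) = g p" using \<phi>[OF p] by simp
  next
    fix x y assume x: "x \<in> points X" and y: "y \<in> points X"
    have "edist Y (k x) (k y) \<le> edist X x y"
    proof (rule ennreal_le_add_twice_epsilon)
      fix \<epsilon> :: ennreal assume "0 < \<epsilon>"
      then obtain p where p: "p \<in> P" "edist X x (\<phi> p) < \<epsilon>" using D x unfolding dense_in_def by blast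
      have "edist Y (k x) (k y) \<le> edist Y (k x) (g p) + edist Y (k y) (g p)"
        using emetric_triangle[OF Y(1) k(1)[OF x] gY[OF p(1)] k(1)[OF y]]
          emetric_sym[OF Y(1) k(1)[OF y] gY[OF p(1)]] by metis
      also have "\<dots> \<le> edist X x (\<phi> p) + edist X y (\<phi> p)"
        using k(2) x y p(1) by (intro add_mono) auto
      also have "edist X y (\<phi> p) \<le> edist X x y + edist X x (\<phi> p)"
        using emetric_triangle[OF X y x \<phi>[OF p(1)]] emetric_sym[OF X x y] by simp
      also have "edist X x (\<phi> p) + (edist X x y + edist X x (\<phi> p)) \<le> \<epsilon> + (edist X x y + \<epsilon>)"
        using p by (intro add_mono order.refl less_imp_le)
      finally show "edist Y (k x) (k y) \<le> edist X x y + (\<epsilon> + \<epsilon>)" by (simp add: ac_simps)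
    qed
    then show "edist Y (restrict k (points X) x) (restrict k (points X) y) \<le> edist X x y"
      using x y by simp
  qed
qed

lemma nonexpansive_eq_on_dense:
  assumes X: "is_emetric X" and Y: "is_emetric Y" and D: "dense_in X A"
    and h: "h ` points X \<subseteq> points Y" "nonexpansive X Y h"
    and k: "k ` points X \<subseteq> points Y" "nonexpansive X Y k"
    and eq: "\<And>a. a \<in> A \<Longrightarrow> h a = k a" and x: "x \<in> points X"
  shows "h x = k x"
proof (rule emetric_eqI[OF Y])
  show H: "h x \<in> points Y" and K: "k x \<in> points Y" using h k x by auto
  have "edist Y (h x) (k x) \<le> 0"
  proof (rule ennreal_le_add_twice_epsilon)
    fix \<epsilon> :: ennreal assume "0 < \<epsilon>"
    then obtain a where a: "a \<in> A" "edist X x a < \<epsilon>" using D x unfolding dense_in_def by blast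
    have aX: "a \<in> points X" using D a(1) unfolding dense_in_def by blast
    have A: "h a \<in> points Y" using h aX by auto
    have "edist Y (h x) (k x) \<le> edist Y (h x) (h a) + edist Y (k x) (k a)"
      using emetric_triangle[OF Y H A K] emetric_sym[OF Y A K] eq[OF a(1)] by simp
    also have "\<dots> \<le> edist X x a + edist X x a"
      using h(2) k(2) x aX unfolding nonexpansive_def by (intro add_mono) auto
    also have "\<dots> \<le> \<epsilon> + \<epsilon>" using a(2) by (intro add_mono less_imp_le)
    finally show "edist Y (h x) (k x) \<le> 0 + (\<epsilon> + \<epsilon>)" by simp
  qed
  then show "edist Y (h x) (k x) \<le> 0" .
qed

section \<open>Completion\<close>

text \<open>
  Points at distance \<open>0\<close> are identified by choosing a representative of each class; an injection
  then moves the representatives into the universe.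
\<close>
lemma kolmogorov_quotient:
  fixes S :: "'b set"
  assumes S: "small TYPE('u) S" and D: "pseudo_emetric S D"
  obtains X :: "'u emetric" and \<psi> where
    "is_emetric X" "small TYPE('u) (points X)" "points X = \<psi> ` S"
    "\<And>s t. s \<in> S \<Longrightarrow> t \<in> S \<Longrightarrow> edist X (\<psi> s) (\<psi> t) = D s t"
proof -
  obtain e :: "'b \<Rightarrow> 'u" where e: "inj_on e S" using small_imp_inj_on[OF S] .
  define rep where "rep s = (SOME t. t \<in> S \<and> D s t = 0)" for s
  have rep: "rep s \<in> S" "D s (rep s) = 0" if "s \<in> S" for s
    using someI[of "\<lambda>t. t \<in> S \<and> D s t = 0" s] that pseudo_emetric_refl[OF D that]
    unfolding rep_def by auto
  have le: "D x y \<le> D x' y'" if "x \<in> S" "x' \<in> S" "y \<in> S" "y' \<in> S" "D x x' = 0" "D y y' = 0" for x x' y y'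
    using pseudo_emetric_quadrangle[OF D that(1-4)] that(5,6) by simp
  have Drep: "D (rep s) (rep t) = D s t" if "s \<in> S" "t \<in> S" for s t
    using le[OF that(1) rep(1) that(2) rep(1)] le[OF rep(1) that(1) rep(1) that(2)] rep that
      pseudo_emetric_sym[OF D] by (intro antisym) metis+
  have rep_eq: "rep s = rep t" if st: "s \<in> S" "t \<in> S" and 0: "D s t = 0" for s t
  proof -
    have "u \<in> S \<and> D s u = 0 \<longleftrightarrow> u \<in> S \<and> D t u = 0" for u
      using pseudo_emetric_triangle[OF D, of s t u] pseudo_emetric_triangle[OF D, of t s u]
        pseudo_emetric_sym[OF D, of s t] st 0 by auto
    then show ?thesis unfolding rep_def by simp
  qed
  define \<psi> where "\<psi> s = e (rep s)" for s
  define X where "X = \<lparr>points = \<psi> ` S, edist = \<lambda>x y. D (inv_into S e x) (inv_into S e y)\<rparr>"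
  have dist: "edist X (\<psi> s) (\<psi> t) = D s t" if "s \<in> S" "t \<in> S" for s t
    using rep that Drep e by (simp add: X_def \<psi>_def)
  have P: "points X = \<psi> ` S" by (simp add: X_def)
  have "is_emetric X"
    unfolding is_emetric_iff_pseudo
  proof
    show "pseudo_emetric (points X) (edist X)"
      unfolding P pseudo_emetric_def ball_simps
      using pseudo_emetric_refl[OF D] pseudo_emetric_sym[OF D] pseudo_emetric_triangle[OF D]
      by (simp add: dist)
    show "\<forall>x\<in>points X. \<forall>y\<in>points X. edist X x y = 0 \<longrightarrow> x = y"
      unfolding P ball_simps using rep_eq by (simp add: dist) (simp add: \<psi>_def)
  qed
  moreover have "small TYPE('u) (points X)" unfolding P by (rule small_image[OF S])
  ultimately show thesis using that P dist by blast
qed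

text \<open>
  Every Cauchy sequence is shadowed by one in the dense subset.
\<close>
lemma ecomplete_of_dense:
  assumes X: "is_emetric X" and D: "dense_in X (\<phi> ` P)"
    and conv: "\<And>p. cauchy_in P (\<lambda>p q. edist X (\<phi> p) (\<phi> q)) p \<Longrightarrow>
      \<exists>x\<in>points X. limit_of (edist X) (\<phi> \<circ> p) x"
  shows "ecomplete X"
  unfolding ecomplete_iff
proof (intro allI impI)
  fix s assume s: "cauchy_in (points X) (edist X) s"
  then have sX: "s n \<in> points X" for n unfolding cauchy_in_def by blast
  have psX: "pseudo_emetric (points X) (edist X)" using X is_emetric_iff_pseudo by blast
  have "\<exists>p\<in>P. edist X (s n) (\<phi> p) < ennreal (1 / Suc n)" for n
  proof -
    have "0 < ennreal (1 / Suc n)" by (simp add: ennreal_less_zero_iff)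
    then show ?thesis using D sX unfolding dense_in_def by blast
  qed
  then obtain p where p: "\<And>n. p n \<in> P" "\<And>n. edist X (s n) (\<phi> (p n)) < ennreal (1 / Suc n)" by metis
  have pX: "\<phi> (p n) \<in> points X" for n using D p(1) unfolding dense_in_def by blast
  have near: "\<exists>N. \<forall>n\<ge>N. edist X (s n) (\<phi> (p n)) < \<epsilon>" if "0 < \<epsilon>" for \<epsilon>
  proof -
    obtain N where "\<And>n. n \<ge> N \<Longrightarrow> ennreal (1 / Suc n) < \<epsilon>"
      using ennreal_inverse_Suc_less \<open>0 < \<epsilon>\<close> by blast
    then show ?thesis using p(2) less_trans by blast
  qed
  have "cauchy_in P (\<lambda>p q. edist X (\<phi> p) (\<phi> q)) p"
    unfolding cauchy_in_def
  proof (intro conjI allI impI)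
    show "range p \<subseteq> P" using p(1) by blast
    fix \<epsilon> :: ennreal assume "0 < \<epsilon>"
    then obtain \<epsilon>' where e': "0 < \<epsilon>'" "\<epsilon>' + \<epsilon>' < \<epsilon>" by (rule ennreal_half_pos)
    obtain \<delta> where \<delta>: "0 < \<delta>" "\<delta> + \<delta> < \<epsilon>'" using ennreal_half_pos[OF e'(1)] .
    obtain M where M: "\<And>m n. m \<ge> M \<Longrightarrow> n \<ge> M \<Longrightarrow> edist X (s m) (s n) < \<epsilon>'"
      using cauchy_inD[OF s e'(1)] by metis
    obtain N where N: "\<And>n. n \<ge> N \<Longrightarrow> edist X (s n) (\<phi> (p n)) < \<delta>" using near[OF \<delta>(1)] by blast
    have "edist X (\<phi> (p m)) (\<phi> (p n)) < \<epsilon>" if mn: "m \<ge> max M N" "n \<ge> max M N" for m n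
    proof -
      have "edist X (\<phi> (p m)) (\<phi> (p n)) \<le>
          edist X (\<phi> (p m)) (s m) + edist X (s m) (s n) + edist X (\<phi> (p n)) (s n)"
        by (rule pseudo_emetric_quadrangle[OF psX pX sX pX sX])
      also have "\<dots> \<le> \<delta> + \<epsilon>' + \<delta>"
        using M N mn emetric_sym[OF X pX sX] by (intro add_mono less_imp_le) auto
      also have "\<dots> = (\<delta> + \<delta>) + \<epsilon>'" by (simp add: ac_simps)
      also have "\<dots> \<le> \<epsilon>' + \<epsilon>'" using \<delta>(2) by (intro add_right_mono less_imp_le)
      finally show ?thesis using e'(2) by (rule le_less_trans)
    qed
    then show "\<exists>N. \<forall>m\<ge>N. \<forall>n\<ge>N. edist X (\<phi> (p m)) (\<phi> (p n)) < \<epsilon>" by blast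
  qed
  then obtain x where x: "x \<in> points X" "limit_of (edist X) (\<phi> \<circ> p) x" using conv by blast
  have "limit_of (edist X) s x"
    unfolding limit_of_def
  proof (intro allI impI)
    fix \<epsilon> :: ennreal assume "0 < \<epsilon>"
    then obtain \<delta> where \<delta>: "0 < \<delta>" "\<delta> + \<delta> < \<epsilon>" by (rule ennreal_half_pos)
    obtain N where N: "\<And>n. n \<ge> N \<Longrightarrow> edist X (s n) (\<phi> (p n)) < \<delta>" using near[OF \<delta>(1)] by blast
    obtain M where M: "\<And>n. n \<ge> M \<Longrightarrow> edist X (\<phi> (p n)) x < \<delta>"
      using x(2) \<delta>(1) unfolding limit_of_def comp_def by blast
    have "edist X (s n) x < \<epsilon>" if "n \<ge> max M N" for n
    proof -
      have "edist X (s n) x \<le> edist X (s n) (\<phi> (p n)) + edist X (\<phi> (p n)) x"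
        by (rule emetric_triangle[OF X sX pX x(1)])
      also have "\<dots> \<le> \<delta> + \<delta>" using M N that by (intro add_mono less_imp_le) auto
      finally show ?thesis using \<delta>(2) by (rule le_less_trans)
    qed
    then show "\<exists>N. \<forall>n\<ge>N. edist X (s n) x < \<epsilon>" by blast
  qed
  with x(1) show "\<exists>x\<in>points X. limit_of (edist X) s x" by blast
qed

text \<open>
  For Cauchy sequences this is the limit of \<open>d (s n) (t n)\<close>. As the infimum of the eventual
  upper bounds it is defined for all sequences, and it satisfies the triangle inequality without
  any convergence argument.
\<close>
definition ultimate_dist :: "('a \<Rightarrow> 'a \<Rightarrow> ennreal) \<Rightarrow> (nat \<Rightarrow> 'a) \<Rightarrow> (nat \<Rightarrow> 'a) \<Rightarrow> ennreal" where
  "ultimate_dist d s t = Inf {c. \<exists>N. \<forall>n\<ge>N. d (s n) (t n) \<le> c}"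

lemma ultimate_dist_le: "(\<And>n. n \<ge> N \<Longrightarrow> d (s n) (t n) \<le> c) \<Longrightarrow> ultimate_dist d s t \<le> c"
  unfolding ultimate_dist_def by (rule Inf_lower) blast

lemma ultimate_dist_lessD: "ultimate_dist d s t < c \<Longrightarrow> \<exists>N. \<forall>n\<ge>N. d (s n) (t n) < c"
  unfolding ultimate_dist_def Inf_less_iff by (auto intro: le_less_trans)

lemma ultimate_dist_const: "ultimate_dist d (\<lambda>_. p) (\<lambda>_. q) = d p q"
  unfolding ultimate_dist_def by (intro antisym Inf_lower Inf_greatest) auto

lemma pseudo_emetric_ultimate_dist:
  assumes D: "pseudo_emetric P d"
  shows "pseudo_emetric {s. range s \<subseteq> P} (ultimate_dist d)"
  unfolding pseudo_emetric_def
proof (intro conjI ballI)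
  fix s :: "nat \<Rightarrow> 'a" assume s: "s \<in> {s. range s \<subseteq> P}"
  then have "d (s n) (s n) \<le> 0" for n using pseudo_emetric_refl[OF D, of "s n"] by auto
  then have "ultimate_dist d s s \<le> 0" by (rule ultimate_dist_le)
  then show "ultimate_dist d s s = 0" by simp
next
  fix s t :: "nat \<Rightarrow> 'a" assume "s \<in> {s. range s \<subseteq> P}" "t \<in> {s. range s \<subseteq> P}"
  then have "s n \<in> P" "t n \<in> P" for n by auto
  then have "d (s n) (t n) = d (t n) (s n)" for n by (rule pseudo_emetric_sym[OF D])
  then show "ultimate_dist d s t = ultimate_dist d t s" unfolding ultimate_dist_def by simp
next
  fix s t u :: "nat \<Rightarrow> 'a" assume stu: "s \<in> {s. range s \<subseteq> P}" "t \<in> {s. range s \<subseteq> P}" "u \<in> {s. range s \<subseteq> P}"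
  show "ultimate_dist d s u \<le> ultimate_dist d s t + ultimate_dist d t u"
  proof (rule ennreal_le_add_dense)
    fix b c assume bc: "ultimate_dist d s t < b" "ultimate_dist d t u < c"
    obtain M N where MN: "\<forall>n\<ge>M. d (s n) (t n) < b" "\<forall>n\<ge>N. d (t n) (u n) < c"
      using ultimate_dist_lessD[OF bc(1)] ultimate_dist_lessD[OF bc(2)] by blast
    show "ultimate_dist d s u \<le> b + c"
    proof (rule ultimate_dist_le)
      fix n assume n: "n \<ge> max M N"
      have "d (s n) (u n) \<le> d (s n) (t n) + d (t n) (u n)"
        using stu by (intro pseudo_emetric_triangle[OF D]) auto
      also have "\<dots> \<le> b + c" using MN n by (intro add_mono less_imp_le) auto
      finally show "d (s n) (u n) \<le> b + c" .
    qed
  qed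
qed

text \<open>
  A point of the completion is a class of Cauchy sequences, and \<open>\<phi>\<close> maps a point to its constant
  sequence. A Cauchy sequence of points of \<open>P\<close> converges to its own class, which by density is
  enough for completeness.
\<close>
lemma completion:
  assumes U: "universe_type TYPE('u)" and P: "small TYPE('u) P" and D: "pseudo_emetric P d"
  obtains X :: "'u emetric" and \<phi> where
    "is_emetric X" "ecomplete X" "small TYPE('u) (points X)" "dense_in X (\<phi> ` P)"
    "\<And>p q. p \<in> P \<Longrightarrow> q \<in> P \<Longrightarrow> edist X (\<phi> p) (\<phi> q) = d p q"
proof -
  define S where "S = {s. cauchy_in P d s}"
  have SP: "S \<subseteq> {s. range s \<subseteq> P}" unfolding S_def cauchy_in_def by blast
  have S: "small TYPE('u) S" by (rule small_subset[OF SP small_sequences[OF U P]])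
  have DS: "pseudo_emetric S (ultimate_dist d)"
    by (rule pseudo_emetric_subset[OF pseudo_emetric_ultimate_dist[OF D] SP])
  obtain X :: "'u emetric" and \<psi> where X: "is_emetric X" "small TYPE('u) (points X)"
    "points X = \<psi> ` S" "\<And>s t. s \<in> S \<Longrightarrow> t \<in> S \<Longrightarrow> edist X (\<psi> s) (\<psi> t) = ultimate_dist d s t"
    using kolmogorov_quotient[OF S DS] by metis
  define \<phi> where "\<phi> p = \<psi> (\<lambda>_. p)" for p
  have cS: "(\<lambda>_. p) \<in> S" if "p \<in> P" for p
    using that pseudo_emetric_refl[OF D that] unfolding S_def cauchy_in_def by auto
  have dist: "edist X (\<phi> p) (\<phi> q) = d p q" if "p \<in> P" "q \<in> P" for p q
    unfolding \<phi>_def X(4)[OF cS[OF that(1)] cS[OF that(2)]] by (rule ultimate_dist_const)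
  have tail: "\<exists>N. \<forall>n\<ge>N. edist X (\<phi> (s n)) (\<psi> s) < \<epsilon>" if s: "s \<in> S" and \<epsilon>: "0 < \<epsilon>" for s \<epsilon>
  proof -
    obtain \<delta> where \<delta>: "0 < \<delta>" "\<delta> + \<delta> < \<epsilon>" using ennreal_half_pos[OF \<epsilon>] .
    have \<delta>': "\<delta> < \<epsilon>" using \<delta>(2) le_less_trans[of \<delta> "\<delta> + \<delta>" \<epsilon>] by simp
    have "cauchy_in P d s" using s unfolding S_def by simp
    then obtain N where N: "\<And>m n. m \<ge> N \<Longrightarrow> n \<ge> N \<Longrightarrow> d (s m) (s n) < \<delta>"
      using cauchy_inD \<delta>(1) by metis
    have sP: "s n \<in> P" for n using s SP by blast
    have "edist X (\<phi> (s n)) (\<psi> s) < \<epsilon>" if "n \<ge> N" for n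
    proof -
      have "edist X (\<phi> (s n)) (\<psi> s) = ultimate_dist d (\<lambda>_. s n) s"
        unfolding \<phi>_def by (rule X(4)[OF cS[OF sP] s])
      also have "\<dots> \<le> \<delta>" using N[OF that] by (intro ultimate_dist_le[of N] less_imp_le)
      finally show ?thesis using \<delta>' by (rule le_less_trans)
    qed
    then show ?thesis by blast
  qed
  have \<phi>X: "\<phi> p \<in> points X" if "p \<in> P" for p using cS[OF that] X(3) by (simp add: \<phi>_def)
  have dense: "dense_in X (\<phi> ` P)"
    unfolding dense_in_def
  proof (intro conjI ballI allI impI)
    show "\<phi> ` P \<subseteq> points X" using \<phi>X by blast
    fix x :: 'u and \<epsilon> :: ennreal assume x: "x \<in> points X" and "0 < \<epsilon>"
    then obtain s where s: "s \<in> S" "x = \<psi> s" using X(3) by blast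
    obtain N where "\<And>n. n \<ge> N \<Longrightarrow> edist X (\<phi> (s n)) x < \<epsilon>" using tail[OF s(1) \<open>0 < \<epsilon>\<close>] s(2) by blast
    then have N: "edist X (\<phi> (s N)) x < \<epsilon>" by simp
    have sN: "s N \<in> P" using s(1) SP by blast
    have "edist X x (\<phi> (s N)) < \<epsilon>" using N emetric_sym[OF X(1) x \<phi>X[OF sN]] by simp
    then show "\<exists>a\<in>\<phi> ` P. edist X x a < \<epsilon>" using sN by blast
  qed
  have "ecomplete X"
  proof (rule ecomplete_of_dense[OF X(1) dense])
    fix p assume p: "cauchy_in P (\<lambda>p q. edist X (\<phi> p) (\<phi> q)) p"
    then have "p n \<in> P" for n unfolding cauchy_in_def by blast
    then have "p \<in> S" using p unfolding S_def cauchy_in_def by (simp add: dist)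
    then show "\<exists>x\<in>points X. limit_of (edist X) (\<phi> \<circ> p) x"
      using tail[of p] X(3) unfolding limit_of_def comp_def by blast
  qed
  with X(1,2) dense dist that show thesis by blast
qed

section \<open>Splitting\<close>

text \<open>
  A form of approximate betweenness. Among complete spaces it singles out the intrinsic ones.
\<close>
definition splits :: "'a set \<Rightarrow> ('a \<Rightarrow> 'a \<Rightarrow> ennreal) \<Rightarrow> bool" where
  "splits A d \<longleftrightarrow> (\<forall>x\<in>A. \<forall>y\<in>A. \<forall>a>0. \<forall>b>0. d x y < a + b \<longrightarrow> (\<exists>z\<in>A. d x z < a \<and> d z y < b))"

lemma splitsD:
  "splits A d \<Longrightarrow> x \<in> A \<Longrightarrow> y \<in> A \<Longrightarrow> d x y < a + b \<Longrightarrow> 0 < a \<Longrightarrow> 0 < b \<Longrightarrow>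
     \<exists>z\<in>A. d x z < a \<and> d z y < b"
  unfolding splits_def by blast

text \<open>
  Moving \<open>x\<close> and \<open>y\<close> to nearby points of the dense subset costs less than the slack in
  \<open>d x y < a + b\<close>. Only rational \<open>a\<close> and \<open>b\<close> have to be tested, which lets a countable dense
  subset be made splitting by adding countably many points.
\<close>
lemma splits_of_dense:
  assumes X: "is_emetric X" and D: "dense_in X (\<phi> ` P)"
    and split: "\<And>p q a b. p \<in> P \<Longrightarrow> q \<in> P \<Longrightarrow> 0 < (a::rat) \<Longrightarrow> 0 < (b::rat) \<Longrightarrow>
      edist X (\<phi> p) (\<phi> q) < ennreal (real_of_rat a) + ennreal (real_of_rat b) \<Longrightarrow>
      \<exists>z\<in>P. edist X (\<phi> p) (\<phi> z) < ennreal (real_of_rat a) \<and> edist X (\<phi> z) (\<phi> q) < ennreal (real_of_rat b)"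
  shows "splits (points X) (edist X)"
  unfolding splits_def
proof (intro ballI allI impI)
  fix x y a b assume x: "x \<in> points X" and y: "y \<in> points X" and ab: "0 < a" "0 < b"
    and lt: "edist X x y < a + b"
  have psX: "pseudo_emetric (points X) (edist X)" using X is_emetric_iff_pseudo by blast
  obtain q r :: rat where qr: "0 < q" "0 < r" "ennreal (real_of_rat q) < a" "ennreal (real_of_rat r) < b"
    "edist X x y < ennreal (real_of_rat q) + ennreal (real_of_rat r)"
    using ennreal_less_add_cases[OF lt ab] .
  obtain u v :: rat where uv: "0 < u" "0 < v" "ennreal (real_of_rat u) < ennreal (real_of_rat q)"
     "ennreal (real_of_rat v) < ennreal (real_of_rat r)"
    "edist X x y < ennreal (real_of_rat u) + ennreal (real_of_rat v)"
    using ennreal_less_add_cases[OF qr(5)] qr(1,2) by (auto simp: ennreal_less_zero_iff)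
  have uq: "u < q" "v < r" using uv(1-4) by (auto simp: ennreal_less_iff of_rat_less)
  \<comment> \<open>The point \<open>x\<close> is displaced twice: once in the distance to be split, once in the distance to
    \<open>z\<close>; the same holds for \<open>y\<close>.\<close>
  define e where "e = min ((q - u) / 2) ((r - v) / 2)"
  have e: "0 < e" "u + e + e \<le> q" "v + e + e \<le> r" using uq by (auto simp: e_def min_def field_simps)
  let ?R = "\<lambda>s. ennreal (real_of_rat s)"
  have add: "?R s + ?R t = ?R (s + t)" if "0 < s" "0 < t" for s t
    using that by (simp add: of_rat_add)
  have e0: "0 < ?R e" using e(1) by (simp add: ennreal_less_zero_iff)
  obtain p where p: "p \<in> P" "edist X x (\<phi> p) < ?R e" using D x e0 unfolding dense_in_def by blast
  obtain p' where p': "p' \<in> P" "edist X y (\<phi> p') < ?R e" using D y e0 unfolding dense_in_def by blast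
  have \<phi>X: "\<phi> p \<in> points X" if "p \<in> P" for p using D that unfolding dense_in_def by blast
  have le: "?R (u + e + e) \<le> ?R q" "?R (v + e + e) \<le> ?R r"
    using e by (auto intro!: ennreal_leI simp: of_rat_less_eq)
  have "edist X (\<phi> p) (\<phi> p') \<le> edist X (\<phi> p) x + edist X x y + edist X (\<phi> p') y"
    using \<phi>X p(1) p'(1) x y by (intro pseudo_emetric_quadrangle[OF psX])
  also have "\<dots> = edist X x (\<phi> p) + edist X x y + edist X y (\<phi> p')"
    using \<phi>X p(1) p'(1) x y by (simp add: emetric_sym[OF X])
  also have "\<dots> < ?R e + (?R u + ?R v) + ?R e"
    using p(2) p'(2) uv(5) by (intro add_strict_mono)
  also have "\<dots> = (?R u + ?R e) + (?R v + ?R e)" by (simp only: ac_simps)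
  also have "\<dots> = ?R (u + e) + ?R (v + e)" using add e(1) uv(1,2) by simp
  finally obtain z where z: "z \<in> P" "edist X (\<phi> p) (\<phi> z) < ?R (u + e)" "edist X (\<phi> z) (\<phi> p') < ?R (v + e)"
    using split[OF p(1) p'(1), of "u + e" "v + e"] e(1) uv(1,2) by auto
  note zX = \<phi>X[OF z(1)] and pX = \<phi>X[OF p(1)] and p'X = \<phi>X[OF p'(1)]
  have "edist X x (\<phi> z) \<le> edist X x (\<phi> p) + edist X (\<phi> p) (\<phi> z)"
    by (rule emetric_triangle[OF X x pX zX])
  also have "\<dots> \<le> ?R e + ?R (u + e)" using p(2) z(2) by (intro add_mono less_imp_le)
  also have "\<dots> = ?R (u + e + e)" using add[of e "u + e"] e(1) uv(1) by (simp add: ac_simps)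
  also have "\<dots> < a" using le(1) qr(3) by (rule le_less_trans)
  finally have 1: "edist X x (\<phi> z) < a" .
  have "edist X (\<phi> z) y \<le> edist X (\<phi> z) (\<phi> p') + edist X (\<phi> p') y"
    by (rule emetric_triangle[OF X zX p'X y])
  also have "\<dots> \<le> ?R (v + e) + ?R e"
    using p'(2) z(3) emetric_sym[OF X y p'X] by (intro add_mono less_imp_le) auto
  also have "\<dots> = ?R (v + e + e)" using add[of "v + e" e] e(1) uv(2) by (simp add: ac_simps)
  also have "\<dots> < b" using le(2) qr(4) by (rule le_less_trans)
  finally show "\<exists>z\<in>points X. edist X x z < a \<and> edist X z y < b" using 1 zX by blast
qed

section \<open>Intrinsic metrics\<close>

lemma curve_length_ge:
  "subdivision a b n t \<Longrightarrow> (\<Sum>i<n. edist X (f (t i)) (f (t (Suc i)))) \<le> curve_length X a b f"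
  unfolding curve_length_def by (rule Sup_upper) blast

lemma edist_le_curve_length: "a \<le> b \<Longrightarrow> edist X (f a) (f b) \<le> curve_length X a b f"
  using curve_length_ge[of a b 1 "\<lambda>i. if i = 0 then a else b" X f] by (simp add: subdivision_def)

text \<open>
  Cut a curve of length less than \<open>q + r\<close> at the last time up to which all subdivision sums are
  at most \<open>q\<close>: just before it the curve is within \<open>q\<close> of the start, and just after it within \<open>r\<close>
  of the end.
\<close>
lemma intrinsic_imp_splits:
  assumes X: "is_emetric X" and I: "intrinsic X"
  shows "splits (points X) (edist X)"
  unfolding splits_def
proof (intro ballI allI impI)
  fix x y a b assume x: "x \<in> points X" and y: "y \<in> points X" and ab: "0 < a" "0 < b"
    and lt: "edist X x y < a + b"
  obtain q r where qr: "ennreal q < a" "ennreal r < b" "edist X x y < ennreal q + ennreal r"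
    using ennreal_less_add_cases[OF lt ab] by metis
  have "path_dist X x y < ennreal q + ennreal r" using I x y qr(3) unfolding intrinsic_def by metis
  then obtain \<alpha> \<beta> f where f: "ecurve X \<alpha> \<beta> f" "f \<alpha> = x" "f \<beta> = y"
    and len: "curve_length X \<alpha> \<beta> f < ennreal q + ennreal r"
    unfolding path_dist_def Inf_less_iff by blast
  have le: "\<alpha> \<le> \<beta>" and fX: "\<And>t. t \<in> {\<alpha>..\<beta>} \<Longrightarrow> f t \<in> points X"
    using f(1) unfolding ecurve_def by blast+
  have cont: "\<exists>\<delta>>0. \<forall>s\<in>{\<alpha>..\<beta>}. \<bar>s - t\<bar> < \<delta> \<longrightarrow> edist X (f s) (f t) < \<epsilon>"
    if "t \<in> {\<alpha>..\<beta>}" "0 < \<epsilon>" for t \<epsilon>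
    using f(1) that unfolding ecurve_def by blast
  \<comment> \<open>The disjunct \<open>t = \<alpha>\<close> makes \<open>A\<close> nonempty without computing the length of a constant curve.\<close>
  define A where "A = {t \<in> {\<alpha>..\<beta>}. t = \<alpha> \<or>
    (\<forall>n u. subdivision \<alpha> t n u \<longrightarrow> (\<Sum>i<n. edist X (f (u i)) (f (u (Suc i)))) \<le> ennreal q)}"
  have A_left: "edist X x (f t) \<le> ennreal q" if t: "t \<in> A" for t
  proof (cases "t = \<alpha>")
    case True
    then show ?thesis using f(2) emetric_refl[OF X x] by simp
  next
    case False
    have "subdivision \<alpha> t 1 (\<lambda>i. if i = 0 then \<alpha> else t)"
      using t by (auto simp: subdivision_def A_def)
    then have "(\<Sum>i<1. edist X (f (if i = 0 then \<alpha> else t)) (f (if Suc i = 0 then \<alpha> else t))) \<le> ennreal q"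
      using t False unfolding A_def by blast
    then show ?thesis using f(2) by simp
  qed
  have A_right: "edist X (f t) y \<le> ennreal r" if t: "t \<in> {\<alpha>..\<beta>}" "t \<notin> A" for t
  proof -
    obtain n u where u: "subdivision \<alpha> t n u"
      and s: "ennreal q < (\<Sum>i<n. edist X (f (u i)) (f (u (Suc i))))" (is "_ < ?s")
      using t unfolding A_def by (auto simp: not_le)
    \<comment> \<open>Appending \<open>\<beta>\<close> to a subdivision of \<open>[\<alpha>, t]\<close> whose sum exceeds \<open>q\<close> leaves less than \<open>r\<close> for
      the last step.\<close>
    let ?v = "u(Suc n := \<beta>)"
    have "subdivision \<alpha> \<beta> (Suc n) ?v" using u t by (auto simp: subdivision_def less_Suc_eq)
    from curve_length_ge[OF this, of X f]
    have "(\<Sum>i<n. edist X (f (?v i)) (f (?v (Suc i)))) + edist X (f t) y \<le> curve_length X \<alpha> \<beta> f"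
      using u f(3) by (simp add: subdivision_def)
    also have "(\<Sum>i<n. edist X (f (?v i)) (f (?v (Suc i)))) = ?s"
      by (intro sum.cong) auto
    finally have 1: "?s + edist X (f t) y < ennreal q + ennreal r" using len by (rule le_less_trans)
    show ?thesis
    proof (rule ccontr)
      assume "\<not> ?thesis"
      then have "ennreal q + ennreal r \<le> ?s + edist X (f t) y"
        using s by (intro add_mono) auto
      with 1 show False by simp
    qed
  qed
  define t0 where "t0 = Sup A"
  have bdd: "bdd_above A" unfolding A_def by (intro bdd_aboveI[of _ \<beta>]) auto
  have \<alpha>A: "\<alpha> \<in> A" using le by (simp add: A_def)
  have t0: "t0 \<in> {\<alpha>..\<beta>}"
  proof -
    have "Sup A \<le> \<beta>" by (rule cSup_least) (use \<alpha>A in \<open>auto simp: A_def\<close>)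
    then show ?thesis using cSup_upper[OF \<alpha>A bdd] by (simp add: t0_def)
  qed
  note zX = fX[OF t0]
  have "edist X x (f t0) \<le> ennreal q"
  proof (rule ennreal_le_epsilon)
    fix e :: real assume "0 < e"
    then obtain \<delta> where \<delta>: "\<delta> > 0" "\<And>s. s \<in> {\<alpha>..\<beta>} \<Longrightarrow> \<bar>s - t0\<bar> < \<delta> \<Longrightarrow> edist X (f s) (f t0) < ennreal e"
      using cont[OF t0, of "ennreal e"] by auto
    have "t0 - \<delta> < Sup A" "A \<noteq> {}" using \<delta>(1) \<alpha>A by (auto simp: t0_def)
    then obtain s where s: "s \<in> A" "t0 - \<delta> < s" by (rule less_cSupE)
    have "s \<le> t0" unfolding t0_def by (rule cSup_upper[OF s(1) bdd])
    note s = s this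
    then have sI: "s \<in> {\<alpha>..\<beta>}" by (simp add: A_def)
    have "edist X x (f t0) \<le> edist X x (f s) + edist X (f s) (f t0)"
      by (rule emetric_triangle[OF X x fX[OF sI] zX])
    also have "\<dots> \<le> ennreal q + ennreal e"
      using A_left[OF s(1)] \<delta>(2)[OF sI] s by (intro add_mono less_imp_le[of "edist X (f s) (f t0)"]) auto
    finally show "edist X x (f t0) \<le> ennreal q + ennreal e" .
  qed
  moreover have "edist X (f t0) y \<le> ennreal r"
  proof (cases "t0 = \<beta>")
    case True
    then show ?thesis using f(3) emetric_refl[OF X y] by simp
  next
    case False
    then have "t0 < \<beta>" using t0 by simp
    show ?thesis
    proof (rule ennreal_le_epsilon)
      fix e :: real assume "0 < e"
      then obtain \<delta> where \<delta>: "\<delta> > 0" "\<And>s. s \<in> {\<alpha>..\<beta>} \<Longrightarrow> \<bar>s - t0\<bar> < \<delta> \<Longrightarrow> edist X (f s) (f t0) < ennreal e"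
        using cont[OF t0, of "ennreal e"] by auto
      define s where "s = min \<beta> (t0 + \<delta> / 2)"
      have s: "t0 < s" "s \<in> {\<alpha>..\<beta>}" "\<bar>s - t0\<bar> < \<delta>" using \<open>t0 < \<beta>\<close> \<delta>(1) t0 by (auto simp: s_def)
      then have "s \<notin> A" using cSup_upper[OF _ bdd, of s] by (auto simp: t0_def)
      have "edist X (f t0) y \<le> edist X (f t0) (f s) + edist X (f s) y"
        by (rule emetric_triangle[OF X zX fX[OF s(2)] y])
      also have "\<dots> = edist X (f s) (f t0) + edist X (f s) y"
        by (simp add: emetric_sym[OF X zX fX[OF s(2)]])
      also have "\<dots> \<le> ennreal e + ennreal r"
        using \<delta>(2)[OF s(2,3)] A_right[OF s(2) \<open>s \<notin> A\<close>] by (intro add_mono less_imp_le[of "edist X (f s) (f t0)"])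
      finally show "edist X (f t0) y \<le> ennreal r + ennreal e" by (simp add: add.commute)
    qed
  qed
  ultimately show "\<exists>z\<in>points X. edist X x z < a \<and> edist X z y < b"
    using zX qr(1,2) le_less_trans by blast
qed

definition real_interval :: "real \<Rightarrow> real emetric" where
  "real_interval l = \<lparr>points = {0..l}, edist = \<lambda>s t. ennreal \<bar>s - t\<bar>\<rparr>"

lemma is_emetric_real_interval: "is_emetric (real_interval l)"
  unfolding is_emetric_def real_interval_def
  by (auto simp: abs_minus_commute simp flip: ennreal_plus intro!: ennreal_leI)

definition midpoint :: "'a emetric \<Rightarrow> real \<Rightarrow> 'a \<Rightarrow> 'a \<Rightarrow> 'a" where
  "midpoint X c u v = (SOME z. z \<in> points X \<and> edist X u z < ennreal c \<and> edist X z v < ennreal c)"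

text \<open>
  The value at \<open>k * l / 2 ^ n\<close> of a path from \<open>x\<close> to \<open>y\<close> that is obtained by repeated halving.
  Past the end, for \<open>k \<ge> 2 ^ n\<close>, the pair of \<open>y\<close> and \<open>y\<close> is halved in the same way, so that the
  estimates for consecutive \<open>k\<close> hold without a bound on \<open>k\<close>.
\<close>
fun dyadic_path :: "'a emetric \<Rightarrow> real \<Rightarrow> 'a \<Rightarrow> 'a \<Rightarrow> nat \<Rightarrow> nat \<Rightarrow> 'a" where
  "dyadic_path X l x y 0 k = (if k = 0 then x else y)"
| "dyadic_path X l x y (Suc n) k =
     (if even k then dyadic_path X l x y n (k div 2)
      else midpoint X (l / 2 ^ Suc n) (dyadic_path X l x y n (k div 2))
        (dyadic_path X l x y n (Suc (k div 2))))"

text \<open>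
  At stage \<open>n\<close> consecutive points of the dyadic path are less than \<open>l / 2 ^ n\<close> apart, because a
  strict bound \<open>2 * c\<close> on a distance splits into two strict bounds \<open>c\<close>. Hence the dyadic path is
  non-expansive for the metric of \<open>[0, l]\<close>, and it extends from the dyadic points by
  completeness.
\<close>
lemma lipschitz_path:
  assumes X: "is_emetric X" "ecomplete X" and S: "splits (points X) (edist X)"
    and x: "x \<in> points X" and y: "y \<in> points X" and l: "0 < l" "edist X x y < ennreal l"
  obtains h where "h ` {0..l} \<subseteq> points X" "h 0 = x" "h l = y"
    "\<And>s t. s \<in> {0..l} \<Longrightarrow> t \<in> {0..l} \<Longrightarrow> edist X (h s) (h t) \<le> ennreal \<bar>s - t\<bar>"
proof -
  let ?f = "dyadic_path X l x y"
  have step: "(\<forall>k. ?f n k \<in> points X) \<and> (\<forall>k. edist X (?f n k) (?f n (Suc k)) < ennreal (l / 2 ^ n))" for n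
  proof (induction n)
    case 0
    show ?case using x y l emetric_refl[OF X(1) y] by auto
  next
    case (Suc n)
    let ?c = "l / 2 ^ Suc n"
    have c: "0 < ?c" "ennreal (l / 2 ^ n) = ennreal ?c + ennreal ?c"
      using l(1) by (auto simp flip: ennreal_plus)
    have mid: "midpoint X ?c (?f n k) (?f n (Suc k)) \<in> points X \<and>
        edist X (?f n k) (midpoint X ?c (?f n k) (?f n (Suc k))) < ennreal ?c \<and>
        edist X (midpoint X ?c (?f n k) (?f n (Suc k))) (?f n (Suc k)) < ennreal ?c" for k
    proof -
      have "\<exists>z\<in>points X. edist X (?f n k) z < ennreal ?c \<and> edist X z (?f n (Suc k)) < ennreal ?c"
      proof -
        have "0 < ennreal ?c" using c(1) by (simp only: ennreal_less_zero_iff)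
        moreover have "edist X (?f n k) (?f n (Suc k)) < ennreal ?c + ennreal ?c"
          using Suc by (simp only: c(2))
        ultimately show ?thesis using S Suc unfolding splits_def by blast
      qed
      from someI_ex[OF this[unfolded Bex_def]] show ?thesis unfolding midpoint_def .
    qed
    have "?f (Suc n) k \<in> points X" for k using Suc mid[of "k div 2"] by simp
    moreover have "edist X (?f (Suc n) k) (?f (Suc n) (Suc k)) < ennreal ?c" for k
      using mid[of "k div 2"] by (cases "even k") (auto elim!: oddE evenE)
    ultimately show ?case by blast
  qed
  then have fX: "?f n k \<in> points X" for n k by blast
  have psX: "pseudo_emetric (points X) (edist X)" using X(1) is_emetric_iff_pseudo by blast
  have far: "edist X (?f n k) (?f n (k + i)) \<le> ennreal (real i * l / 2 ^ n)" for n k i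
  proof (induction i)
    case 0
    show ?case using emetric_refl[OF X(1) fX] by simp
  next
    case (Suc i)
    have "edist X (?f n k) (?f n (k + Suc i)) \<le>
        edist X (?f n k) (?f n (k + i)) + edist X (?f n (k + i)) (?f n (Suc (k + i)))"
      using emetric_triangle[OF X(1) fX fX fX] by simp
    also have "\<dots> \<le> ennreal (real i * l / 2 ^ n) + ennreal (l / 2 ^ n)"
      using Suc step by (intro add_mono less_imp_le[of "edist X (?f n (k + i)) _"]) auto
    also have "\<dots> = ennreal (real (Suc i) * l / 2 ^ n)"
      using l(1) by (simp add: field_simps flip: ennreal_plus)
    finally show ?case .
  qed
  have refine: "?f (n + j) (2 ^ j * k) = ?f n k" for n j k
    by (induction j) (auto simp: mult.assoc)
  define P where "P = {(n, k). k \<le> (2::nat) ^ n}"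
  define \<phi> where "\<phi> = (\<lambda>(n::nat, k::nat). real k * l / 2 ^ n)"
  define g where "g = (\<lambda>(n, k). ?f n k)"
  have le1: "edist X (?f n k) (?f n k') \<le> ennreal \<bar>real k * l / 2 ^ n - real k' * l / 2 ^ n\<bar>" for n k k'
  proof -
    have up: "edist X (?f n k) (?f n k') \<le> ennreal \<bar>real k * l / 2 ^ n - real k' * l / 2 ^ n\<bar>"
      if "k \<le> k'" for k k'
    proof -
      from that obtain i where i: "k' = k + i" by (rule less_eqE)
      have "\<bar>real k * l / 2 ^ n - real k' * l / 2 ^ n\<bar> = real i * l / 2 ^ n"
        using l(1) by (simp add: i add_divide_distrib distrib_right)
      then show ?thesis using far[of n k i] i by simp
    qed
    show ?thesis
    proof (cases "k \<le> k'")
      case False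
      then show ?thesis
        using up[of k' k] emetric_sym[OF X(1) fX fX, of n k n k'] by (simp add: abs_minus_commute)
    qed (rule up)
  qed
  have lip: "edist X (g p) (g p') \<le> edist (real_interval l) (\<phi> p) (\<phi> p')" for p p'
  proof -
    obtain n k m k' where p: "p = (n, k)" "p' = (m, k')" by (metis surj_pair)
    \<comment> \<open>Dyadic numbers with different denominators are compared at a common stage.\<close>
    have "g p = ?f (n + m) (2 ^ m * k)" "g p' = ?f (n + m) (2 ^ n * k')"
      using refine[of n m k] refine[of m n k'] by (simp_all add: g_def p add.commute)
    moreover have "\<phi> p = real (2 ^ m * k) * l / 2 ^ (n + m)" "\<phi> p' = real (2 ^ n * k') * l / 2 ^ (n + m)"
      by (simp_all add: \<phi>_def p power_add)
    ultimately show ?thesis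
      using le1[of "n + m" "2 ^ m * k" "2 ^ n * k'"] by (simp add: real_interval_def)
  qed
  have dense: "dense_in (real_interval l) (\<phi> ` P)"
    unfolding dense_in_def
  proof (intro conjI ballI allI impI)
    show "\<phi> ` P \<subseteq> points (real_interval l)"
    proof -
      have "real k * l / 2 ^ n \<le> l" if "k \<le> 2 ^ n" for k n
      proof -
        have "real k \<le> 2 ^ n" using that by (metis of_nat_le_iff of_nat_numeral of_nat_power)
        then show ?thesis using l(1) by (simp add: field_simps)
      qed
      then show ?thesis using l(1) by (auto simp: \<phi>_def P_def real_interval_def)
    qed
    fix t \<epsilon> assume t: "t \<in> points (real_interval l)" and \<epsilon>: "0 < (\<epsilon> :: ennreal)"
    then have t: "0 \<le> t" "t \<le> l" by (auto simp: real_interval_def)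
    obtain q where q: "0 < ennreal q" "ennreal q < \<epsilon>" using ennreal_rat_dense[OF \<epsilon>] by blast
    then have "0 < q" by simp
    obtain n where n: "l / q < 2 ^ n" using real_arch_pow[of 2 "l / q"] by auto
    then have n: "l / 2 ^ n < q" using \<open>0 < q\<close> l(1) by (simp add: field_simps)
    define k where "k = nat \<lfloor>t * 2 ^ n / l\<rfloor>"
    have k: "real k \<le> t * 2 ^ n / l" "t * 2 ^ n / l < real k + 1"
      using t l(1) by (auto simp: k_def)
    have "t * 2 ^ n / l \<le> 2 ^ n" using t l(1) by (simp add: field_simps)
    then have "real k \<le> 2 ^ n" using k(1) by linarith
    then have "k \<le> 2 ^ n" by (metis of_nat_le_iff of_nat_numeral of_nat_power)
    then have kP: "(n, k) \<in> P" by (simp add: P_def)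
    have "real k * l / 2 ^ n \<le> t" "t < real k * l / 2 ^ n + l / 2 ^ n"
      using k l(1) by (auto simp: field_simps)
    then have "\<bar>t - \<phi> (n, k)\<bar> < q" using n by (simp add: \<phi>_def)
    then have "edist (real_interval l) t (\<phi> (n, k)) < ennreal q"
      using \<open>0 < q\<close> by (simp add: real_interval_def ennreal_lessI)
    then show "\<exists>a\<in>\<phi> ` P. edist (real_interval l) t a < \<epsilon>" using q(2) kP less_trans by blast
  qed
  have gX: "g ` P \<subseteq> points X" using fX by (auto simp: g_def)
  obtain h where h: "h \<in> points (real_interval l) \<rightarrow>\<^sub>E points X"
    "\<And>s t. s \<in> points (real_interval l) \<Longrightarrow> t \<in> points (real_interval l) \<Longrightarrow>
       edist X (h s) (h t) \<le> edist (real_interval l) s t"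
    "\<And>p. p \<in> P \<Longrightarrow> h (\<phi> p) = g p"
    using nonexpansive_extension[OF is_emetric_real_interval X dense gX lip] by blast
  show thesis
  proof (rule that[of h])
    show "h ` {0..l} \<subseteq> points X" using h(1) by (auto simp: real_interval_def)
    show "h 0 = x" using h(3)[of "(0, 0)"] by (simp add: P_def \<phi>_def g_def)
    show "h l = y" using h(3)[of "(0, 1)"] by (simp add: P_def \<phi>_def g_def)
    show "edist X (h s) (h t) \<le> ennreal \<bar>s - t\<bar>" if "s \<in> {0..l}" "t \<in> {0..l}" for s t
      using h(2) that by (simp add: real_interval_def)
  qed
qed

lemma splits_imp_intrinsic:
  assumes X: "is_emetric X" "ecomplete X" and S: "splits (points X) (edist X)"
  shows "intrinsic X"
  unfolding intrinsic_def
proof (intro ballI antisym)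
  fix x y assume x: "x \<in> points X" and y: "y \<in> points X"
  show "edist X x y \<le> path_dist X x y"
    unfolding path_dist_def ecurve_def by (intro Inf_greatest) (auto intro: edist_le_curve_length)
  show "path_dist X x y \<le> edist X x y"
  proof (rule ennreal_le_epsilon)
    fix e :: real assume fin: "edist X x y < top" and e: "0 < e"
    obtain d where d: "0 \<le> d" "edist X x y = ennreal d" using fin by (cases "edist X x y") auto
    define l where "l = d + e"
    have l: "0 < l" "edist X x y < ennreal l" using d e by (auto simp: l_def ennreal_lessI)
    obtain h where h: "h ` {0..l} \<subseteq> points X" "h 0 = x" "h l = y"
      "\<And>s t. s \<in> {0..l} \<Longrightarrow> t \<in> {0..l} \<Longrightarrow> edist X (h s) (h t) \<le> ennreal \<bar>s - t\<bar>"
      using lipschitz_path[OF X S x y l] by blast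
    have "ecurve X 0 l h"
      unfolding ecurve_def
    proof (intro conjI ballI allI impI)
      fix t and \<epsilon> :: ennreal assume t: "t \<in> {0..l}" and \<epsilon>: "0 < \<epsilon>"
      obtain q where q: "0 < ennreal q" "ennreal q < \<epsilon>" using ennreal_rat_dense[OF \<epsilon>] by blast
      have "edist X (h s) (h t) < \<epsilon>" if s: "s \<in> {0..l}" "\<bar>s - t\<bar> < q" for s
      proof -
        have "edist X (h s) (h t) \<le> ennreal q"
          using h(4)[OF s(1) t] s(2) by (meson ennreal_leI less_imp_le order_trans)
        then show ?thesis using q(2) by (rule le_less_trans)
      qed
      then show "\<exists>\<delta>>0. \<forall>s\<in>{0..l}. \<bar>s - t\<bar> < \<delta> \<longrightarrow> edist X (h s) (h t) < \<epsilon>"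
        using q(1) by (intro exI[of _ q]) auto
    qed (use l h(1) in auto)
    moreover have "curve_length X 0 l h \<le> ennreal l"
      unfolding curve_length_def
    proof (rule Sup_least, clarify)
      fix n t assume sub: "subdivision 0 l n t"
      have mono: "t i \<le> t j" if "i \<le> j" "j \<le> n" for i j
        using that sub by (induction j rule: dec_induct) (auto simp: subdivision_def intro: order_trans)
      have I: "t i \<in> {0..l}" if "i \<le> n" for i
        using mono[of 0 i] mono[of i n] that sub by (auto simp: subdivision_def)
      have "(\<Sum>i<n. edist X (h (t i)) (h (t (Suc i)))) \<le> (\<Sum>i<n. ennreal (t (Suc i) - t i))"
      proof (rule sum_mono)
        fix i assume "i \<in> {..<n}"
        then show "edist X (h (t i)) (h (t (Suc i))) \<le> ennreal (t (Suc i) - t i)"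
          using h(4)[OF I I, of i "Suc i"] mono[of i "Suc i"] by auto
      qed
      also have "\<dots> = ennreal (\<Sum>i<n. t (Suc i) - t i)"
        using mono by (intro sum_ennreal) auto
      also have "(\<Sum>i<n. t (Suc i) - t i) = l"
        using sub by (simp add: sum_lessThan_telescope subdivision_def)
      finally show "(\<Sum>i<n. edist X (h (t i)) (h (t (Suc i)))) \<le> ennreal l" .
    qed
    ultimately have "path_dist X x y \<le> ennreal l"
      unfolding path_dist_def using h(2,3) by (intro Inf_lower2[of "curve_length X 0 l h"]) blast+
    then show "path_dist X x y \<le> edist X x y + ennreal e" using d e by (simp add: l_def)
  qed
qed

section \<open>The category of complete intrinsic metric spaces\<close>

text \<open>
  From here on, intrinsic spaces are handled through splitting only.
\<close>
lemma Obj_CPMet: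
  "X \<in> Obj (CPMet :: ('u emetric, ('u emetric, 'u) morphism) cat) \<longleftrightarrow>
     is_emetric X \<and> ecomplete X \<and> small TYPE('u) (points X) \<and> splits (points X) (edist X)"
  using intrinsic_imp_splits splits_imp_intrinsic
  by (auto simp: CPMet_def full_subcategory_def CMet_def)

text \<open>
  The underlying functions of the morphisms. Together with the next lemmas it allows working
  with functions on points instead of morphism records.
\<close>
definition maps :: "'a emetric \<Rightarrow> 'a emetric \<Rightarrow> ('a \<Rightarrow> 'a) set" where
  "maps X Y = {h. h \<in> points X \<rightarrow>\<^sub>E points Y \<and> nonexpansive X Y h}"

lemma mapsI:
  "(\<And>x. x \<in> points X \<Longrightarrow> h x \<in> points Y) \<Longrightarrow>
   (\<And>x y. x \<in> points X \<Longrightarrow> y \<in> points X \<Longrightarrow> edist Y (h x) (h y) \<le> edist X x y) \<Longrightarrow>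
   restrict h (points X) \<in> maps X Y"
  unfolding maps_def nonexpansive_def by auto

lemma maps_in: "h \<in> maps X Y \<Longrightarrow> x \<in> points X \<Longrightarrow> h x \<in> points Y"
  and maps_le: "h \<in> maps X Y \<Longrightarrow> x \<in> points X \<Longrightarrow> y \<in> points X \<Longrightarrow> edist Y (h x) (h y) \<le> edist X x y"
  and maps_eqI: "h \<in> maps X Y \<Longrightarrow> k \<in> maps X Y \<Longrightarrow> (\<And>x. x \<in> points X \<Longrightarrow> h x = k x) \<Longrightarrow> h = k"
  unfolding maps_def nonexpansive_def by (auto intro: PiE_ext)

lemma maps_compose: "h \<in> maps X Y \<Longrightarrow> k \<in> maps Y Z \<Longrightarrow> compose (points X) k h \<in> maps X Z"
  unfolding compose_def
  by (intro mapsI order_trans[OF maps_le[of k Y Z] maps_le[of h X Y]]) (auto intro: maps_in)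

lemma maps_id: "restrict (\<lambda>x. x) (points X) \<in> maps X X"
  by (rule mapsI) auto

lemma hom_CPMet:
  "f \<in> hom CPMet X Y \<longleftrightarrow>
     X \<in> Obj CPMet \<and> Y \<in> Obj CPMet \<and> source f = X \<and> target f = Y \<and> func f \<in> maps X Y"
  by (auto simp: hom_def CPMet_def full_subcategory_def CMet_def maps_def Let_def)

lemma hom_CPMet_eqI:
  "f \<in> hom CPMet X Y \<Longrightarrow> g \<in> hom CPMet X Y \<Longrightarrow>
     (\<And>x. x \<in> points X \<Longrightarrow> func f x = func g x) \<Longrightarrow> f = g"
  by (auto simp: hom_CPMet intro!: morphism.expand maps_eqI)

lemma Comp_CPMet: "Comp CPMet = comp_on points"
  and Id_CPMet: "Id CPMet X = Morphism X X (restrict (\<lambda>x. x) (points X))"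
  by (simp_all add: CPMet_def full_subcategory_def CMet_def Let_def)

lemma func_Comp_CPMet:
  "f \<in> hom CPMet X Y \<Longrightarrow> x \<in> points X \<Longrightarrow> func (Comp CPMet g f) x = func g (func f x)"
  by (auto simp: hom_CPMet Comp_CPMet comp_on_def compose_def)

lemma Comp_hom_CPMet:
  "f \<in> hom CPMet X Y \<Longrightarrow> g \<in> hom CPMet Y Z \<Longrightarrow> Comp CPMet g f \<in> hom CPMet X Z"
  by (auto simp: hom_CPMet Comp_CPMet comp_on_def maps_compose)

lemma Id_hom_CPMet: "X \<in> Obj CPMet \<Longrightarrow> Id CPMet X \<in> hom CPMet X X"
  by (simp add: hom_CPMet Id_CPMet maps_id)

lemma hom_CPMet_in: "f \<in> hom CPMet X Y \<Longrightarrow> x \<in> points X \<Longrightarrow> func f x \<in> points Y"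
  by (auto simp: hom_CPMet dest: maps_in)

lemma hom_CPMet_le:
  "f \<in> hom CPMet X Y \<Longrightarrow> x \<in> points X \<Longrightarrow> y \<in> points X \<Longrightarrow>
     edist Y (func f x) (func f y) \<le> edist X x y"
  by (auto simp: hom_CPMet dest: maps_le)

lemma category_CPMet: "category (CPMet :: ('u emetric, ('u emetric, 'u) morphism) cat)"
proof
  let ?C = "CPMet :: ('u emetric, ('u emetric, 'u) morphism) cat"
  fix f w x y z assume f: "f \<in> hom ?C w x"
  {
    fix g h assume g: "g \<in> hom ?C x y" and h: "h \<in> hom ?C y z"
    show "Comp ?C h (Comp ?C g f) = Comp ?C (Comp ?C h g) f"
      by (rule hom_CPMet_eqI[of _ w z])
        (auto simp: f g h func_Comp_CPMet[OF f] func_Comp_CPMet[OF g]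
          func_Comp_CPMet[OF Comp_hom_CPMet[OF f g]] hom_CPMet_in[OF f]
          intro: Comp_hom_CPMet[OF Comp_hom_CPMet[OF f g] h] Comp_hom_CPMet[OF f Comp_hom_CPMet[OF g h]])
  next
    have wx: "w \<in> Obj ?C" "x \<in> Obj ?C" using f by (auto simp: hom_CPMet)
    show "Comp ?C f (Id ?C w) = f"
      by (rule hom_CPMet_eqI[OF Comp_hom_CPMet[OF Id_hom_CPMet[OF wx(1)] f] f])
        (subst func_Comp_CPMet[OF Id_hom_CPMet[OF wx(1)]], assumption, simp add: Id_CPMet)
    show "Comp ?C (Id ?C x) f = f"
      by (rule hom_CPMet_eqI[OF Comp_hom_CPMet[OF f Id_hom_CPMet[OF wx(2)]] f])
        (subst func_Comp_CPMet[OF f], assumption, simp add: Id_CPMet hom_CPMet_in[OF f])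
  next
    fix g assume "g \<in> hom ?C x y"
    then show "Comp ?C g f \<in> hom ?C w y" using Comp_hom_CPMet f by blast
  }
next
  let ?C = "CPMet :: ('u emetric, ('u emetric, 'u) morphism) cat"
  fix f assume "f \<in> Arr ?C"
  then have "f \<in> hom ?C (Dom ?C f) (Cod ?C f)" by (simp add: hom_def)
  then show "Dom ?C f \<in> Obj ?C" "Cod ?C f \<in> Obj ?C" by (simp_all add: hom_CPMet)
qed (rule Id_hom_CPMet)

section \<open>Colimits\<close>

locale diagram =
  fixes J :: "('j, 'k) cat" and Fo :: "'j \<Rightarrow> 'u emetric" and Fa :: "'k \<Rightarrow> ('u emetric, 'u) morphism"
  assumes F: "is_functor J CPMet Fo Fa"
begin

lemma Fo: "i \<in> Obj J \<Longrightarrow> Fo i \<in> Obj CPMet"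
  using F unfolding is_functor_def by blast

lemma Fo_emetric: "i \<in> Obj J \<Longrightarrow> is_emetric (Fo i)"
  using Fo by (simp add: Obj_CPMet)

lemma Fa: "i \<in> Obj J \<Longrightarrow> j \<in> Obj J \<Longrightarrow> u \<in> hom J i j \<Longrightarrow> Fa u \<in> hom CPMet (Fo i) (Fo j)"
  using F unfolding is_functor_def by blast

lemma Fa_in:
  "i \<in> Obj J \<Longrightarrow> j \<in> Obj J \<Longrightarrow> u \<in> hom J i j \<Longrightarrow> x \<in> points (Fo i) \<Longrightarrow> func (Fa u) x \<in> points (Fo j)"
  by (rule hom_CPMet_in[OF Fa])

lemma is_cocone_iff:
  "is_cocone J CPMet Fo Fa X \<iota> \<longleftrightarrow> X \<in> Obj CPMet \<and> (\<forall>i\<in>Obj J. \<iota> i \<in> hom CPMet (Fo i) X) \<and>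
     (\<forall>i\<in>Obj J. \<forall>j\<in>Obj J. \<forall>u\<in>hom J i j. \<forall>x\<in>points (Fo i).
        func (\<iota> j) (func (Fa u) x) = func (\<iota> i) x)"
proof -
  have "Comp CPMet (\<iota> j) (Fa u) = \<iota> i \<longleftrightarrow> (\<forall>x\<in>points (Fo i). func (\<iota> j) (func (Fa u) x) = func (\<iota> i) x)"
    if i: "i \<in> Obj J" and j: "j \<in> Obj J" and u: "u \<in> hom J i j"
      and \<iota>: "\<iota> i \<in> hom CPMet (Fo i) X" "\<iota> j \<in> hom CPMet (Fo j) X" for i j u
    using hom_CPMet_eqI[OF Comp_hom_CPMet[OF Fa[OF i j u] \<iota>(2)] \<iota>(1)]
      func_Comp_CPMet[OF Fa[OF i j u]] by metis
  then show ?thesis unfolding is_cocone_def by (auto 0 4)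
qed

lemma is_colimit_iff:
  assumes X: "is_cocone J CPMet Fo Fa X \<iota>"
  shows "is_colimit J CPMet Fo Fa X \<iota> \<longleftrightarrow> (\<forall>Y \<gamma>. is_cocone J CPMet Fo Fa Y \<gamma> \<longrightarrow>
     (\<exists>!h. h \<in> maps X Y \<and> (\<forall>i\<in>Obj J. \<forall>x\<in>points (Fo i). h (func (\<iota> i) x) = func (\<gamma> i) x)))"
proof -
  have "(\<exists>!f. f \<in> hom CPMet X Y \<and> (\<forall>i \<in> Obj J. Comp CPMet f (\<iota> i) = \<gamma> i)) \<longleftrightarrow>
     (\<exists>!h. h \<in> maps X Y \<and> (\<forall>i\<in>Obj J. \<forall>x\<in>points (Fo i). h (func (\<iota> i) x) = func (\<gamma> i) x))"
    (is "Ex1 ?P \<longleftrightarrow> Ex1 ?Q")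
    if Y: "is_cocone J CPMet Fo Fa Y \<gamma>" for Y \<gamma>
  proof -
    have XY: "X \<in> Obj CPMet" "Y \<in> Obj CPMet" using X Y unfolding is_cocone_def by blast+
    have eq: "Comp CPMet f (\<iota> i) = \<gamma> i \<longleftrightarrow> (\<forall>x\<in>points (Fo i). func f (func (\<iota> i) x) = func (\<gamma> i) x)"
      if f: "f \<in> hom CPMet X Y" and i: "i \<in> Obj J" for f i
    proof -
      have \<iota>: "\<iota> i \<in> hom CPMet (Fo i) X" and \<gamma>: "\<gamma> i \<in> hom CPMet (Fo i) Y"
        using X Y i unfolding is_cocone_def by blast+
      show ?thesis
        using hom_CPMet_eqI[OF Comp_hom_CPMet[OF \<iota> f] \<gamma>] func_Comp_CPMet[OF \<iota>] by metis
    qed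
    have Q: "?Q h \<longleftrightarrow> ?P (Morphism X Y h)" for h
    proof -
      have "Morphism X Y h \<in> hom CPMet X Y \<longleftrightarrow> h \<in> maps X Y" using XY by (simp add: hom_CPMet)
      then show ?thesis using eq[of "Morphism X Y h"] by auto
    qed
    have P: "f = Morphism X Y (func f)" if "?P f" for f
      using that by (cases f) (auto simp: hom_CPMet)
    show ?thesis
    proof
      assume "Ex1 ?P"
      then obtain f where f: "?P f" "\<And>g. ?P g \<Longrightarrow> g = f" by (elim ex1E) blast
      show "Ex1 ?Q"
      proof (rule ex1I[of _ "func f"])
        show "?Q (func f)" using f(1) P[OF f(1)] Q by metis
        show "h = func f" if "?Q h" for h using f(2)[of "Morphism X Y h"] that Q by (metis morphism.sel(3))
      qed
    next
      assume "Ex1 ?Q"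
      then obtain h where h: "?Q h" "\<And>k. ?Q k \<Longrightarrow> k = h" by (elim ex1E) blast
      show "Ex1 ?P"
      proof (rule ex1I[of _ "Morphism X Y h"])
        show "?P (Morphism X Y h)" using h(1) Q by blast
        show "f = Morphism X Y h" if "?P f" for f using h(2)[of "func f"] P[OF that] that Q by metis
      qed
    qed
  qed
  then have "(is_cocone J CPMet Fo Fa Y \<gamma> \<longrightarrow>
        (\<exists>!f. f \<in> hom CPMet X Y \<and> (\<forall>i \<in> Obj J. Comp CPMet f (\<iota> i) = \<gamma> i))) \<longleftrightarrow>
      (is_cocone J CPMet Fo Fa Y \<gamma> \<longrightarrow>
        (\<exists>!h. h \<in> maps X Y \<and> (\<forall>i\<in>Obj J. \<forall>x\<in>points (Fo i). h (func (\<iota> i) x) = func (\<gamma> i) x)))"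
    for Y \<gamma> by (rule imp_cong[OF refl])
  then show ?thesis unfolding is_colimit_def by (simp only: X simp_thms)
qed

abbreviation total :: "('j \<times> 'u) set" where
  "total \<equiv> SIGMA i:Obj J. points (Fo i)"

text \<open>
  Only moves inside a space cost their distance. Moves along the maps of the diagram, in either
  direction, are free, since every cocone identifies their end points.
\<close>
inductive chain :: "'j \<times> 'u \<Rightarrow> ennreal \<Rightarrow> 'j \<times> 'u \<Rightarrow> bool" where
  stop: "p \<in> total \<Longrightarrow> chain p 0 p"
| move: "i \<in> Obj J \<Longrightarrow> x \<in> points (Fo i) \<Longrightarrow> y \<in> points (Fo i) \<Longrightarrow> chain (i, y) c q \<Longrightarrow>
    chain (i, x) (edist (Fo i) x y + c) q"
| push: "i \<in> Obj J \<Longrightarrow> j \<in> Obj J \<Longrightarrow> u \<in> hom J i j \<Longrightarrow> x \<in> points (Fo i) \<Longrightarrow>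
    chain (j, func (Fa u) x) c q \<Longrightarrow> chain (i, x) c q"
| pull: "i \<in> Obj J \<Longrightarrow> j \<in> Obj J \<Longrightarrow> u \<in> hom J i j \<Longrightarrow> x \<in> points (Fo i) \<Longrightarrow>
    chain (i, x) c q \<Longrightarrow> chain (j, func (Fa u) x) c q"

lemma chain_total: "chain p c q \<Longrightarrow> p \<in> total \<and> q \<in> total"
  by (induction rule: chain.induct) (auto simp: Fa_in)

lemma chain_trans: "chain p c q \<Longrightarrow> chain q e r \<Longrightarrow> chain p (c + e) r"
  by (induction rule: chain.induct) (auto simp: add.assoc intro: chain.intros)

lemma chain_sym: "chain p c q \<Longrightarrow> chain q c p"
proof (induction rule: chain.induct)
  case (stop p)
  then show ?case by (rule chain.stop)
next
  case (move i x y c q)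
  have "chain (i, x) 0 (i, x)" using move.hyps by (intro chain.stop) simp
  then have "chain (i, y) (edist (Fo i) y x + 0) (i, x)" by (rule chain.move[OF move.hyps(1,3,2)])
  then have "chain q (c + (edist (Fo i) y x + 0)) (i, x)" by (rule chain_trans[OF move.IH])
  then show ?case
    using emetric_sym[OF Fo_emetric[OF move.hyps(1)] move.hyps(2,3)] by (simp add: add.commute)
next
  case (push i j u x c q)
  have "chain (i, x) 0 (i, x)" using push.hyps by (intro chain.stop) simp
  then have "chain (j, func (Fa u) x) 0 (i, x)" by (rule chain.pull[OF push.hyps(1-4)])
  from chain_trans[OF push.IH this] show ?case by simp
next
  case (pull i j u x c q)
  have "chain (j, func (Fa u) x) 0 (j, func (Fa u) x)"
    using pull.hyps(2) Fa_in[OF pull.hyps(1-4)] by (intro chain.stop) simp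
  then have "chain (i, x) 0 (j, func (Fa u) x)" by (rule chain.push[OF pull.hyps(1-4)])
  from chain_trans[OF pull.IH this] show ?case by simp
qed

text \<open>
  Only a pseudo-metric: points joined by chains of arbitrarily small cost have distance \<open>0\<close>.
\<close>
definition glue :: "'j \<times> 'u \<Rightarrow> 'j \<times> 'u \<Rightarrow> ennreal" where
  "glue p q = Inf {c. chain p c q}"

lemma glue_le: "chain p c q \<Longrightarrow> glue p q \<le> c"
  unfolding glue_def by (rule Inf_lower) simp

lemma glue_lessD: "glue p q < c \<Longrightarrow> \<exists>e. chain p e q \<and> e < c"
  unfolding glue_def Inf_less_iff by blast

lemma pseudo_emetric_glue: "pseudo_emetric total glue"
  unfolding pseudo_emetric_def
proof (intro conjI ballI)
  fix p assume "p \<in> total"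
  then have "glue p p \<le> 0" by (intro glue_le chain.stop)
  then show "glue p p = 0" by simp
next
  fix p q
  have "chain p c q \<longleftrightarrow> chain q c p" for c using chain_sym by blast
  then show "glue p q = glue q p" by (simp add: glue_def)
next
  fix p q r
  show "glue p r \<le> glue p q + glue q r"
  proof (rule ennreal_le_add_dense)
    fix b c assume "glue p q < b" "glue q r < c"
    then obtain b' c' where b: "chain p b' q" "b' < b" and c: "chain q c' r" "c' < c"
      using glue_lessD by blast
    have "glue p r \<le> b' + c'" by (rule glue_le[OF chain_trans[OF b(1) c(1)]])
    also have "\<dots> \<le> b + c" using b c by (intro add_mono less_imp_le)
    finally show "glue p r \<le> b + c" .
  qed
qed

lemma glue_same: "i \<in> Obj J \<Longrightarrow> x \<in> points (Fo i) \<Longrightarrow> y \<in> points (Fo i) \<Longrightarrow>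
    glue (i, x) (i, y) \<le> edist (Fo i) x y"
  using glue_le[OF chain.move[OF _ _ _ chain.stop, of i x y]] by simp

lemma glue_arrow: "i \<in> Obj J \<Longrightarrow> j \<in> Obj J \<Longrightarrow> u \<in> hom J i j \<Longrightarrow> x \<in> points (Fo i) \<Longrightarrow>
    glue (j, func (Fa u) x) (i, x) = 0"
  using glue_le[OF chain.pull[OF _ _ _ _ chain.stop, of i j u x]] by simp

text \<open>
  Follow the chain as long as its cost stays below \<open>a\<close>. The step that uses up this budget lies
  inside a single space, since the other steps are free, and it can be split there.
\<close>
lemma splits_chain:
  "chain p c q \<Longrightarrow> c < a + b \<Longrightarrow> 0 < a \<Longrightarrow> 0 < b \<Longrightarrow> \<exists>z\<in>total. glue p z < a \<and> glue z q < b"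
proof (induction arbitrary: a b rule: chain.induct)
  case (stop p)
  then show ?case using pseudo_emetric_refl[OF pseudo_emetric_glue, of p] by (intro bexI[of _ p]) auto
next
  case (move i x y c q)
  let ?e = "edist (Fo i) x y"
  have top: "?e + c < top" using move.prems(1) order.strict_trans2 top_greatest by blast
  have iy: "(i, y) \<in> total" and q: "q \<in> total" using chain_total[OF move.hyps(4)] by auto
  have ix: "(i, x) \<in> total" using move.hyps by auto
  show ?case
  proof (cases "?e < a")
    case True
    then have a': "0 < a - ?e" by (simp add: diff_gr0_ennreal)
    have "?e + c < ?e + ((a - ?e) + b)"
      using move.prems(1) True by (simp add: add.assoc[symmetric] add_diff_inverse_ennreal)
    then have "c < (a - ?e) + b"
      by (metis add_left_mono not_le)
    from move.IH[OF this a' move.prems(3)] obtain z where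
      z: "z \<in> total" "glue (i, y) z < a - ?e" "glue z q < b" by blast
    have "glue (i, x) z \<le> glue (i, x) (i, y) + glue (i, y) z"
      by (rule pseudo_emetric_triangle[OF pseudo_emetric_glue ix iy z(1)])
    also have "\<dots> \<le> ?e + glue (i, y) z" using move.hyps glue_same by (intro add_right_mono)
    also have "\<dots> < a"
    proof -
      have "glue (i, y) z + ?e < (a - ?e) + ?e"
        using z(2) top by (intro ennreal_add_strict_right_mono) (auto simp: less_top)
      also have "(a - ?e) + ?e = a" using True by (intro diff_add_cancel_ennreal less_imp_le)
      finally show ?thesis by (simp add: add.commute)
    qed
    finally show ?thesis using z by blast
  next
    case False
    have "?e + c < a + b" by (rule move.prems(1))
    have "c < b"
    proof (rule ccontr)
      assume "\<not> c < b"
      then have "a + b \<le> ?e + c" using False by (intro add_mono) auto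
      with move.prems(1) show False by simp
    qed
    then have b': "0 < b - c" by (simp add: diff_gr0_ennreal)
    have "c + ?e < c + (a + (b - c))"
      using move.prems(1) \<open>c < b\<close> by (simp add: add.left_commute[of c] add_diff_inverse_ennreal add.commute)
    then have "?e < a + (b - c)" by (metis add_left_mono not_le)
    then obtain w where w: "w \<in> points (Fo i)" "edist (Fo i) x w < a" "edist (Fo i) w y < b - c"
      using Fo[OF move.hyps(1)] move.hyps move.prems(2) b' unfolding Obj_CPMet splits_def by blast
    have "glue (i, x) (i, w) \<le> edist (Fo i) x w" using glue_same move.hyps w by blast
    then have 1: "glue (i, x) (i, w) < a" using w(2) by (rule le_less_trans)
    have iw: "(i, w) \<in> total" using w move.hyps by auto
    have "glue (i, w) q \<le> glue (i, w) (i, y) + glue (i, y) q"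
      by (rule pseudo_emetric_triangle[OF pseudo_emetric_glue iw iy q])
    also have "\<dots> \<le> edist (Fo i) w y + c"
      using w move.hyps glue_same glue_le by (intro add_mono) auto
    also have "\<dots> < (b - c) + c"
      using w(3) top by (intro ennreal_add_strict_right_mono) (auto simp: less_top)
    also have "\<dots> = b" using \<open>c < b\<close> by (simp add: diff_add_cancel_ennreal)
    finally show ?thesis using 1 iw by blast
  qed
next
  case (push i j u x c q)
  from push.IH[OF push.prems] obtain z where
    z: "z \<in> total" "glue (j, func (Fa u) x) z < a" "glue z q < b" by blast
  have "glue (i, x) z \<le> glue (i, x) (j, func (Fa u) x) + glue (j, func (Fa u) x) z"
    using push.hyps z Fa_in by (intro pseudo_emetric_triangle[OF pseudo_emetric_glue]) auto
  also have "glue (i, x) (j, func (Fa u) x) = 0"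
    using push.hyps glue_arrow Fa_in pseudo_emetric_sym[OF pseudo_emetric_glue, of "(i, x)"] by simp
  finally show ?case using z by (auto intro: le_less_trans)
next
  case (pull i j u x c q)
  from pull.IH[OF pull.prems] obtain z where
    z: "z \<in> total" "glue (i, x) z < a" "glue z q < b" by blast
  have "glue (j, func (Fa u) x) z \<le> glue (j, func (Fa u) x) (i, x) + glue (i, x) z"
    using pull.hyps z Fa_in by (intro pseudo_emetric_triangle[OF pseudo_emetric_glue]) auto
  also have "glue (j, func (Fa u) x) (i, x) = 0" using pull.hyps glue_arrow by simp
  finally show ?case using z by (auto intro: le_less_trans)
qed

lemma cocone_chain_le:
  assumes Y: "is_cocone J CPMet Fo Fa Y \<gamma>"
  shows "chain p c q \<Longrightarrow> edist Y (func (\<gamma> (fst p)) (snd p)) (func (\<gamma> (fst q)) (snd q)) \<le> c"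
proof (induction rule: chain.induct)
  case (stop p)
  then have "func (\<gamma> (fst p)) (snd p) \<in> points Y"
    using Y hom_CPMet_in unfolding is_cocone_iff by fastforce
  then show ?case using Y emetric_refl unfolding is_cocone_iff Obj_CPMet by fastforce
next
  case (move i x y c q)
  have q: "fst q \<in> Obj J" "snd q \<in> points (Fo (fst q))" using chain_total[OF move.hyps(4)] by auto
  have \<gamma>: "\<And>i. i \<in> Obj J \<Longrightarrow> \<gamma> i \<in> hom CPMet (Fo i) Y" and "is_emetric Y"
    using Y unfolding is_cocone_iff Obj_CPMet by blast+
  then have "edist Y (func (\<gamma> i) x) (func (\<gamma> (fst q)) (snd q)) \<le>
      edist Y (func (\<gamma> i) x) (func (\<gamma> i) y) + edist Y (func (\<gamma> i) y) (func (\<gamma> (fst q)) (snd q))"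
    using move.hyps q hom_CPMet_in[OF \<gamma>] by (intro emetric_triangle) auto
  also have "\<dots> \<le> edist (Fo i) x y + c"
    using move hom_CPMet_le[OF \<gamma>] by (intro add_mono) auto
  finally show ?case by simp
next
  case (push i j u x c q)
  then show ?case using Y unfolding is_cocone_iff by simp
next
  case (pull i j u x c q)
  then show ?case using Y unfolding is_cocone_iff by simp
qed

lemma cocone_glue_le:
  assumes Y: "is_cocone J CPMet Fo Fa Y \<gamma>"
  shows "edist Y (func (\<gamma> i) x) (func (\<gamma> j) y) \<le> glue (i, x) (j, y)"
  unfolding glue_def using cocone_chain_le[OF Y] by (intro Inf_greatest) fastforce

text \<open>
  The colimit is the completion of the disjoint union under \<open>glue\<close>. A cocone is non-expansive
  for \<open>glue\<close>, hence it extends to the completion; the extension is unique because the images of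
  the spaces are dense.
\<close>
lemma colimit_exists:
  assumes U: "universe_type TYPE('u)" and small: "small TYPE('u) (Obj J)"
  obtains X \<iota> where "is_colimit J CPMet Fo Fa X \<iota>"
    "\<And>i j x y. i \<in> Obj J \<Longrightarrow> j \<in> Obj J \<Longrightarrow> x \<in> points (Fo i) \<Longrightarrow> y \<in> points (Fo j) \<Longrightarrow>
       edist X (func (\<iota> i) x) (func (\<iota> j) y) = glue (i, x) (j, y)"
proof -
  have "small TYPE('u) total"
    using Fo by (intro small_Sigma[OF U small]) (simp add: Obj_CPMet)
  then obtain X :: "'u emetric" and \<phi> where X: "is_emetric X" "ecomplete X" "small TYPE('u) (points X)"
    and dense: "dense_in X (\<phi> ` total)"
    and dist: "\<And>p q. p \<in> total \<Longrightarrow> q \<in> total \<Longrightarrow> edist X (\<phi> p) (\<phi> q) = glue p q"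
    using completion[OF U _ pseudo_emetric_glue] by metis
  have "splits (points X) (edist X)"
  proof (rule splits_of_dense[OF X(1) dense])
    fix p q and a b :: rat
    assume pq: "p \<in> total" "q \<in> total" and ab: "0 < a" "0 < b"
      and lt: "edist X (\<phi> p) (\<phi> q) < ennreal (real_of_rat a) + ennreal (real_of_rat b)"
    then have "glue p q < ennreal (real_of_rat a) + ennreal (real_of_rat b)" by (simp only: dist)
    then obtain c where "chain p c q" "c < ennreal (real_of_rat a) + ennreal (real_of_rat b)"
      using glue_lessD by blast
    then obtain z where "z \<in> total" "glue p z < ennreal (real_of_rat a)" "glue z q < ennreal (real_of_rat b)"
      using splits_chain ab by (metis ennreal_less_zero_iff zero_less_of_rat_iff)
    then show "\<exists>z\<in>total. edist X (\<phi> p) (\<phi> z) < ennreal (real_of_rat a) \<and>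
        edist X (\<phi> z) (\<phi> q) < ennreal (real_of_rat b)"
      using pq by (metis dist)
  qed
  with X have XO: "X \<in> Obj CPMet" by (simp add: Obj_CPMet)
  have \<phi>X: "\<phi> (i, x) \<in> points X" if "i \<in> Obj J" "x \<in> points (Fo i)" for i x
    using dense that unfolding dense_in_def by auto
  define \<iota> where "\<iota> i = Morphism (Fo i) X (restrict (\<lambda>x. \<phi> (i, x)) (points (Fo i)))" for i
  have \<iota>: "func (\<iota> i) x = \<phi> (i, x)" if "x \<in> points (Fo i)" for i x
    using that by (simp add: \<iota>_def)
  have cocone: "is_cocone J CPMet Fo Fa X \<iota>"
    unfolding is_cocone_iff
  proof (intro conjI ballI XO)
    fix i assume i: "i \<in> Obj J"
    show "\<iota> i \<in> hom CPMet (Fo i) X"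
      unfolding hom_CPMet \<iota>_def using XO Fo[OF i] \<phi>X[OF i] i dist glue_same by (auto intro!: mapsI)
    fix j u x assume j: "j \<in> Obj J" "u \<in> hom J i j" and x: "x \<in> points (Fo i)"
    have "\<phi> (j, func (Fa u) x) = \<phi> (i, x)"
      using i j x \<phi>X Fa_in dist glue_arrow by (intro emetric_eqI[OF X(1)]) auto
    then show "func (\<iota> j) (func (Fa u) x) = func (\<iota> i) x" using \<iota> x Fa_in i j by simp
  qed
  have "is_colimit J CPMet Fo Fa X \<iota>"
    unfolding is_colimit_iff[OF cocone]
  proof (intro allI impI)
    fix Y \<gamma> assume Y: "is_cocone J CPMet Fo Fa Y \<gamma>"
    then have YO: "is_emetric Y" "ecomplete Y" and \<gamma>: "\<And>i. i \<in> Obj J \<Longrightarrow> \<gamma> i \<in> hom CPMet (Fo i) Y"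
      unfolding is_cocone_iff Obj_CPMet by blast+
    define g where "g p = func (\<gamma> (fst p)) (snd p)" for p
    have g: "g ` total \<subseteq> points Y" using hom_CPMet_in[OF \<gamma>] by (auto simp: g_def)
    have gle: "edist Y (g p) (g q) \<le> edist X (\<phi> p) (\<phi> q)" if "p \<in> total" "q \<in> total" for p q
      using cocone_glue_le[OF Y, of "fst p" "snd p" "fst q" "snd q"] that dist
      by (simp add: g_def)
    obtain h where h: "h \<in> points X \<rightarrow>\<^sub>E points Y"
      "\<And>x y. x \<in> points X \<Longrightarrow> y \<in> points X \<Longrightarrow> edist Y (h x) (h y) \<le> edist X x y"
      "\<And>p. p \<in> total \<Longrightarrow> h (\<phi> p) = g p"
      using nonexpansive_extension[OF X(1) YO dense g gle] by blast
    show "\<exists>!h. h \<in> maps X Y \<and> (\<forall>i\<in>Obj J. \<forall>x\<in>points (Fo i). h (func (\<iota> i) x) = func (\<gamma> i) x)"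
    proof (rule ex1I[of _ h])
      show "h \<in> maps X Y \<and> (\<forall>i\<in>Obj J. \<forall>x\<in>points (Fo i). h (func (\<iota> i) x) = func (\<gamma> i) x)"
        using h by (auto simp: maps_def nonexpansive_def \<iota> g_def)
      then have hm: "h \<in> maps X Y" by blast
      fix k assume k: "k \<in> maps X Y \<and> (\<forall>i\<in>Obj J. \<forall>x\<in>points (Fo i). k (func (\<iota> i) x) = func (\<gamma> i) x)"
      show "k = h"
      proof (rule maps_eqI[OF _ hm])
        show "k \<in> maps X Y" using k by blast
        fix x assume x: "x \<in> points X"
        show "k x = h x"
          by (rule nonexpansive_eq_on_dense[OF X(1) YO(1) dense _ _ _ _ _ x])
            (use k hm h(3) in \<open>auto simp: maps_def \<iota> g_def\<close>)
      qed
    qed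
  qed
  moreover have "edist X (func (\<iota> i) x) (func (\<iota> j) y) = glue (i, x) (j, y)"
    if "i \<in> Obj J" "j \<in> Obj J" "x \<in> points (Fo i)" "y \<in> points (Fo j)" for i j x y
    using that by (simp add: \<iota> dist)
  ultimately show thesis using that by blast
qed

text \<open>
  The universal property compares an arbitrary colimit with the constructed one. A non-expansive
  map in one direction suffices, as no cocone can have distances larger than \<open>glue\<close>.
\<close>
lemma colimit_dist:
  assumes U: "universe_type TYPE('u)" and small: "small TYPE('u) (Obj J)"
    and X: "is_colimit J CPMet Fo Fa X \<iota>"
    and ij: "i \<in> Obj J" "j \<in> Obj J" and xy: "x \<in> points (Fo i)" "y \<in> points (Fo j)"
  shows "edist X (func (\<iota> i) x) (func (\<iota> j) y) = glue (i, x) (j, y)"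
proof (rule antisym)
  have cX: "is_cocone J CPMet Fo Fa X \<iota>" using X unfolding is_colimit_def by blast
  then show "edist X (func (\<iota> i) x) (func (\<iota> j) y) \<le> glue (i, x) (j, y)" by (rule cocone_glue_le)
  have \<iota>: "\<iota> i \<in> hom CPMet (Fo i) X" "\<iota> j \<in> hom CPMet (Fo j) X"
    using cX ij unfolding is_cocone_iff by blast+
  obtain Z \<zeta> where Z: "is_colimit J CPMet Fo Fa Z \<zeta>"
    and dist: "\<And>i j x y. i \<in> Obj J \<Longrightarrow> j \<in> Obj J \<Longrightarrow> x \<in> points (Fo i) \<Longrightarrow> y \<in> points (Fo j) \<Longrightarrow>
       edist Z (func (\<zeta> i) x) (func (\<zeta> j) y) = glue (i, x) (j, y)"
    using colimit_exists[OF U small] by blast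
  then have "is_cocone J CPMet Fo Fa Z \<zeta>" unfolding is_colimit_def by blast
  then obtain h where h: "h \<in> maps X Z" "\<forall>i\<in>Obj J. \<forall>x\<in>points (Fo i). h (func (\<iota> i) x) = func (\<zeta> i) x"
    using X unfolding is_colimit_iff[OF cX] by blast
  have "glue (i, x) (j, y) = edist Z (h (func (\<iota> i) x)) (h (func (\<iota> j) y))"
    using dist ij xy h(2) by simp
  also have "\<dots> \<le> edist X (func (\<iota> i) x) (func (\<iota> j) y)"
    using hom_CPMet_in[OF \<iota>(1) xy(1)] hom_CPMet_in[OF \<iota>(2) xy(2)] by (rule maps_le[OF h(1)])
  finally show "glue (i, x) (j, y) \<le> edist X (func (\<iota> i) x) (func (\<iota> j) y)" .
qed

end

lemma cocomplete_CPMet: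
  assumes "universe_type TYPE('u)"
  shows "cocomplete TYPE('u) (CPMet :: ('u emetric, ('u emetric, 'u) morphism) cat)"
  unfolding cocomplete_def
proof (intro allI impI)
  fix J :: "('u, 'u) cat" and Fo :: "'u \<Rightarrow> 'u emetric" and Fa
  assume a: "category J \<and> small TYPE('u) (Obj J) \<and> small TYPE('u) (Arr J) \<and> is_functor J CPMet Fo Fa"
  then interpret diagram J Fo Fa by (intro diagram.intro) auto
  obtain X \<iota> where "is_colimit J CPMet Fo Fa X \<iota>"
    using a by (elim conjE) (rule colimit_exists[OF assms])
  then show "\<exists>X \<iota>. is_colimit J CPMet Fo Fa X \<iota>" by (intro exI)
qed

section \<open>Directed colimits and presentability\<close>

lemma hom_SET: "f \<in> hom SET A B \<longleftrightarrow> source f = A \<and> target f = B \<and> func f \<in> A \<rightarrow>\<^sub>E B"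
  by (auto simp: hom_def SET_def)

lemma hom_SET_eqI:
  "f \<in> hom SET A B \<Longrightarrow> g \<in> hom SET A B \<Longrightarrow> (\<And>x. x \<in> A \<Longrightarrow> func f x = func g x) \<Longrightarrow> f = g"
  by (auto simp: hom_SET intro!: morphism.expand intro: PiE_ext)

lemma func_Comp_SET:
  "f \<in> hom SET A B \<Longrightarrow> x \<in> A \<Longrightarrow> func (Comp SET g f) x = func g (func f x)"
  unfolding hom_SET by (auto simp: SET_def comp_on_def compose_def)

lemma Comp_hom_SET: "f \<in> hom SET A B \<Longrightarrow> g \<in> hom SET B C \<Longrightarrow> Comp SET g f \<in> hom SET A C"
  unfolding hom_SET by (auto simp: SET_def comp_on_def compose_def)

lemma hom_functor_arr_hom:
  assumes "category C" "u \<in> hom C y z"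
  shows "hom_functor_arr C x u \<in> hom SET (hom C x y) (hom C x z)"
  using assms category.Comp_hom[OF assms(1) _ assms(2)]
  by (auto simp: hom_SET hom_functor_arr_def hom_def[of C y z])

lemma func_hom_functor_arr:
  "u \<in> hom C y z \<Longrightarrow> g \<in> hom C x y \<Longrightarrow> func (hom_functor_arr C x u) g = Comp C u g"
  by (auto simp: hom_functor_arr_def hom_def[of C y z])

text \<open>
  The usual test for a directed colimit of sets: every arrow into the colimit lifts to a stage,
  and two lifts that become equal in the colimit become equal at a later stage.
\<close>
lemma hom_sets_colimitI:
  assumes C: "category C" and F: "is_functor J C Fo Fa" and X: "is_cocone J C Fo Fa X \<iota>"
    and directed: "\<And>i j. i \<in> Obj J \<Longrightarrow> j \<in> Obj J \<Longrightarrow>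
      \<exists>k\<in>Obj J. hom J i k \<noteq> {} \<and> hom J j k \<noteq> {}"
    and lift: "\<And>f. f \<in> hom C x X \<Longrightarrow> \<exists>i\<in>Obj J. \<exists>g\<in>hom C x (Fo i). f = Comp C (\<iota> i) g"
    and merge: "\<And>i f g. i \<in> Obj J \<Longrightarrow> f \<in> hom C x (Fo i) \<Longrightarrow> g \<in> hom C x (Fo i) \<Longrightarrow>
      Comp C (\<iota> i) f = Comp C (\<iota> i) g \<Longrightarrow>
      \<exists>j\<in>Obj J. \<exists>u\<in>hom J i j. Comp C (Fa u) f = Comp C (Fa u) g"
  shows "is_colimit J SET (\<lambda>i. hom C x (Fo i)) (\<lambda>u. hom_functor_arr C x (Fa u))
    (hom C x X) (\<lambda>i. hom_functor_arr C x (\<iota> i))"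
proof -
  have Fa: "Fa u \<in> hom C (Fo i) (Fo j)" if "i \<in> Obj J" "j \<in> Obj J" "u \<in> hom J i j" for i j u
    using F that unfolding is_functor_def by blast
  have \<iota>: "\<iota> i \<in> hom C (Fo i) X" if "i \<in> Obj J" for i
    using X that unfolding is_cocone_def by blast
  have \<iota>Fa: "Comp C (\<iota> j) (Fa u) = \<iota> i" if "i \<in> Obj J" "j \<in> Obj J" "u \<in> hom J i j" for i j u
    using X that unfolding is_cocone_def by blast
  note assoc = category.Comp_assoc[OF C] and comp = category.Comp_hom[OF C]
  have cocone: "is_cocone J SET (\<lambda>i. hom C x (Fo i)) (\<lambda>u. hom_functor_arr C x (Fa u))
    (hom C x X) (\<lambda>i. hom_functor_arr C x (\<iota> i))"
    unfolding is_cocone_def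
  proof (intro conjI ballI)
    show "hom C x X \<in> Obj SET" by (simp add: SET_def)
    fix i assume i: "i \<in> Obj J"
    show i': "hom_functor_arr C x (\<iota> i) \<in> hom SET (hom C x (Fo i)) (hom C x X)"
      by (rule hom_functor_arr_hom[OF C \<iota>[OF i]])
    fix j u assume j: "j \<in> Obj J" and u: "u \<in> hom J i j"
    note u' = hom_functor_arr_hom[OF C Fa[OF i j u], of x]
    show "Comp SET (hom_functor_arr C x (\<iota> j)) (hom_functor_arr C x (Fa u)) = hom_functor_arr C x (\<iota> i)"
    proof (rule hom_SET_eqI[OF Comp_hom_SET[OF u' hom_functor_arr_hom[OF C \<iota>[OF j]]] i'])
      fix g assume g: "g \<in> hom C x (Fo i)"
      then show "func (Comp SET (hom_functor_arr C x (\<iota> j)) (hom_functor_arr C x (Fa u))) g =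
          func (hom_functor_arr C x (\<iota> i)) g"
        using assoc[OF g Fa[OF i j u] \<iota>[OF j]] comp[OF g Fa[OF i j u]]
        by (simp add: func_Comp_SET[OF u'] func_hom_functor_arr[OF \<iota>[OF i]] func_hom_functor_arr[OF \<iota>[OF j]]
            func_hom_functor_arr[OF Fa[OF i j u]] \<iota>Fa[OF i j u])
    qed
  qed
  show ?thesis
    unfolding is_colimit_def
  proof (intro conjI cocone allI impI)
    fix Y \<gamma>
    assume Y: "is_cocone J SET (\<lambda>i. hom C x (Fo i)) (\<lambda>u. hom_functor_arr C x (Fa u)) Y \<gamma>"
    have \<gamma>: "\<gamma> i \<in> hom SET (hom C x (Fo i)) Y" if "i \<in> Obj J" for i
      using Y that unfolding is_cocone_def by blast
    have \<gamma>_comp: "func (\<gamma> j) (Comp C (Fa u) g) = func (\<gamma> i) g"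
      if i: "i \<in> Obj J" and j: "j \<in> Obj J" and u: "u \<in> hom J i j" and g: "g \<in> hom C x (Fo i)" for i j u g
    proof -
      have "func (Comp SET (\<gamma> j) (hom_functor_arr C x (Fa u))) g = func (\<gamma> i) g"
        using Y i j u unfolding is_cocone_def by simp
      then show ?thesis
        by (simp add: func_Comp_SET[OF hom_functor_arr_hom[OF C Fa[OF i j u]] g]
            func_hom_functor_arr[OF Fa[OF i j u] g])
    qed
    have well_defined: "func (\<gamma> i) f = func (\<gamma> j) g"
      if i: "i \<in> Obj J" and j: "j \<in> Obj J" and f: "f \<in> hom C x (Fo i)" and g: "g \<in> hom C x (Fo j)"
        and eq: "Comp C (\<iota> i) f = Comp C (\<iota> j) g" for i j f g
    proof -
      obtain k u v where k: "k \<in> Obj J" and u: "u \<in> hom J i k" and v: "v \<in> hom J j k"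
        using directed[OF i j] by blast
      note f' = comp[OF f Fa[OF i k u]] and g' = comp[OF g Fa[OF j k v]]
      have "Comp C (\<iota> k) (Comp C (Fa u) f) = Comp C (\<iota> k) (Comp C (Fa v) g)"
        using eq assoc[OF f Fa[OF i k u] \<iota>[OF k]] assoc[OF g Fa[OF j k v] \<iota>[OF k]]
          \<iota>Fa[OF i k u] \<iota>Fa[OF j k v] by simp
      from merge[OF k f' g' this] obtain l w where l: "l \<in> Obj J" and w: "w \<in> hom J k l"
        and eq': "Comp C (Fa w) (Comp C (Fa u) f) = Comp C (Fa w) (Comp C (Fa v) g)" by blast
      show ?thesis
        using \<gamma>_comp[OF k l w f'] \<gamma>_comp[OF k l w g'] \<gamma>_comp[OF i k u f] \<gamma>_comp[OF j k v g] eq' by simp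
    qed
    obtain I G where IG: "\<And>f. f \<in> hom C x X \<Longrightarrow> I f \<in> Obj J"
      "\<And>f. f \<in> hom C x X \<Longrightarrow> G f \<in> hom C x (Fo (I f))"
      "\<And>f. f \<in> hom C x X \<Longrightarrow> f = Comp C (\<iota> (I f)) (G f)"
      using lift by metis
    define h where "h = Morphism (hom C x X) Y (restrict (\<lambda>f. func (\<gamma> (I f)) (G f)) (hom C x X))"
    have h: "h \<in> hom SET (hom C x X) Y"
      using IG(1,2) \<gamma> by (fastforce simp: hom_SET h_def)
    have h_\<iota>: "func h (Comp C (\<iota> i) g) = func (\<gamma> i) g" if i: "i \<in> Obj J" and g: "g \<in> hom C x (Fo i)" for i g
    proof -
      note f = comp[OF g \<iota>[OF i]]
      show ?thesis
        using well_defined[OF IG(1)[OF f] i IG(2)[OF f] g IG(3)[OF f, symmetric]] f by (simp add: h_def)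
    qed
    have Comp_iff: "Comp SET k (hom_functor_arr C x (\<iota> i)) = \<gamma> i \<longleftrightarrow>
        (\<forall>g\<in>hom C x (Fo i). func k (Comp C (\<iota> i) g) = func (\<gamma> i) g)"
      if i: "i \<in> Obj J" and k: "k \<in> hom SET (hom C x X) Y" for i k
    proof -
      note i' = hom_functor_arr_hom[OF C \<iota>[OF i], of x]
      have "func (Comp SET k (hom_functor_arr C x (\<iota> i))) g = func k (Comp C (\<iota> i) g)"
        if g: "g \<in> hom C x (Fo i)" for g
        by (simp add: func_Comp_SET[OF i' g] func_hom_functor_arr[OF \<iota>[OF i] g])
      then show ?thesis
        using hom_SET_eqI[OF Comp_hom_SET[OF i' k] \<gamma>[OF i]] by auto
    qed
    show "\<exists>!h. h \<in> hom SET (hom C x X) Y \<and>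
        (\<forall>i\<in>Obj J. Comp SET h (hom_functor_arr C x (\<iota> i)) = \<gamma> i)"
    proof (rule ex1I[of _ h])
      show "h \<in> hom SET (hom C x X) Y \<and> (\<forall>i\<in>Obj J. Comp SET h (hom_functor_arr C x (\<iota> i)) = \<gamma> i)"
        using h h_\<iota> Comp_iff[OF _ h] by simp
      fix k assume k: "k \<in> hom SET (hom C x X) Y \<and>
        (\<forall>i\<in>Obj J. Comp SET k (hom_functor_arr C x (\<iota> i)) = \<gamma> i)"
      then have kh: "k \<in> hom SET (hom C x X) Y" by blast
      show "k = h"
      proof (rule hom_SET_eqI[OF kh h])
        fix f assume f: "f \<in> hom C x X"
        have "func k (Comp C (\<iota> (I f)) (G f)) = func (\<gamma> (I f)) (G f)"
          using k Comp_iff[OF IG(1)[OF f] kh] IG(1,2)[OF f] by blast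
        then show "func k f = func h f" using IG(3)[OF f] f by (simp add: h_def)
      qed
    qed
  qed
qed

lemma Obj_poset_cat [simp]: "Obj (poset_cat I r) = I"
  and hom_poset_cat: "u \<in> hom (poset_cat I r) i j \<longleftrightarrow> u = (i, j) \<and> (i, j) \<in> r"
  by (auto simp: poset_cat_def hom_def)

locale directed_diagram = diagram "poset_cat I r" Fo Fa
  for I :: "'i set" and r and Fo :: "'i \<Rightarrow> 'u emetric" and Fa +
  assumes directed: "directed_poset aleph_one I r"
begin

lemma r_in: "(i, j) \<in> r \<Longrightarrow> i \<in> I \<and> j \<in> I"
  and r_trans: "(i, j) \<in> r \<Longrightarrow> (j, k) \<in> r \<Longrightarrow> (i, k) \<in> r"
  and r_refl: "i \<in> I \<Longrightarrow> (i, i) \<in> r"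
  using directed unfolding directed_poset_def partial_order_on_def preorder_on_def refl_on_def trans_def
  by blast+

lemma upper_bound: "countable S \<Longrightarrow> S \<subseteq> I \<Longrightarrow> \<exists>b\<in>I. \<forall>s\<in>S. (s, b) \<in> r"
  using directed unfolding directed_poset_def less_aleph_one_iff by blast

definition transport :: "'i \<Rightarrow> 'i \<times> 'u \<Rightarrow> 'u" where
  "transport k p = func (Fa (fst p, k)) (snd p)"

lemma Fa_hom: "(i, j) \<in> r \<Longrightarrow> Fa (i, j) \<in> hom CPMet (Fo i) (Fo j)"
  using Fa[of i j "(i, j)"] r_in by (simp add: hom_poset_cat)

lemma transport_in: "(i, k) \<in> r \<Longrightarrow> x \<in> points (Fo i) \<Longrightarrow> transport k (i, x) \<in> points (Fo k)"
  unfolding transport_def using hom_CPMet_in[OF Fa_hom] by simp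

lemma transport_le: "(i, k) \<in> r \<Longrightarrow> x \<in> points (Fo i) \<Longrightarrow> y \<in> points (Fo i) \<Longrightarrow>
    edist (Fo k) (transport k (i, x)) (transport k (i, y)) \<le> edist (Fo i) x y"
  unfolding transport_def using hom_CPMet_le[OF Fa_hom] by simp

lemma transport_self: "i \<in> I \<Longrightarrow> x \<in> points (Fo i) \<Longrightarrow> transport i (i, x) = x"
  using F unfolding is_functor_def transport_def by (simp add: poset_cat_def Id_CPMet)

lemma transport_transport:
  assumes ij: "(i, j) \<in> r" and jk: "(j, k) \<in> r" and x: "x \<in> points (Fo i)"
  shows "transport k (j, transport j (i, x)) = transport k (i, x)"
proof -
  have "Fa (Comp (poset_cat I r) (j, k) (i, j)) = Comp CPMet (Fa (j, k)) (Fa (i, j))"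
  proof -
    have "(i, j) \<in> hom (poset_cat I r) i j" "(j, k) \<in> hom (poset_cat I r) j k"
      using ij jk by (simp_all add: hom_poset_cat)
    moreover have "i \<in> I" "j \<in> I" "k \<in> I" using r_in ij jk by blast+
    ultimately show ?thesis using F unfolding is_functor_def Obj_poset_cat by blast
  qed
  then have "Fa (i, k) = Comp CPMet (Fa (j, k)) (Fa (i, j))" by (simp add: poset_cat_def)
  then show ?thesis using func_Comp_CPMet[OF Fa_hom[OF ij] x] by (simp add: transport_def)
qed

lemma transport_dist_mono:
  assumes "(fst p, k) \<in> r" "(fst q, k) \<in> r" "(k, l) \<in> r" "p \<in> total" "q \<in> total"
  shows "edist (Fo l) (transport l p) (transport l q) \<le> edist (Fo k) (transport k p) (transport k q)"
  using assms transport_le[of k l "transport k p" "transport k q"]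
    transport_in[of "fst p" k "snd p"] transport_in[of "fst q" k "snd q"]
    transport_transport[of "fst p" k l "snd p"] transport_transport[of "fst q" k l "snd q"]
  by auto

text \<open>
  Along a chain every map of the diagram can be continued to a later stage, where the free moves
  become equalities and only the moves inside spaces contribute.
\<close>
lemma chain_realized:
  "chain p c q \<Longrightarrow> \<exists>k\<in>I. (fst p, k) \<in> r \<and> (fst q, k) \<in> r \<and>
     edist (Fo k) (transport k p) (transport k q) \<le> c"
proof (induction rule: chain.induct)
  case (stop p)
  then show ?case
    using r_refl transport_self emetric_refl[OF Fo_emetric] by (intro bexI[of _ "fst p"]) auto
next
  case (move i x y c q)
  then obtain k where k: "k \<in> I" "(i, k) \<in> r" "(fst q, k) \<in> r"
    "edist (Fo k) (transport k (i, y)) (transport k q) \<le> c" by auto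
  have q: "fst q \<in> I" "snd q \<in> points (Fo (fst q))" using chain_total[OF move.hyps(4)] by auto
  have "edist (Fo k) (transport k (i, x)) (transport k q) \<le>
      edist (Fo k) (transport k (i, x)) (transport k (i, y)) + edist (Fo k) (transport k (i, y)) (transport k q)"
    using k move.hyps q transport_in[of "fst q" k "snd q"]
    by (intro emetric_triangle[OF Fo_emetric]) (auto intro: transport_in)
  also have "\<dots> \<le> edist (Fo i) x y + c" using k move.hyps transport_le by (intro add_mono) auto
  finally show ?case using k by auto
next
  case (push i j u x c q)
  then have u: "u = (i, j)" "(i, j) \<in> r" by (auto simp: hom_poset_cat)
  obtain k where k: "k \<in> I" "(j, k) \<in> r" "(fst q, k) \<in> r"
    "edist (Fo k) (transport k (j, func (Fa u) x)) (transport k q) \<le> c" using push.IH by auto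
  have "transport k (j, func (Fa u) x) = transport k (i, x)"
    using transport_transport[OF u(2) k(2) push.hyps(4)] by (simp add: transport_def u)
  then show ?case using k u r_trans[OF u(2) k(2)] by auto
next
  case (pull i j u x c q)
  then have u: "u = (i, j)" "(i, j) \<in> r" by (auto simp: hom_poset_cat)
  obtain k where k: "k \<in> I" "(i, k) \<in> r" "(fst q, k) \<in> r"
    "edist (Fo k) (transport k (i, x)) (transport k q) \<le> c" using pull.IH by auto
  obtain l where l: "l \<in> I" "(j, l) \<in> r" "(k, l) \<in> r"
    using upper_bound[of "{j, k}"] r_in u k by auto
  have "transport l (j, func (Fa u) x) = transport l (i, x)"
    using transport_transport[OF u(2) l(2) pull.hyps(4)] by (simp add: transport_def u)
  moreover have "edist (Fo l) (transport l (i, x)) (transport l q) \<le> c"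
    using transport_dist_mono[of "(i, x)" k q l] k l chain_total[OF pull.hyps(5)] order_trans by auto
  ultimately show ?case using l r_trans[OF k(3) l(3)] by auto
qed

text \<open>
  For each \<open>n\<close> some stage comes within \<open>1 / (n + 1)\<close> of the infimum. As the poset is
  \<open>\<aleph>\<^sub>1\<close>-directed there is a stage after all of these, and transported distances only decrease.
\<close>
lemma glue_realized:
  assumes p: "p \<in> total" and q: "q \<in> total"
  shows "\<exists>k\<in>I. (fst p, k) \<in> r \<and> (fst q, k) \<in> r \<and>
     edist (Fo k) (transport k p) (transport k q) \<le> glue p q"
proof (cases "glue p q < top")
  case True
  have "\<exists>k\<in>I. (fst p, k) \<in> r \<and> (fst q, k) \<in> r \<and>
      edist (Fo k) (transport k p) (transport k q) \<le> glue p q + ennreal (1 / Suc n)" for n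
  proof -
    have "glue p q < glue p q + ennreal (1 / Suc n)"
      using ennreal_add_strict_right_mono[of 0 "ennreal (1 / Suc n)" "glue p q"] True
      by (simp add: ennreal_less_zero_iff add.commute less_top)
    then obtain c where c: "chain p c q" "c < glue p q + ennreal (1 / Suc n)" using glue_lessD by blast
    then show ?thesis using chain_realized[OF c(1)] less_imp_le order_trans by blast
  qed
  then obtain k where k: "\<And>n. k n \<in> I" "\<And>n. (fst p, k n) \<in> r" "\<And>n. (fst q, k n) \<in> r"
    "\<And>n. edist (Fo (k n)) (transport (k n) p) (transport (k n) q) \<le> glue p q + ennreal (1 / Suc n)"
    by metis
  obtain b where b: "b \<in> I" "\<And>n. (k n, b) \<in> r" using upper_bound[of "range k"] k(1) by blast
  have "edist (Fo b) (transport b p) (transport b q) \<le> glue p q"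
  proof (rule ennreal_le_epsilon)
    fix e :: real assume "0 < e"
    then obtain n where n: "1 / Suc n < e" by (rule nat_approx_posE)
    have "edist (Fo b) (transport b p) (transport b q) \<le> glue p q + ennreal (1 / Suc n)"
      using transport_dist_mono[OF k(2,3) b(2) p q] k(4) by (rule order_trans)
    also have "\<dots> \<le> glue p q + ennreal e" using n by (intro add_left_mono ennreal_leI) simp
    finally show "edist (Fo b) (transport b p) (transport b q) \<le> glue p q + ennreal e" .
  qed
  then show ?thesis using b r_trans[OF k(2) b(2)] r_trans[OF k(3) b(2)] by blast
next
  case False
  then have "glue p q = top" using top.not_eq_extremum by blast
  then show ?thesis using upper_bound[of "{fst p, fst q}"] p q by auto
qed

text \<open>
  The extra lower bound \<open>i\<close> matters when \<open>P\<close> is empty, that is, for maps out of the empty space.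
\<close>
lemma glue_realized_countably:
  assumes P: "countable P" "P \<subseteq> total" and i: "i \<in> I"
  obtains k where "(i, k) \<in> r" "\<And>p. p \<in> P \<Longrightarrow> (fst p, k) \<in> r"
    "\<And>p q. p \<in> P \<Longrightarrow> q \<in> P \<Longrightarrow> edist (Fo k) (transport k p) (transport k q) \<le> glue p q"
proof -
  obtain K where K: "\<And>p q. p \<in> P \<Longrightarrow> q \<in> P \<Longrightarrow> K p q \<in> I \<and> (fst p, K p q) \<in> r \<and> (fst q, K p q) \<in> r \<and>
     edist (Fo (K p q)) (transport (K p q) p) (transport (K p q) q) \<le> glue p q"
    using glue_realized P(2) by (metis subsetD)
  let ?S = "insert i ((\<lambda>(p, q). K p q) ` (P \<times> P))"
  have "countable ?S" using P(1) by simp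
  moreover have "?S \<subseteq> I" using K i by auto
  ultimately obtain k where k: "\<And>s. s \<in> ?S \<Longrightarrow> (s, k) \<in> r" using upper_bound[of ?S] by blast
  have Kk: "(K p q, k) \<in> r" if "p \<in> P" "q \<in> P" for p q using k that by auto
  show thesis
  proof (rule that)
    show "(i, k) \<in> r" using k by simp
    show "(fst p, k) \<in> r" if "p \<in> P" for p using r_trans K[OF that that] Kk[OF that that] by blast
    show "edist (Fo k) (transport k p) (transport k q) \<le> glue p q" if pq: "p \<in> P" "q \<in> P" for p q
      using transport_dist_mono[of p "K p q" q k] K[OF pq] Kk[OF pq] pq P(2) order_trans by blast
  qed
qed

context
  fixes X \<iota>
  assumes U: "universe_type TYPE('u)" and small: "small TYPE('u) I"
    and X: "is_colimit (poset_cat I r) CPMet Fo Fa X \<iota>"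
begin

lemma cocone: "is_cocone (poset_cat I r) CPMet Fo Fa X \<iota>"
  using X unfolding is_colimit_def by blast

lemma X_Obj: "X \<in> Obj CPMet"
  using cocone unfolding is_cocone_def by blast

lemma X_emetric: "is_emetric X"
  using X_Obj by (simp add: Obj_CPMet)

lemma \<iota>: "i \<in> I \<Longrightarrow> \<iota> i \<in> hom CPMet (Fo i) X"
  using cocone unfolding is_cocone_def by simp

lemma \<iota>_transport: "(i, k) \<in> r \<Longrightarrow> x \<in> points (Fo i) \<Longrightarrow> func (\<iota> k) (transport k (i, x)) = func (\<iota> i) x"
  using cocone r_in unfolding is_cocone_iff by (simp add: hom_poset_cat transport_def)

lemma \<iota>_dist: "p \<in> total \<Longrightarrow> q \<in> total \<Longrightarrow>
    edist X (func (\<iota> (fst p)) (snd p)) (func (\<iota> (fst q)) (snd q)) = glue p q"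
  using colimit_dist[OF U _ X, of "fst p" "fst q" "snd p" "snd q"] small by auto

text \<open>
  Splitting and completeness are checked at one stage: two points, or all members of a Cauchy
  sequence, have representatives there with the distances of the colimit.
\<close>
lemma image_Obj:
  defines "V \<equiv> (\<Union>i\<in>I. func (\<iota> i) ` points (Fo i))"
  shows "X\<lparr>points := V\<rparr> \<in> Obj CPMet"
proof -
  have VX: "V \<subseteq> points X" using hom_CPMet_in[OF \<iota>] by (auto simp: V_def)
  have V: "\<exists>p\<in>total. v = func (\<iota> (fst p)) (snd p)" if "v \<in> V" for v
    using that by (auto simp: V_def)
  have in_V: "func (\<iota> k) z \<in> V" if "k \<in> I" "z \<in> points (Fo k)" for k z
    using that by (auto simp: V_def)
  let ?V = "X\<lparr>points := V\<rparr>"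
  have em: "is_emetric ?V" using X_emetric VX unfolding is_emetric_def by (simp add: subset_iff)
  have "small TYPE('u) V" using X_Obj by (intro small_subset[OF VX]) (simp add: Obj_CPMet)
  moreover have "splits V (edist X)"
    unfolding splits_def
  proof (intro ballI allI impI)
    fix v w a b assume v: "v \<in> V" and w: "w \<in> V" and ab: "0 < (a :: ennreal)" "0 < (b :: ennreal)"
      and lt: "edist X v w < a + b"
    obtain p q where p: "p \<in> total" "v = func (\<iota> (fst p)) (snd p)"
      and q: "q \<in> total" "w = func (\<iota> (fst q)) (snd q)" using V v w by meson
    obtain k where k: "k \<in> I" "(fst p, k) \<in> r" "(fst q, k) \<in> r"
      "edist (Fo k) (transport k p) (transport k q) \<le> glue p q" using glue_realized[OF p(1) q(1)] by blast
    have pq: "transport k p \<in> points (Fo k)" "transport k q \<in> points (Fo k)"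
      using transport_in[of "fst p" k "snd p"] transport_in[of "fst q" k "snd q"] p q k by auto
    have "edist (Fo k) (transport k p) (transport k q) < a + b"
      using k(4) lt \<iota>_dist[OF p(1) q(1)] p(2) q(2) by simp
    moreover have "splits (points (Fo k)) (edist (Fo k))" using Fo[of k] k(1) by (simp add: Obj_CPMet)
    ultimately obtain z where z: "z \<in> points (Fo k)" "edist (Fo k) (transport k p) z < a"
      "edist (Fo k) z (transport k q) < b"
      using splitsD[OF _ pq] ab by blast
    have vw: "v = func (\<iota> k) (transport k p)" "w = func (\<iota> k) (transport k q)"
      using \<iota>_transport[of "fst p" k "snd p"] \<iota>_transport[of "fst q" k "snd q"] p q k by auto
    have "edist X v (func (\<iota> k) z) < a" "edist X (func (\<iota> k) z) w < b"
      unfolding vw using hom_CPMet_le[OF \<iota>[OF k(1)]] pq z le_less_trans by blast+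
    then show "\<exists>z\<in>V. edist X v z < a \<and> edist X z w < b" using in_V k(1) z(1) by blast
  qed
  moreover have "ecomplete ?V"
    unfolding ecomplete_iff
  proof (intro allI impI)
    fix s assume s: "cauchy_in (points ?V) (edist ?V) s"
    then have "s n \<in> V" for n by (auto simp: cauchy_in_def)
    then have "\<forall>n. \<exists>p. p \<in> total \<and> s n = func (\<iota> (fst p)) (snd p)" using V by blast
    from choice[OF this] obtain p
      where p: "\<And>n. p n \<in> total" "\<And>n. s n = func (\<iota> (fst (p n))) (snd (p n))" by blast
    have "fst (p 0) \<in> I" using p(1)[of 0] by auto
    moreover have "countable (range p)" "range p \<subseteq> total" using p(1) by (simp_all add: image_subset_iff)
    ultimately obtain k where k: "(fst (p 0), k) \<in> r" "\<And>n. (fst (p n), k) \<in> r"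
      "\<And>m n. edist (Fo k) (transport k (p m)) (transport k (p n)) \<le> glue (p m) (p n)"
      using glue_realized_countably[of "range p" "fst (p 0)"] by (metis (no_types, lifting) rangeI)
    have kI: "k \<in> I" using r_in k(1) by blast
    have pk: "transport k (p n) \<in> points (Fo k)" for n
      using transport_in[of "fst (p n)" k "snd (p n)"] p(1)[of n] k(2) by auto
    have "cauchy_in (points (Fo k)) (edist (Fo k)) (\<lambda>n. transport k (p n))"
      unfolding cauchy_in_def
    proof (intro conjI allI impI)
      fix \<epsilon> :: ennreal assume "0 < \<epsilon>"
      from cauchy_inD[OF s this] have "\<exists>N. \<forall>m\<ge>N. \<forall>n\<ge>N. edist X (s m) (s n) < \<epsilon>" by simp
      then obtain N where N: "\<forall>m\<ge>N. \<forall>n\<ge>N. edist X (s m) (s n) < \<epsilon>" by (rule exE)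
      have "edist (Fo k) (transport k (p m)) (transport k (p n)) \<le> edist X (s m) (s n)" for m n
        using k(3) \<iota>_dist[OF p(1) p(1)] by (simp add: p(2))
      then show "\<exists>N. \<forall>m\<ge>N. \<forall>n\<ge>N. edist (Fo k) (transport k (p m)) (transport k (p n)) < \<epsilon>"
        using N le_less_trans by blast
    qed (use pk in blast)
    then obtain z where z: "z \<in> points (Fo k)" "limit_of (edist (Fo k)) (\<lambda>n. transport k (p n)) z"
      using Fo[of k] kI unfolding Obj_CPMet ecomplete_iff by auto
    have s_eq: "s n = func (\<iota> k) (transport k (p n))" for n
      using \<iota>_transport[of "fst (p n)" k "snd (p n)"] p[of n] k(2) by auto
    have "edist X (s n) (func (\<iota> k) z) \<le> edist (Fo k) (transport k (p n)) z" for n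
      unfolding s_eq by (rule hom_CPMet_le[OF \<iota>[OF kI] pk z(1)])
    then have "limit_of (edist X) s (func (\<iota> k) z)"
      using z(2) unfolding limit_of_def by (meson le_less_trans)
    then show "\<exists>x\<in>points ?V. limit_of (edist ?V) s x" using in_V[OF kI z(1)] by auto
  qed
  ultimately show ?thesis using em by (simp add: Obj_CPMet)
qed

text \<open>
  The points that come from a stage form a subspace \<open>V\<close> that is an object of the category. The
  cocone factors through it, and the induced map from \<open>X\<close> to \<open>V\<close>, regarded as a map to \<open>X\<close>, is
  compatible with the cocone. So it is the identity, and \<open>V\<close> is all of \<open>X\<close>.
\<close>
lemma jointly_surjective:
  assumes x: "x \<in> points X"
  shows "\<exists>i\<in>I. \<exists>y\<in>points (Fo i). x = func (\<iota> i) y"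
proof -
  define V where "V = X\<lparr>points := \<Union>i\<in>I. func (\<iota> i) ` points (Fo i)\<rparr>"
  have V: "V \<in> Obj CPMet" unfolding V_def by (rule image_Obj)
  define \<gamma> where "\<gamma> i = Morphism (Fo i) V (func (\<iota> i))" for i
  have "points V \<subseteq> points X" using hom_CPMet_in[OF \<iota>] by (auto simp: V_def)
  moreover have "edist V = edist X" by (simp add: V_def)
  ultimately have mapsV: "h \<in> maps Y V \<Longrightarrow> h \<in> maps Y X" for h Y
    unfolding maps_def nonexpansive_def by (auto simp: PiE_iff)
  have "func (\<iota> i) \<in> maps (Fo i) V" if "i \<in> I" for i
    using \<iota>[OF that] that unfolding hom_CPMet maps_def nonexpansive_def V_def by (auto simp: PiE_iff)
  then have "is_cocone (poset_cat I r) CPMet Fo Fa V \<gamma>"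
    using cocone V Fo unfolding is_cocone_iff by (simp add: \<gamma>_def hom_CPMet)
  then obtain h where h: "h \<in> maps X V" "\<forall>i\<in>I. \<forall>x\<in>points (Fo i). h (func (\<iota> i) x) = func (\<iota> i) x"
    using X unfolding is_colimit_iff[OF cocone] by (metis Obj_poset_cat \<gamma>_def morphism.sel(3))
  have "\<exists>!h. h \<in> maps X X \<and> (\<forall>i\<in>I. \<forall>x\<in>points (Fo i). h (func (\<iota> i) x) = func (\<iota> i) x)"
    using X cocone unfolding is_colimit_iff[OF cocone] by simp
  moreover have "restrict (\<lambda>x. x) (points X) \<in> maps X X \<and>
      (\<forall>i\<in>I. \<forall>x\<in>points (Fo i). restrict (\<lambda>x. x) (points X) (func (\<iota> i) x) = func (\<iota> i) x)"
    using maps_id hom_CPMet_in[OF \<iota>] by auto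
  ultimately have "h = restrict (\<lambda>x. x) (points X)" using h mapsV by blast
  then have "x \<in> points V" using maps_in[OF h(1) x] x by simp
  then show ?thesis by (auto simp: V_def)
qed

text \<open>
  Representatives of the values on a countable dense subset are moved to a stage where they have
  the distances of their images in the colimit; there they define a non-expansive map, which
  extends by completeness of that stage.
\<close>
lemma separable_lift:
  assumes A: "A \<in> Obj CPMet" and S: "countable S" "dense_in A S" and f: "f \<in> hom CPMet A X"
  shows "\<exists>i\<in>I. \<exists>g\<in>hom CPMet A (Fo i). f = Comp CPMet (\<iota> i) g"
proof -
  have SA: "s \<in> points A" if "s \<in> S" for s using S(2) that unfolding dense_in_def by blast
  have "\<exists>p\<in>total. func f s = func (\<iota> (fst p)) (snd p)" if s: "s \<in> S" for s
    using jointly_surjective[OF hom_CPMet_in[OF f SA[OF s]]] by fastforce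
  then obtain p where p: "\<And>s. s \<in> S \<Longrightarrow> p s \<in> total"
    "\<And>s. s \<in> S \<Longrightarrow> func f s = func (\<iota> (fst (p s))) (snd (p s))" by metis
  obtain i where "i \<in> I" using upper_bound[of "{}"] by auto
  have "countable (p ` S)" "p ` S \<subseteq> total" using S(1) p(1) by (simp_all only: countable_image image_subset_iff ball_simps) blast
  from glue_realized_countably[OF this \<open>i \<in> I\<close>] obtain k where k: "(i, k) \<in> r"
    "\<And>s. s \<in> S \<Longrightarrow> (fst (p s), k) \<in> r"
    "\<And>s t. s \<in> S \<Longrightarrow> t \<in> S \<Longrightarrow> edist (Fo k) (transport k (p s)) (transport k (p t)) \<le> glue (p s) (p t)"
    by (metis imageI)
  have kI: "k \<in> I" using r_in k(1) by blast
  have pk: "transport k (p s) \<in> points (Fo k)" if "s \<in> S" for s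
    using transport_in[of "fst (p s)" k "snd (p s)"] p(1)[OF that] k(2)[OF that] by auto
  have le: "edist (Fo k) (transport k (p s)) (transport k (p t)) \<le> edist A s t" if st: "s \<in> S" "t \<in> S" for s t
  proof -
    have "glue (p s) (p t) = edist X (func f s) (func f t)"
      using \<iota>_dist[OF p(1) p(1)] st p(2) by simp
    also have "\<dots> \<le> edist A s t" by (rule hom_CPMet_le[OF f SA[OF st(1)] SA[OF st(2)]])
    finally show ?thesis using k(3)[OF st] by (rule order_trans[rotated])
  qed
  have Am: "is_emetric A" using A by (simp add: Obj_CPMet)
  have Fk: "is_emetric (Fo k)" "ecomplete (Fo k)" using Fo[of k] kI by (auto simp: Obj_CPMet)
  have D: "dense_in A ((\<lambda>s. s) ` S)" using S(2) by simp
  obtain h where h: "h \<in> points A \<rightarrow>\<^sub>E points (Fo k)"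
    "\<And>x y. x \<in> points A \<Longrightarrow> y \<in> points A \<Longrightarrow> edist (Fo k) (h x) (h y) \<le> edist A x y"
    "\<And>s. s \<in> S \<Longrightarrow> h s = transport k (p s)"
    using nonexpansive_extension[OF Am Fk D, of "\<lambda>s. transport k (p s)"] pk le by blast
  define g where "g = Morphism A (Fo k) h"
  have g: "g \<in> hom CPMet A (Fo k)"
    using h A Fo[of k] kI by (auto simp: g_def hom_CPMet maps_def nonexpansive_def)
  note c = Comp_hom_CPMet[OF g \<iota>[OF kI]]
  have "f = Comp CPMet (\<iota> k) g"
  proof (rule hom_CPMet_eqI[OF f c])
    fix x assume x: "x \<in> points A"
    show "func f x = func (Comp CPMet (\<iota> k) g) x"
    proof (rule nonexpansive_eq_on_dense[OF Am X_emetric S(2) _ _ _ _ _ x])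
      fix s assume s: "s \<in> S"
      have "func (Comp CPMet (\<iota> k) g) s = func (\<iota> k) (transport k (p s))"
        using func_Comp_CPMet[OF g SA[OF s], of "\<iota> k"] h(3)[OF s] by (simp add: g_def)
      then show "func f s = func (Comp CPMet (\<iota> k) g) s"
        using \<iota>_transport[of "fst (p s)" k "snd (p s)"] p[OF s] k(2)[OF s] by auto
    qed (use f c in \<open>auto simp: hom_CPMet maps_def\<close>)
  qed
  with kI g show ?thesis by blast
qed

text \<open>
  If the composites agree in the colimit, then for each point \<open>s\<close> of the countable dense subset
  the values \<open>f s\<close> and \<open>g s\<close> have distance \<open>0\<close> in the colimit. At a stage that realizes all
  these distances the values coincide.
\<close>
lemma separable_merge:
  assumes A: "A \<in> Obj CPMet" and S: "countable S" "dense_in A S"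
    and i: "i \<in> I" and f: "f \<in> hom CPMet A (Fo i)" and g: "g \<in> hom CPMet A (Fo i)"
    and eq: "Comp CPMet (\<iota> i) f = Comp CPMet (\<iota> i) g"
  shows "\<exists>j\<in>I. \<exists>u\<in>hom (poset_cat I r) i j. Comp CPMet (Fa u) f = Comp CPMet (Fa u) g"
proof -
  have SA: "s \<in> points A" if "s \<in> S" for s using S(2) that unfolding dense_in_def by blast
  let ?P = "(\<lambda>s. (i, func f s)) ` S \<union> (\<lambda>s. (i, func g s)) ` S"
  have P: "countable ?P" "?P \<subseteq> total" using S(1) SA i hom_CPMet_in[OF f] hom_CPMet_in[OF g] by auto
  obtain k where k: "(i, k) \<in> r"
    "\<And>p q. p \<in> ?P \<Longrightarrow> q \<in> ?P \<Longrightarrow> edist (Fo k) (transport k p) (transport k q) \<le> glue p q"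
    by (rule glue_realized_countably[OF P i]) blast
  have kI: "k \<in> I" using r_in k(1) by blast
  have Am: "is_emetric A" using A by (simp add: Obj_CPMet)
  have Fk: "is_emetric (Fo k)" using Fo[of k] kI by (auto simp: Obj_CPMet)
  note cf = Comp_hom_CPMet[OF f Fa_hom[OF k(1)]] and cg = Comp_hom_CPMet[OF g Fa_hom[OF k(1)]]
  have "Comp CPMet (Fa (i, k)) f = Comp CPMet (Fa (i, k)) g"
  proof (rule hom_CPMet_eqI[OF cf cg])
    fix x assume x: "x \<in> points A"
    show "func (Comp CPMet (Fa (i, k)) f) x = func (Comp CPMet (Fa (i, k)) g) x"
    proof (rule nonexpansive_eq_on_dense[OF Am Fk S(2) _ _ _ _ _ x])
      fix s assume s: "s \<in> S"
      note fs = hom_CPMet_in[OF f SA[OF s]] and gs = hom_CPMet_in[OF g SA[OF s]]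
      have "func (\<iota> i) (func f s) = func (\<iota> i) (func g s)"
        using eq func_Comp_CPMet[OF f SA[OF s]] func_Comp_CPMet[OF g SA[OF s]] by metis
      then have "glue (i, func f s) (i, func g s) = 0"
        using \<iota>_dist[of "(i, func f s)" "(i, func g s)"] i fs gs
          emetric_refl[OF X_emetric hom_CPMet_in[OF \<iota>[OF i]]] by simp
      then have "edist (Fo k) (transport k (i, func f s)) (transport k (i, func g s)) \<le> 0"
        using k(2)[of "(i, func f s)" "(i, func g s)"] s by auto
      then have "transport k (i, func f s) = transport k (i, func g s)"
        using transport_in[OF k(1)] fs gs by (intro emetric_eqI[OF Fk]) auto
      then show "func (Comp CPMet (Fa (i, k)) f) s = func (Comp CPMet (Fa (i, k)) g) s"
        using func_Comp_CPMet[OF f SA[OF s]] func_Comp_CPMet[OF g SA[OF s]] by (simp add: transport_def)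
    qed (use cf cg in \<open>auto simp: hom_CPMet maps_def\<close>)
  qed
  moreover have "(i, k) \<in> hom (poset_cat I r) i k" using k(1) by (simp add: hom_poset_cat)
  ultimately show ?thesis using kI by (intro bexI[of _ k] bexI[of _ "(i, k)"])
qed

end

end

lemma presentable_separable:
  assumes U: "universe_type TYPE('u)"
    and A: "(A :: 'u emetric) \<in> Obj CPMet" and S: "countable S" "dense_in A S"
  shows "presentable TYPE('u) aleph_one CPMet A"
  unfolding presentable_def
proof (intro conjI A allI impI)
  fix I :: "'u set" and r and Fo :: "'u \<Rightarrow> 'u emetric" and Fa X \<iota>
  assume "directed_poset aleph_one I r \<and> small TYPE('u) I \<and> is_functor (poset_cat I r) CPMet Fo Fa \<and>
      is_colimit (poset_cat I r) CPMet Fo Fa X \<iota>"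
  then have D: "directed_poset aleph_one I r" and I: "small TYPE('u) I"
    and F: "is_functor (poset_cat I r) CPMet Fo Fa"
    and X: "is_colimit (poset_cat I r) CPMet Fo Fa X \<iota>" by auto
  interpret directed_diagram I r Fo Fa
    using D F by (intro directed_diagram.intro diagram.intro directed_diagram_axioms.intro)
  show "is_colimit (poset_cat I r) SET (\<lambda>i. hom CPMet A (Fo i)) (\<lambda>u. hom_functor_arr CPMet A (Fa u))
      (hom CPMet A X) (\<lambda>i. hom_functor_arr CPMet A (\<iota> i))"
  proof (rule hom_sets_colimitI[OF category_CPMet F cocone[OF U I X]])
    fix i j assume "i \<in> Obj (poset_cat I r)" "j \<in> Obj (poset_cat I r)"
    then obtain k where "k \<in> I" "(i, k) \<in> r" "(j, k) \<in> r" using upper_bound[of "{i, j}"] by auto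
    then show "\<exists>k\<in>Obj (poset_cat I r). hom (poset_cat I r) i k \<noteq> {} \<and> hom (poset_cat I r) j k \<noteq> {}"
      using hom_poset_cat by (metis Obj_poset_cat empty_iff)
  next
    fix f assume "f \<in> hom CPMet A X"
    then show "\<exists>i\<in>Obj (poset_cat I r). \<exists>g\<in>hom CPMet A (Fo i). f = Comp CPMet (\<iota> i) g"
      using separable_lift[OF U I X A S] by simp
  next
    fix i f g assume "i \<in> Obj (poset_cat I r)" "f \<in> hom CPMet A (Fo i)" "g \<in> hom CPMet A (Fo i)"
      "Comp CPMet (\<iota> i) f = Comp CPMet (\<iota> i) g"
    then show "\<exists>j\<in>Obj (poset_cat I r). \<exists>u\<in>hom (poset_cat I r) i j. Comp CPMet (Fa u) f = Comp CPMet (Fa u) g"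
      using separable_merge[OF U I X A S] by simp
  qed
qed

section \<open>Unions of isometrically embedded spaces\<close>

text \<open>
  Each \<open>m i\<close> identifies \<open>Fo i\<close> isometrically with the subspace \<open>Y i\<close>. Non-expansive maps on the
  subspaces glue to a non-expansive map on \<open>X\<close> because any two points of \<open>X\<close> lie in a common
  subspace.
\<close>
lemma union_colimit:
  fixes X :: "'u emetric" and I :: "'i set"
  assumes X: "X \<in> Obj CPMet" and Fo_Obj: "\<And>i. i \<in> I \<Longrightarrow> Fo i \<in> Obj CPMet"
    and r: "r = {(i, j). i \<in> I \<and> j \<in> I \<and> Y i \<subseteq> Y j}"
    and onto: "\<And>i. i \<in> I \<Longrightarrow> m i ` points (Fo i) = Y i"
    and iso: "\<And>i x y. i \<in> I \<Longrightarrow> x \<in> points (Fo i) \<Longrightarrow> y \<in> points (Fo i) \<Longrightarrow>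
      edist X (m i x) (m i y) = edist (Fo i) x y"
    and Y: "\<And>i. i \<in> I \<Longrightarrow> Y i \<subseteq> points X"
    and cover: "\<And>x y. x \<in> points X \<Longrightarrow> y \<in> points X \<Longrightarrow> \<exists>i\<in>I. x \<in> Y i \<and> y \<in> Y i"
    and dir: "\<And>i j. i \<in> I \<Longrightarrow> j \<in> I \<Longrightarrow> \<exists>k\<in>I. Y i \<subseteq> Y k \<and> Y j \<subseteq> Y k"
  obtains Fa \<iota> where "is_functor (poset_cat I r) CPMet Fo Fa"
    "is_colimit (poset_cat I r) CPMet Fo Fa X \<iota>"
proof -
  define n where "n i = inv_into (points (Fo i)) (m i)" for i
  have Xm: "is_emetric X" using X by (simp add: Obj_CPMet)
  have nm: "n i (m i x) = x" if i: "i \<in> I" and x: "x \<in> points (Fo i)" for i x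
  proof -
    have "inj_on (m i) (points (Fo i))"
    proof (rule inj_onI)
      fix x y assume x: "x \<in> points (Fo i)" and y: "y \<in> points (Fo i)" and eq: "m i x = m i y"
      have "m i y \<in> points X" using onto[OF i] Y[OF i] y by blast
      then have "edist (Fo i) x y \<le> 0" using iso[OF i x y] eq emetric_refl[OF Xm] by simp
      moreover have "is_emetric (Fo i)" using Fo_Obj[OF i] by (simp add: Obj_CPMet)
      ultimately show "x = y" using x y by (intro emetric_eqI)
    qed
    then show ?thesis unfolding n_def using x by simp
  qed
  have mn: "n i y \<in> points (Fo i)" "m i (n i y) = y" if "i \<in> I" "y \<in> Y i" for i y
    using inv_into_into[of y "m i" "points (Fo i)"] f_inv_into_f[of y "m i" "points (Fo i)"] onto that
    unfolding n_def by blast+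
  have m_in: "m i x \<in> Y i" if "i \<in> I" "x \<in> points (Fo i)" for i x using onto that by blast
  have n_iso: "edist (Fo i) (n i x) (n i y) = edist X x y" if "i \<in> I" "x \<in> Y i" "y \<in> Y i" for i x y
    using iso[OF that(1) mn(1) mn(1), of x y] mn(2) that by simp
  have rI: "i \<in> I" "j \<in> I" "Y i \<subseteq> Y j" if "(i, j) \<in> r" for i j using that r by auto
  define Fa where "Fa = (\<lambda>(i, j). Morphism (Fo i) (Fo j) (restrict (\<lambda>x. n j (m i x)) (points (Fo i))))"
  define \<iota> where "\<iota> i = Morphism (Fo i) X (restrict (m i) (points (Fo i)))" for i
  have Fa_val: "func (Fa (i, j)) x = n j (m i x)" if "x \<in> points (Fo i)" for i j x
    using that by (simp add: Fa_def)
  have Fa_hom: "Fa (i, j) \<in> hom CPMet (Fo i) (Fo j)" if ij: "(i, j) \<in> r" for i j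
  proof -
    have Yj: "m i x \<in> Y j" if "x \<in> points (Fo i)" for x using m_in rI[OF ij] that by blast
    have "restrict (\<lambda>x. n j (m i x)) (points (Fo i)) \<in> maps (Fo i) (Fo j)"
      using mn(1)[OF rI(2)[OF ij] Yj] n_iso[OF rI(2)[OF ij] Yj Yj] iso[OF rI(1)[OF ij]]
      by (intro mapsI) auto
    then show ?thesis using Fo_Obj rI[OF ij] by (simp add: Fa_def hom_CPMet)
  qed
  have Fa_functor: "is_functor (poset_cat I r) CPMet Fo Fa"
    unfolding is_functor_def Obj_poset_cat
  proof (intro conjI ballI)
    fix i assume i: "i \<in> I"
    show "Fo i \<in> Obj CPMet" by (rule Fo_Obj[OF i])
    have "(i, i) \<in> r" using r i by simp
    note Fa_ii = Fa_hom[OF this]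
    have "Fa (i, i) = Id CPMet (Fo i)"
      by (rule hom_CPMet_eqI[OF Fa_ii Id_hom_CPMet[OF Fo_Obj[OF i]]])
        (simp add: Fa_val Id_CPMet nm[OF i])
    then show "Fa (Id (poset_cat I r) i) = Id CPMet (Fo i)" by (simp add: poset_cat_def)
    fix j u assume "j \<in> I" and u: "u \<in> hom (poset_cat I r) i j"
    then show "Fa u \<in> hom CPMet (Fo i) (Fo j)" using Fa_hom by (auto simp: hom_poset_cat)
    fix k v assume "k \<in> I" and "v \<in> hom (poset_cat I r) j k"
    then have uv: "u = (i, j)" "(i, j) \<in> r" "v = (j, k)" "(j, k) \<in> r" using u by (auto simp: hom_poset_cat)
    then have ik: "(i, k) \<in> r" using r by auto
    have "Fa (i, k) = Comp CPMet (Fa (j, k)) (Fa (i, j))"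
    proof (rule hom_CPMet_eqI[OF Fa_hom[OF ik] Comp_hom_CPMet[OF Fa_hom[OF uv(2)] Fa_hom[OF uv(4)]]])
      fix x assume x: "x \<in> points (Fo i)"
      have Yj: "m i x \<in> Y j" using m_in rI[OF uv(2)] x by blast
      show "func (Fa (i, k)) x = func (Comp CPMet (Fa (j, k)) (Fa (i, j))) x"
        using x mn[OF rI(2)[OF uv(2)] Yj] by (simp add: func_Comp_CPMet[OF Fa_hom[OF uv(2)] x] Fa_val)
    qed
    then show "Fa (Comp (poset_cat I r) v u) = Comp CPMet (Fa v) (Fa u)"
      using uv by (simp add: poset_cat_def)
  qed
  interpret diagram "poset_cat I r" Fo Fa by (rule diagram.intro[OF Fa_functor])
  have cocone: "is_cocone (poset_cat I r) CPMet Fo Fa X \<iota>"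
    unfolding is_cocone_iff Obj_poset_cat
  proof (intro conjI ballI X)
    fix i assume i: "i \<in> I"
    have "restrict (m i) (points (Fo i)) \<in> maps (Fo i) X"
      using m_in[OF i] Y[OF i] iso[OF i] by (intro mapsI) auto
    then show "\<iota> i \<in> hom CPMet (Fo i) X" using X Fo_Obj[OF i] by (simp add: \<iota>_def hom_CPMet)
    fix j u x assume "j \<in> I" "u \<in> hom (poset_cat I r) i j" and x: "x \<in> points (Fo i)"
    then have u: "u = (i, j)" "(i, j) \<in> r" by (auto simp: hom_poset_cat)
    have Yj: "m i x \<in> Y j" using m_in rI[OF u(2)] x by blast
    show "func (\<iota> j) (func (Fa u) x) = func (\<iota> i) x"
      using x mn[OF rI(2)[OF u(2)] Yj] by (simp add: \<iota>_def u Fa_val)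
  qed
  have "is_colimit (poset_cat I r) CPMet Fo Fa X \<iota>"
    unfolding is_colimit_iff[OF cocone]
  proof (intro allI impI)
    fix Z \<gamma> assume Z: "is_cocone (poset_cat I r) CPMet Fo Fa Z \<gamma>"
    have \<gamma>: "\<gamma> i \<in> hom CPMet (Fo i) Z" if "i \<in> I" for i using Z that unfolding is_cocone_iff by simp
    have up: "func (\<gamma> i) (n i x) = func (\<gamma> k) (n k x)" if "(i, k) \<in> r" and x: "x \<in> Y i" for i k x
    proof -
      have "func (\<gamma> k) (func (Fa (i, k)) (n i x)) = func (\<gamma> i) (n i x)"
        using Z that rI[OF that(1)] mn(1) unfolding is_cocone_iff by (simp add: hom_poset_cat)
      then show ?thesis using Fa_val mn rI(1)[OF that(1)] x by simp
    qed
    have same: "func (\<gamma> i) (n i x) = func (\<gamma> j) (n j x)" if ij: "i \<in> I" "j \<in> I" and x: "x \<in> Y i" "x \<in> Y j" for i j x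
    proof -
      obtain k where "k \<in> I" "Y i \<subseteq> Y k" "Y j \<subseteq> Y k" using dir[OF ij] by blast
      then have "(i, k) \<in> r" "(j, k) \<in> r" using r ij by auto
      then show ?thesis using up[of i k x] up[of j k x] x by simp
    qed
    define k where "k x = (SOME i. i \<in> I \<and> x \<in> Y i)" for x
    have k: "k x \<in> I \<and> x \<in> Y (k x)" if x: "x \<in> points X" for x
    proof -
      have "\<exists>i. i \<in> I \<and> x \<in> Y i" using cover[OF x x] by blast
      then show ?thesis unfolding k_def by (rule someI_ex)
    qed
    define h where "h = restrict (\<lambda>x. func (\<gamma> (k x)) (n (k x) x)) (points X)"
    have h_val: "h x = func (\<gamma> i) (n i x)" if i: "i \<in> I" and x: "x \<in> Y i" for i x
    proof -
      have "x \<in> points X" using Y[OF i] x by blast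
      then show ?thesis using same[OF _ i _ x] k by (simp add: h_def)
    qed
    have h: "h \<in> maps X Z"
      unfolding h_def
    proof (rule mapsI)
      fix x assume x: "x \<in> points X"
      then show "func (\<gamma> (k x)) (n (k x) x) \<in> points Z" using k hom_CPMet_in[OF \<gamma>] mn(1) by blast
      fix y assume y: "y \<in> points X"
      obtain i where i: "i \<in> I" "x \<in> Y i" "y \<in> Y i" using cover[OF x y] by blast
      have "edist Z (h x) (h y) \<le> edist (Fo i) (n i x) (n i y)"
        using h_val i hom_CPMet_le[OF \<gamma>[OF i(1)]] mn(1)[OF i(1)] by simp
      also have "\<dots> = edist X x y" using n_iso i by blast
      finally show "edist Z (func (\<gamma> (k x)) (n (k x) x)) (func (\<gamma> (k y)) (n (k y) y)) \<le> edist X x y"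
        using x y by (simp add: h_def)
    qed
    show "\<exists>!h. h \<in> maps X Z \<and> (\<forall>i\<in>Obj (poset_cat I r). \<forall>x\<in>points (Fo i). h (func (\<iota> i) x) = func (\<gamma> i) x)"
      unfolding Obj_poset_cat
    proof (rule ex1I[of _ h])
      show "h \<in> maps X Z \<and> (\<forall>i\<in>I. \<forall>x\<in>points (Fo i). h (func (\<iota> i) x) = func (\<gamma> i) x)"
        using h h_val[OF _ m_in] nm by (simp add: \<iota>_def)
      fix g assume g: "g \<in> maps X Z \<and> (\<forall>i\<in>I. \<forall>x\<in>points (Fo i). g (func (\<iota> i) x) = func (\<gamma> i) x)"
      show "g = h"
      proof (rule maps_eqI[OF _ h])
        show "g \<in> maps X Z" using g by blast
        fix x assume "x \<in> points X"
        then obtain i where i: "i \<in> I" "x \<in> Y i" using k by blast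
        have "g (func (\<iota> i) (n i x)) = func (\<gamma> i) (n i x)" using g i mn(1) by blast
        then show "g x = h x" using h_val[OF i] mn[OF i] by (simp add: \<iota>_def)
      qed
    qed
  qed
  with Fa_functor that show thesis by blast
qed

section \<open>Separable subspaces\<close>

definition closure_in :: "'a emetric \<Rightarrow> 'a set \<Rightarrow> 'a set" where
  "closure_in X S = {x \<in> points X. \<forall>\<epsilon>>0. \<exists>s\<in>S. edist X x s < \<epsilon>}"

lemma closure_in_mono: "S \<subseteq> T \<Longrightarrow> closure_in X S \<subseteq> closure_in X T"
  unfolding closure_in_def by blast

lemma subset_closure_in:
  assumes X: "is_emetric X" and S: "S \<subseteq> points X"
  shows "S \<subseteq> closure_in X S"
proof
  fix s assume s: "s \<in> S"
  then have "edist X s s < \<epsilon>" if "0 < \<epsilon>" for \<epsilon> using emetric_refl[OF X] S that by auto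
  then show "s \<in> closure_in X S" using s S unfolding closure_in_def by blast
qed

lemma dense_in_closure:
  "is_emetric X \<Longrightarrow> S \<subseteq> points X \<Longrightarrow> dense_in (X\<lparr>points := closure_in X S\<rparr>) S"
  using subset_closure_in[of X S] unfolding dense_in_def by (auto simp: closure_in_def)

lemma closure_in_Obj:
  assumes X: "X \<in> Obj CPMet" and S: "S \<subseteq> points X" and sp: "splits (closure_in X S) (edist X)"
  shows "X\<lparr>points := closure_in X S\<rparr> \<in> Obj CPMet"
proof -
  let ?V = "X\<lparr>points := closure_in X S\<rparr>"
  have Xm: "is_emetric X" "ecomplete X" "small TYPE('a) (points X)" using X by (auto simp: Obj_CPMet)
  have sub: "closure_in X S \<subseteq> points X" by (auto simp: closure_in_def)
  have "ecomplete ?V"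
    unfolding ecomplete_iff
  proof (intro allI impI)
    fix s assume s: "cauchy_in (points ?V) (edist ?V) s"
    then have sV: "s n \<in> closure_in X S" for n by (auto simp: cauchy_in_def)
    have "cauchy_in (points X) (edist X) s" using s sub unfolding cauchy_in_def by auto
    then obtain x where x: "x \<in> points X" "limit_of (edist X) s x"
      using Xm(2) unfolding ecomplete_iff by blast
    have "\<exists>t\<in>S. edist X x t < \<epsilon>" if \<epsilon>: "0 < \<epsilon>" for \<epsilon>
    proof -
      obtain \<delta> where \<delta>: "0 < \<delta>" "\<delta> + \<delta> < \<epsilon>" using ennreal_half_pos[OF \<epsilon>] .
      obtain N where "\<forall>n\<ge>N. edist X (s n) x < \<delta>" using x(2) \<delta>(1) unfolding limit_of_def by blast
      then have N: "edist X (s N) x < \<delta>" by blast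
      obtain t where t: "t \<in> S" "edist X (s N) t < \<delta>" using sV[of N] \<delta>(1) unfolding closure_in_def by blast
      have sN: "s N \<in> points X" and tX: "t \<in> points X" using sV sub S t(1) by blast+
      have "edist X x t \<le> edist X x (s N) + edist X (s N) t" by (rule emetric_triangle[OF Xm(1) x(1) sN tX])
      also have "\<dots> \<le> \<delta> + \<delta>"
        using N t(2) emetric_sym[OF Xm(1) x(1) sN] by (intro add_mono less_imp_le) auto
      finally show ?thesis using \<delta>(2) t(1) le_less_trans by blast
    qed
    then have "x \<in> closure_in X S" using x(1) unfolding closure_in_def by blast
    then show "\<exists>x\<in>points ?V. limit_of (edist ?V) s x" using x(2) by auto
  qed
  then show ?thesis
    using is_emetric_subspace[OF Xm(1) sub] small_subset[OF sub Xm(3)] sp by (simp add: Obj_CPMet)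
qed

text \<open>
  Add chosen splitting points for all pairs and all rational bounds, and repeat this countably
  often. The union is a countable set that is dense in its closure and splits for rational
  bounds.
\<close>
lemma splitting_hull:
  assumes X: "X \<in> Obj CPMet" and S: "countable S" "S \<subseteq> points X"
  obtains T where "countable T" "S \<subseteq> T" "T \<subseteq> points X" "splits (closure_in X T) (edist X)"
proof -
  have Xm: "is_emetric X" "splits (points X) (edist X)" using X by (auto simp: Obj_CPMet)
  let ?R = "\<lambda>a :: rat. ennreal (real_of_rat a)"
  define D where "D T = {(x, y, a :: rat, b :: rat). x \<in> T \<and> y \<in> T \<and> 0 < a \<and> 0 < b \<and> edist X x y < ?R a + ?R b}"
    for T
  define z where "z = (\<lambda>(x, y, a, b). SOME z. z \<in> points X \<and> edist X x z < ?R a \<and> edist X z y < ?R b)"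
  have z: "z (x, y, a, b) \<in> points X \<and> edist X x (z (x, y, a, b)) < ?R a \<and> edist X (z (x, y, a, b)) y < ?R b"
    if "(x, y, a, b) \<in> D (points X)" for x y a b
  proof -
    have "\<exists>z\<in>points X. edist X x z < ?R a \<and> edist X z y < ?R b"
      using that by (intro splitsD[OF Xm(2)]) (auto simp: D_def ennreal_less_zero_iff)
    from someI_ex[OF this[unfolded Bex_def]] show ?thesis by (simp add: z_def)
  qed
  define step where "step T = T \<union> z ` D T" for T
  have Suc_step: "(step ^^ Suc n) S = (step ^^ n) S \<union> z ` D ((step ^^ n) S)" for n
    by (simp add: step_def[of "(step ^^ n) S"])
  define T where "T = (\<Union>n. (step ^^ n) S)"
  have n: "countable ((step ^^ n) S) \<and> (step ^^ n) S \<subseteq> points X" for n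
  proof (induction n)
    case (Suc n)
    let ?T = "(step ^^ n) S"
    have "countable (?T \<times> ?T \<times> (UNIV :: rat set) \<times> (UNIV :: rat set))"
      using Suc by (intro countable_SIGMA) auto
    moreover have "D ?T \<subseteq> ?T \<times> ?T \<times> UNIV \<times> UNIV" by (auto simp: D_def)
    ultimately have "countable (D ?T)" using countable_subset by blast
    moreover have "D ?T \<subseteq> D (points X)" using Suc by (auto simp: D_def)
    then have "z ` D ?T \<subseteq> points X" using z by (auto 0 3)
    ultimately show ?case using Suc unfolding Suc_step by simp
  qed (use S in simp)
  have T: "countable T" "T \<subseteq> points X" using n by (auto simp: T_def)
  have ST: "S \<subseteq> T" unfolding T_def by (rule UN_upper[of 0 UNIV "\<lambda>n. (step ^^ n) S", simplified])
  have mono: "(step ^^ i) S \<subseteq> (step ^^ j) S" if "i \<le> j" for i j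
    using that by (induction j rule: dec_induct) (use Suc_step in blast)+
  let ?V = "X\<lparr>points := closure_in X T\<rparr>"
  have Vm: "is_emetric ?V" by (rule is_emetric_subspace[OF Xm(1)]) (auto simp: closure_in_def)
  have "splits (points ?V) (edist ?V)"
  proof (rule splits_of_dense[OF Vm, of "\<lambda>x. x" T])
    show "dense_in ?V ((\<lambda>x. x) ` T)" using dense_in_closure[OF Xm(1) T(2)] by simp
    fix p q and a b :: rat
    assume pq: "p \<in> T" "q \<in> T" and ab: "0 < a" "0 < b" and lt: "edist ?V p q < ?R a + ?R b"
    obtain i j where "p \<in> (step ^^ i) S" "q \<in> (step ^^ j) S" using pq by (auto simp: T_def)
    then have "p \<in> (step ^^ max i j) S" "q \<in> (step ^^ max i j) S"
      using mono[of i "max i j"] mono[of j "max i j"] by auto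
    then have D: "(p, q, a, b) \<in> D ((step ^^ max i j) S)" using ab lt by (simp add: D_def)
    then have "z (p, q, a, b) \<in> (step ^^ Suc (max i j)) S" unfolding Suc_step by blast
    then have "z (p, q, a, b) \<in> T" unfolding T_def by blast
    moreover have "(p, q, a, b) \<in> D (points X)" using D n by (auto simp: D_def)
    ultimately show "\<exists>w\<in>T. edist ?V p w < ?R a \<and> edist ?V w q < ?R b"
      using z[of p q a b] by (intro bexI[of _ "z (p, q, a, b)"]) auto
  qed
  then have "splits (closure_in X T) (edist X)" by simp
  with T ST that show thesis by blast
qed

section \<open>A small set of generators\<close>

text \<open>
  Rational upper bounds encode the distances, so that a code is a subset of a countable set and
  there are few codes. The subset \<open>N\<close> of indices makes room for the empty space.
\<close>
definition distance_code :: "'a emetric \<Rightarrow> nat set \<Rightarrow> (nat \<Rightarrow> 'a) \<Rightarrow> (nat \<times> nat \<times> rat) set" where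
  "distance_code A N s = {(i, j, q). i \<in> N \<and> j \<in> N \<and> edist A (s i) (s j) < ennreal (real_of_rat q)}"

definition coded :: "(nat \<times> nat \<times> rat) set \<Rightarrow> 'u emetric \<Rightarrow> bool" where
  "coded K A \<longleftrightarrow> A \<in> Obj CPMet \<and> (\<exists>N s. dense_in A (s ` N) \<and> K = distance_code A N s)"

text \<open>
  The code determines \<open>N\<close>, from the triples \<open>(i, i, 1)\<close>, and the distances between the dense
  families. So \<open>s i \<mapsto> t i\<close> and \<open>t i \<mapsto> s i\<close> both extend to non-expansive maps, and these are
  inverse to each other since they are so on dense subsets.
\<close>
lemma coded_isometry:
  assumes "coded K A" "coded K B"
  obtains h where "h ` points A = points B"
    "\<And>x y. x \<in> points A \<Longrightarrow> y \<in> points A \<Longrightarrow> edist B (h x) (h y) = edist A x y"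
proof -
  obtain N s where A: "A \<in> Obj CPMet" and s: "dense_in A (s ` N)" "K = distance_code A N s"
    using assms(1) unfolding coded_def by blast
  obtain M t where B: "B \<in> Obj CPMet" and t: "dense_in B (t ` M)" "K = distance_code B M t"
    using assms(2) unfolding coded_def by blast
  have Am: "is_emetric A" "ecomplete A" and Bm: "is_emetric B" "ecomplete B"
    using A B by (auto simp: Obj_CPMet)
  have sA: "s i \<in> points A" if "i \<in> N" for i using s(1) that unfolding dense_in_def by blast
  have tB: "t i \<in> points B" if "i \<in> M" for i using t(1) that unfolding dense_in_def by blast
  have N: "i \<in> N \<longleftrightarrow> (i, i, 1) \<in> K" for i
    unfolding s(2) distance_code_def using emetric_refl[OF Am(1) sA] by auto
  have M: "i \<in> M \<longleftrightarrow> (i, i, 1) \<in> K" for i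
    unfolding t(2) distance_code_def using emetric_refl[OF Bm(1) tB] by auto
  have NM: "M = N" using N M by blast
  have dist: "edist B (t i) (t j) = edist A (s i) (s j)" if "i \<in> N" "j \<in> N" for i j
  proof (rule ennreal_eqI_rat)
    fix q :: rat
    have "(i, j, q) \<in> distance_code B M t \<longleftrightarrow> (i, j, q) \<in> distance_code A N s" using s(2) t(2) by simp
    then show "edist B (t i) (t j) < ennreal (real_of_rat q) \<longleftrightarrow> edist A (s i) (s j) < ennreal (real_of_rat q)"
      using that NM by (simp add: distance_code_def)
  qed
  have tN: "t ` N \<subseteq> points B" "s ` N \<subseteq> points A" using tB sA NM by blast+
  note t1 = t(1)[unfolded NM]
  obtain h where h: "h \<in> points A \<rightarrow>\<^sub>E points B"
    "\<And>x y. x \<in> points A \<Longrightarrow> y \<in> points A \<Longrightarrow> edist B (h x) (h y) \<le> edist A x y"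
    "\<And>i. i \<in> N \<Longrightarrow> h (s i) = t i"
    using nonexpansive_extension[OF Am(1) Bm s(1) tN(1)] dist by (metis order.refl)
  obtain k where k: "k \<in> points B \<rightarrow>\<^sub>E points A"
    "\<And>x y. x \<in> points B \<Longrightarrow> y \<in> points B \<Longrightarrow> edist A (k x) (k y) \<le> edist B x y"
    "\<And>i. i \<in> N \<Longrightarrow> k (t i) = s i"
    using nonexpansive_extension[OF Bm(1) Am t1 tN(2)] dist by (metis order.refl)
  have hB: "h x \<in> points B" if "x \<in> points A" for x using h(1) that by blast
  have kA: "k x \<in> points A" if "x \<in> points B" for x using k(1) that by blast
  have kh: "k (h x) = x" if x: "x \<in> points A" for x
    by (rule nonexpansive_eq_on_dense[OF Am(1) Am(1) s(1), of "\<lambda>x. k (h x)" "\<lambda>x. x"])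
      (use x hB kA h(3) k(3) order_trans[OF k(2)[OF hB hB] h(2)] in \<open>auto simp: nonexpansive_def\<close>)
  have hk: "h (k x) = x" if x: "x \<in> points B" for x
    by (rule nonexpansive_eq_on_dense[OF Bm(1) Bm(1) t1, of "\<lambda>x. h (k x)" "\<lambda>x. x"])
      (use x hB kA h(3) k(3) order_trans[OF h(2)[OF kA kA] k(2)] in \<open>auto simp: nonexpansive_def\<close>)
  show thesis
  proof (rule that)
    show "h ` points A = points B" using hB kA hk by (force simp: image_iff)
    show "edist B (h x) (h y) = edist A x y" if "x \<in> points A" "y \<in> points A" for x y
      using h(2)[OF that] k(2)[OF hB hB, OF that] kh that by (intro antisym) auto
  qed
qed

lemma coded_separable:
  assumes A: "A \<in> Obj CPMet" and S: "countable S" "dense_in A S"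
  shows "\<exists>K. coded K A"
proof -
  obtain N :: "nat set" and s where "S = s ` N"
    using S(1) by (metis countable_image_inj_eq image_empty range_from_nat_into)
  then show ?thesis using A S(2) unfolding coded_def by blast
qed

definition generators :: "'u emetric set" where
  "generators = {SOME A. coded K A | K. \<exists>A :: 'u emetric. coded K A}"

lemma small_generators:
  assumes "universe_type TYPE('u)"
  shows "small TYPE('u) (generators :: 'u emetric set)"
proof (rule small_subset)
  show "(generators :: 'u emetric set) \<subseteq> range (\<lambda>K. SOME A. coded K A)" by (auto simp: generators_def)
  show "small TYPE('u) (range (\<lambda>K. SOME A :: 'u emetric. coded K A))"
    by (rule small_image[OF small_sets_of_countable[OF assms]])
qed

lemma generators_presentable:
  assumes U: "universe_type TYPE('u)" and A: "(A :: 'u emetric) \<in> generators"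
  shows "presentable TYPE('u) aleph_one CPMet A"
proof -
  obtain K where K: "A = (SOME A. coded K A)" "\<exists>A :: 'u emetric. coded K A"
    using A unfolding generators_def by blast
  have "coded K A" unfolding K(1) by (rule someI_ex[OF K(2)])
  then obtain N :: "nat set" and s where "A \<in> Obj CPMet" "dense_in A (s ` N)" unfolding coded_def by blast
  then show ?thesis by (intro presentable_separable[OF U, of A "s ` N"]) auto
qed

lemma isometric_generator:
  fixes A :: "'u emetric"
  assumes A: "A \<in> Obj CPMet" and S: "countable S" "dense_in A S"
  obtains B :: "'u emetric" and h where "B \<in> generators" "B \<in> Obj CPMet" "h ` points B = points A"
    "\<And>x y. x \<in> points B \<Longrightarrow> y \<in> points B \<Longrightarrow> edist A (h x) (h y) = edist B x y"
proof -
  obtain K where K: "coded K A" using coded_separable[OF A S] by blast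
  define B where "B = (SOME A :: 'u emetric. coded K A)"
  have B: "coded K B" unfolding B_def by (rule someI[of "coded K", OF K])
  have B': "B \<in> generators" "B \<in> Obj CPMet"
    using K B unfolding generators_def B_def coded_def by blast+
  show thesis by (rule coded_isometry[OF B K]) (rule that[OF B'])
qed

text \<open>
  The index set consists of the closures of countable subsets that are splitting, ordered by
  inclusion. It is small since these subsets are ranges of sequences, or empty. Countably many
  of the closures lie in a splitting hull of the union of their countable dense subsets.
\<close>
lemma colimit_of_generators:
  assumes U: "universe_type TYPE('u)" and X: "(X :: 'u emetric) \<in> Obj CPMet"
  obtains I :: "'u set" and r Fo Fa \<iota> where "directed_poset aleph_one I r" "small TYPE('u) I"
    "is_functor (poset_cat I r) CPMet Fo Fa" "Fo ` I \<subseteq> generators"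
    "is_colimit (poset_cat I r) CPMet Fo Fa X \<iota>"
proof -
  have Xm: "is_emetric X" "small TYPE('u) (points X)" using X by (auto simp: Obj_CPMet)
  define \<Y> where "\<Y> = closure_in X ` {S. countable S \<and> S \<subseteq> points X \<and> splits (closure_in X S) (edist X)}"
  have "small TYPE('u) \<Y>"
  proof (rule small_subset)
    show "\<Y> \<subseteq> closure_in X ` insert {} (range ` {s :: nat \<Rightarrow> 'u. range s \<subseteq> points X})"
      unfolding \<Y>_def
    proof (rule image_mono, rule subsetI)
      fix S assume S: "S \<in> {S. countable S \<and> S \<subseteq> points X \<and> splits (closure_in X S) (edist X)}"
      show "S \<in> insert {} (range ` {s :: nat \<Rightarrow> 'u. range s \<subseteq> points X})"
      proof (cases "S = {}")
        case False
        then have "S = range (from_nat_into S)" using S by (simp add: range_from_nat_into)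
        then show ?thesis using S by blast
      qed simp
    qed
    show "small TYPE('u) (closure_in X ` insert {} (range ` {s :: nat \<Rightarrow> 'u. range s \<subseteq> points X}))"
      by (intro small_image small_insert[OF U] small_sequences[OF U Xm(2)])
  qed
  \<comment> \<open>The index poset has to consist of elements of \<open>'u\<close>, which serve as names of the subspaces.\<close>
  then obtain e :: "'u set \<Rightarrow> 'u" where e: "inj_on e \<Y>" using small_imp_inj_on by blast
  define I where "I = e ` \<Y>"
  define Y where "Y = inv_into \<Y> e"
  have I: "small TYPE('u) I" unfolding I_def by (rule small_image) fact
  have Y_in: "Y i \<in> \<Y>" if "i \<in> I" for i using that unfolding I_def Y_def by (rule inv_into_into)
  have Y_e: "e V \<in> I" "Y (e V) = V" if "V \<in> \<Y>" for V using that e by (auto simp: I_def Y_def)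
  have Y_inj: "i = j" if "i \<in> I" "j \<in> I" "Y i = Y j" for i j
    using that unfolding I_def Y_def by (metis inv_into_injective)
  have YX: "Y i \<subseteq> points X" if "i \<in> I" for i using Y_in[OF that] by (auto simp: \<Y>_def closure_in_def)
  define r where "r = {(i, j). i \<in> I \<and> j \<in> I \<and> Y i \<subseteq> Y j}"
  have hull: "\<exists>k\<in>I. S \<subseteq> Y k \<and> closure_in X S \<subseteq> Y k" if S: "countable S" "S \<subseteq> points X" for S
  proof -
    obtain T where T: "countable T" "S \<subseteq> T" "T \<subseteq> points X" "splits (closure_in X T) (edist X)"
      using splitting_hull[OF X S] .
    then have "closure_in X T \<in> \<Y>" by (auto simp: \<Y>_def)
    moreover have "S \<subseteq> closure_in X T" using subset_closure_in[OF Xm(1) T(3)] T(2) by blast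
    ultimately show ?thesis using Y_e closure_in_mono[OF T(2), of X] by metis
  qed
  have bound: "\<exists>b\<in>I. \<forall>i\<in>J. Y i \<subseteq> Y b" if J: "countable J" "J \<subseteq> I" for J
  proof -
    have "\<exists>S. countable S \<and> S \<subseteq> points X \<and> Y i = closure_in X S" if "i \<in> J" for i
      using Y_in[of i] J(2) that by (auto simp: \<Y>_def)
    then obtain S where S: "\<And>i. i \<in> J \<Longrightarrow> countable (S i) \<and> S i \<subseteq> points X \<and> Y i = closure_in X (S i)"
      by metis
    have "countable (\<Union>i\<in>J. S i)" "(\<Union>i\<in>J. S i) \<subseteq> points X" using J(1) S by auto
    from hull[OF this] obtain b where b: "b \<in> I" "closure_in X (\<Union>i\<in>J. S i) \<subseteq> Y b" by blast
    have "Y i \<subseteq> Y b" if "i \<in> J" for i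
      using S[OF that] closure_in_mono[of "S i" "\<Union>i\<in>J. S i" X] b(2) that by blast
    with b(1) show ?thesis by blast
  qed
  have directed: "directed_poset aleph_one I r"
    unfolding directed_poset_def less_aleph_one_iff
  proof (intro conjI allI impI)
    show "partial_order_on I r"
      unfolding partial_order_on_def preorder_on_def refl_on_def trans_def antisym_def
      using Y_inj by (auto simp: r_def)
    fix J assume J: "J \<subseteq> I \<and> countable J"
    then obtain b where "b \<in> I" "\<forall>i\<in>J. Y i \<subseteq> Y b" using bound by blast
    then show "\<exists>b\<in>I. \<forall>s\<in>J. (s, b) \<in> r" using J unfolding r_def by blast
  qed
  have "\<exists>(B :: 'u emetric) m. B \<in> generators \<and> B \<in> Obj CPMet \<and> m ` points B = Y i \<and>
      (\<forall>x\<in>points B. \<forall>y\<in>points B. edist X (m x) (m y) = edist B x y)" if i: "i \<in> I" for i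
  proof -
    obtain S where S: "countable S" "S \<subseteq> points X" "splits (closure_in X S) (edist X)" "Y i = closure_in X S"
      using Y_in[OF i] by (auto simp: \<Y>_def)
    obtain B :: "'u emetric" and m where "B \<in> generators" "B \<in> Obj CPMet" "m ` points B = points (X\<lparr>points := closure_in X S\<rparr>)"
      "\<And>x y. x \<in> points B \<Longrightarrow> y \<in> points B \<Longrightarrow> edist (X\<lparr>points := closure_in X S\<rparr>) (m x) (m y) = edist B x y"
      by (rule isometric_generator[OF closure_in_Obj[OF X S(2,3)] S(1) dense_in_closure[OF Xm(1) S(2)]]) blast
    then show ?thesis using S(4) by (intro exI[of _ B] exI[of _ m]) simp
  qed
  then obtain Fo :: "'u \<Rightarrow> 'u emetric" and m where Fo: "\<And>i. i \<in> I \<Longrightarrow> Fo i \<in> generators" "\<And>i. i \<in> I \<Longrightarrow> Fo i \<in> Obj CPMet"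
    "\<And>i. i \<in> I \<Longrightarrow> m i ` points (Fo i) = Y i"
    "\<And>i x y. i \<in> I \<Longrightarrow> x \<in> points (Fo i) \<Longrightarrow> y \<in> points (Fo i) \<Longrightarrow> edist X (m i x) (m i y) = edist (Fo i) x y"
    by metis
  have cover: "\<exists>i\<in>I. x \<in> Y i \<and> y \<in> Y i" if "x \<in> points X" "y \<in> points X" for x y
    using hull[of "{x, y}"] that by auto
  have dir: "\<exists>k\<in>I. Y i \<subseteq> Y k \<and> Y j \<subseteq> Y k" if "i \<in> I" "j \<in> I" for i j
    using bound[of "{i, j}"] that by auto
  obtain Fa \<iota> where "is_functor (poset_cat I r) CPMet Fo Fa" "is_colimit (poset_cat I r) CPMet Fo Fa X \<iota>"
    using union_colimit[OF X Fo(2) r_def Fo(3,4) YX cover dir] by blast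
  moreover have "Fo ` I \<subseteq> generators" using Fo(1) by blast
  ultimately show thesis using that directed I by blast
qed

theorem theorem3p6:
  assumes "universe_type TYPE('u)"
  shows "locally_presentable TYPE('u) aleph_one
           (CPMet :: ('u emetric, ('u emetric, 'u) morphism) cat)"
  unfolding locally_presentable_def
proof (intro conjI exI[of _ generators] ballI)
  show "regular_cardinal aleph_one" by (rule regular_cardinal_aleph_one)
  show "category (CPMet :: ('u emetric, ('u emetric, 'u) morphism) cat)" by (rule category_CPMet)
  show "cocomplete TYPE('u) (CPMet :: ('u emetric, ('u emetric, 'u) morphism) cat)"
    by (rule cocomplete_CPMet[OF assms])
  show "small TYPE('u) (generators :: 'u emetric set)" by (rule small_generators[OF assms])
  show "presentable TYPE('u) aleph_one CPMet A" if "A \<in> generators" for A :: "'u emetric"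
    by (rule generators_presentable[OF assms that])
  fix X :: "'u emetric" assume "X \<in> Obj CPMet"
  then show "\<exists>(I :: 'u set) r Fo Fa \<iota>.
      directed_poset aleph_one I r \<and> small TYPE('u) I \<and> is_functor (poset_cat I r) CPMet Fo Fa \<and>
      Fo ` I \<subseteq> generators \<and> is_colimit (poset_cat I r) CPMet Fo Fa X \<iota>"
    by (rule colimit_of_generators[OF assms]) blast
qed

end
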